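(* Let $n\geq1$ be an integer, $\varphi\in\Sigma_n$, $0<p<\frac4n$, and let $\varphi_+,\varphi_-\in L^2(\mathbb{R}^n)$ be such that $$\|u_\varphi(t,\cdot)-e^{it\Delta}\varphi_\pm\|_{L^2(\mathbb{R}^n)}\longrightarrow0\quad\text{as } t\to\pm\infty .$$ Let $w_\varphi$ be the pseudo-conformal transformation of $u_\varphi$, $$w_\varphi(t,x)=\frac1{t^{n/2}}\,\overline{u_\varphi}\Big(\frac1t,\frac xt\Big)e^{i\frac{|x|^2}{4t}},\qquad t\neq0,\ x\in\mathbb{R}^n,$$ and let $w_\varphi^+,w_\varphi^-\in L^2(\mathbb{R}^n)$ be the functions such that $$\|w_\varphi(t,\cdot)-w_\varphi^\pm\|_{L^2(\mathbb{R}^n)}\longrightarrow0\quad\text{as } t\to0^\pm .$$ Then the following equivalence holds (for each choice of sign): $$\int_{\mathbb{R}^n}|x|^2|\varphi_\pm|^2dx<\infty\iff w_\varphi^\pm\in\dot H^1(\mathbb{R}^n).$$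
   Context: $\Sigma_n=\{\varphi\in H^1(\mathbb{R}^n): \int_{\mathbb{R}^n}|x|^2|\varphi|^2dx<\infty\}$ (complex-valued functions), with norm $\|\varphi\|_{\Sigma_n}^2=\int_{\mathbb{R}^n}(|\nabla\varphi|^2+|\varphi|^2+|x|^2|\varphi|^2)\,dx$. For $\varphi\in H^1(\mathbb{R}^n)$ and $p$ given with $0<p<\frac4{n-2}$ if $n\ge3$ and $0<p<\infty$ if $n=1,2$, $u_\varphi(t,x)$ denotes the unique global solution (continuous in $t\in\mathbb{R}$ with values in $H^1(\mathbb{R}^n)$) of the defocusing nonlinear Schrödinger equation $i\partial_tu+\Delta u-u|u|^p=0$, $(t,x)\in\mathbb{R}\times\mathbb{R}^n$, $u(0,\cdot)=\varphi$. $e^{it\Delta}$ is the free Schrödinger group, i.e. $e^{it\Delta}h$ solves $i\partial_tv+\Delta v=0$, $v(0)=h$. For $t<0$, $t^{n/2}$ is understood with a fixed branch of the power. For $w\in L^2(\mathbb{R}^n)$, $w\in\dot H^1(\mathbb{R}^n)$ means that the distributional gradient $\nabla w$ belongs to $L^2(\mathbb{R}^n)$. Statements with $\pm$ are to be read once with all upper signs and once with all lower signs. *)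

theory Defs
  imports "HOL-Analysis.Analysis"
begin

text \<open>
  Elements of the function spaces are represented by Borel functions \<open>real ^ 'n \<Rightarrow> complex\<close> with
  \<open>n = CARD('n)\<close>; every Lebesgue class contains a Borel function. All notions below depend only on
  the class of a function modulo null sets.
\<close>

definition L2 :: "(real ^ 'n \<Rightarrow> complex) set" where
  "L2 = {f. f \<in> borel_measurable lborel \<and> integrable lborel (\<lambda>x. (cmod (f x))\<^sup>2)}"

definition L2_norm :: "(real ^ 'n \<Rightarrow> complex) \<Rightarrow> real" where
  "L2_norm f = sqrt (\<integral>x. (cmod (f x))\<^sup>2 \<partial>lborel)"

definition finite_second_moment :: "(real ^ 'n \<Rightarrow> complex) \<Rightarrow> bool" where
  "finite_second_moment f \<longleftrightarrow> integrable lborel (\<lambda>x. (norm x)\<^sup>2 * (cmod (f x))\<^sup>2)"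

definition partial :: "'n \<Rightarrow> (real ^ 'n \<Rightarrow> complex) \<Rightarrow> real ^ 'n \<Rightarrow> complex" where
  "partial j f x = frechet_derivative f (at x) (axis j 1)"

definition laplacian :: "(real ^ 'n \<Rightarrow> complex) \<Rightarrow> real ^ 'n \<Rightarrow> complex" where
  "laplacian f x = (\<Sum>j\<in>UNIV. partial j (partial j f) x)"

primrec C_diff :: "nat \<Rightarrow> (real ^ 'n \<Rightarrow> complex) \<Rightarrow> bool" where
  "C_diff 0 f \<longleftrightarrow> continuous_on UNIV f"
| "C_diff (Suc m) f \<longleftrightarrow> f differentiable_on UNIV \<and> (\<forall>j. C_diff m (partial j f))"

definition test_functions :: "(real ^ 'n \<Rightarrow> complex) set" where
  "test_functions = {\<theta>. (\<forall>m. C_diff m \<theta>) \<and> compact (closure {x. \<theta> x \<noteq> 0})}"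

definition L2_gradient :: "(real ^ 'n \<Rightarrow> complex) \<Rightarrow> ('n \<Rightarrow> real ^ 'n \<Rightarrow> complex) \<Rightarrow> bool" where
  "L2_gradient f G \<longleftrightarrow>
     (\<forall>j. G j \<in> L2 \<and>
        (\<forall>\<theta>\<in>test_functions. (\<integral>x. f x * partial j \<theta> x \<partial>lborel) = - (\<integral>x. G j x * \<theta> x \<partial>lborel)))"

text \<open>Meant for functions \<open>f \<in> L2\<close>: the distributional gradient belongs to \<open>L\<^sup>2\<close>.\<close>

definition in_H1_dot :: "(real ^ 'n \<Rightarrow> complex) \<Rightarrow> bool" where
  "in_H1_dot f \<longleftrightarrow> (\<exists>G. L2_gradient f G)"

definition H1 :: "(real ^ 'n \<Rightarrow> complex) set" where
  "H1 = {f \<in> L2. in_H1_dot f}"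

text \<open>The distributional gradient is unique modulo null sets, so the choice below is harmless.\<close>

definition weak_gradient :: "(real ^ 'n \<Rightarrow> complex) \<Rightarrow> 'n \<Rightarrow> real ^ 'n \<Rightarrow> complex" where
  "weak_gradient f = (SOME G. L2_gradient f G)"

definition H1_norm :: "(real ^ 'n \<Rightarrow> complex) \<Rightarrow> real" where
  "H1_norm f = sqrt ((L2_norm f)\<^sup>2 + (\<Sum>j\<in>UNIV. (L2_norm (weak_gradient f j))\<^sup>2))"

definition Sigma_space :: "(real ^ 'n \<Rightarrow> complex) set" where
  "Sigma_space = {f \<in> H1. finite_second_moment f}"

definition continuous_in_L2 :: "(real \<Rightarrow> real ^ 'n \<Rightarrow> complex) \<Rightarrow> bool" where
  "continuous_in_L2 u \<longleftrightarrow>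
     (\<forall>t. u t \<in> L2) \<and> (\<forall>t. ((\<lambda>s. L2_norm (\<lambda>x. u s x - u t x)) \<longlongrightarrow> 0) (at t))"

definition continuous_in_H1 :: "(real \<Rightarrow> real ^ 'n \<Rightarrow> complex) \<Rightarrow> bool" where
  "continuous_in_H1 u \<longleftrightarrow>
     (\<forall>t. u t \<in> H1) \<and> (\<forall>t. ((\<lambda>s. H1_norm (\<lambda>x. u s x - u t x)) \<longlongrightarrow> 0) (at t))"

text \<open>
  \<open>\<i> \<partial>\<^sub>t u + \<Delta> u - F(u) = 0\<close> in the sense of distributions on \<open>\<real>\<^sup>n\<close>, at every time \<open>t\<close>. This is the
  usual notion of solution for curves that are continuous in \<open>H\<^sup>1\<close> (or in \<open>L\<^sup>2\<close> if \<open>F = 0\<close>), where the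
  equation is an identity in \<open>H\<^sup>-\<^sup>1\<close> (respectively \<open>H\<^sup>-\<^sup>2\<close>). For \<open>F z = z |z|\<^sup>p\<close> with energy-subcritical
  \<open>p\<close>, \<open>F(u(t))\<close> is locally integrable by the Sobolev embedding.
\<close>

definition schroedinger_equation ::
    "(complex \<Rightarrow> complex) \<Rightarrow> (real \<Rightarrow> real ^ 'n \<Rightarrow> complex) \<Rightarrow> bool" where
  "schroedinger_equation F u \<longleftrightarrow>
     (\<forall>\<theta>\<in>test_functions. \<forall>t. \<exists>D.
        ((\<lambda>s. \<integral>x. u s x * \<theta> x \<partial>lborel) has_vector_derivative D) (at t) \<and>
        \<i> * D + (\<integral>x. u t x * laplacian \<theta> x \<partial>lborel) - (\<integral>x. F (u t x) * \<theta> x \<partial>lborel) = 0)"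

text \<open>\<open>u\<close> is the global solution \<open>u\<^sub>\<phi>\<close> of the defocusing equation (unique modulo null sets).\<close>

definition nls_solution ::
    "real \<Rightarrow> (real ^ 'n \<Rightarrow> complex) \<Rightarrow> (real \<Rightarrow> real ^ 'n \<Rightarrow> complex) \<Rightarrow> bool" where
  "nls_solution p \<phi> u \<longleftrightarrow>
     continuous_in_H1 u \<and>
     schroedinger_equation (\<lambda>z. z * of_real (cmod z powr p)) u \<and>
     (AE x in lborel. u 0 x = \<phi> x)"

text \<open>\<open>v t\<close> is \<open>e\<^sup>i\<^sup>t\<^sup>\<Delta> h\<close>: the solution of the free equation with datum \<open>h\<close>, which is unique among
  \<open>L\<^sup>2\<close>-continuous curves.\<close>

definition free_evolution ::
    "(real ^ 'n \<Rightarrow> complex) \<Rightarrow> (real \<Rightarrow> real ^ 'n \<Rightarrow> complex) \<Rightarrow> bool" where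
  "free_evolution h v \<longleftrightarrow>
     continuous_in_L2 v \<and> schroedinger_equation (\<lambda>z. 0) v \<and> (AE x in lborel. v 0 x = h x)"

text \<open>\<open>t\<^sup>n\<^sup>/\<^sup>2\<close>: the positive power for \<open>t > 0\<close>, and for \<open>t < 0\<close> the branch in which the argument of
  \<open>t\<close> is \<open>(2 * k + 1) * pi\<close>.\<close>

definition half_power :: "int \<Rightarrow> nat \<Rightarrow> real \<Rightarrow> complex" where
  "half_power k n t =
     (if t > 0 then of_real (t powr (real n / 2))
      else of_real (\<bar>t\<bar> powr (real n / 2)) * cis ((2 * real_of_int k + 1) * pi * (real n / 2)))"

definition pseudo_conformal ::
    "int \<Rightarrow> (real \<Rightarrow> real ^ 'n \<Rightarrow> complex) \<Rightarrow> real \<Rightarrow> real ^ 'n \<Rightarrow> complex" where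
  "pseudo_conformal k u t x =
     1 / half_power k CARD('n) t * cnj (u (1 / t) ((1 / t) *\<^sub>R x)) *
     exp (\<i> * of_real ((norm x)\<^sup>2 / (4 * t)))"

end

theory Submission
  imports Defs "HOL-Computational_Algebra.Polynomial"
begin

text \<open>
  For the free equation a Galilean boost with velocity \<open>2 \<eta>\<close> in direction \<open>j\<close> multiplies the initial
  datum by \<open>exp (\<i> \<eta> x\<^sub>j)\<close>, and the pseudo-conformal transformation turns this boost into the
  translation by \<open>2 \<eta> e\<^sub>j\<close>. Both the transformation and the free flow are isometries of \<open>L\<^sup>2\<close>, so the
  map from scattering state to limit \<open>w\<close> is an isometry that intertwines modulations with
  translations: the difference quotients of \<open>w\<close> and those of \<open>\<eta> \<mapsto> exp (\<i> \<eta> x\<^sub>j) \<phi>\<close> have equal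
  norms, and they are bounded (equivalently, convergent) iff \<open>\<nabla>w \<in> L\<^sup>2\<close>, respectively \<open>x \<phi> \<in> L\<^sup>2\<close>.
  Mass conservation for weak free solutions \<open>v\<close> is obtained by differentiating \<open>\<integral>\<integral> v(x) cnj(v(y)) K(x - y) dx dy\<close> for a
  Hermitian test kernel \<open>K\<close> and letting \<open>K\<close> shrink to a point mass.
\<close>

subsection \<open>Square-integrable functions\<close>

text \<open>The free flow is available only as an \<open>L2\<close>-continuous distributional
  solution, without a Fourier representation and without an operator that could be applied to new
  data. Solutions with modulated data are therefore manufactured from the given one: its Galilean
  boost is checked to be a weak solution again. The complex conjugate in the transformation makes
  the correspondence antilinear, so only real linear combinations are taken. Mass conservation is
  delicate because \<open>cnj (v t)\<close> is no admissible test function and \<open>v t\<close>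
  has no derivatives. Pairing through \<open>K (x - y)\<close> puts both Laplacians on
  \<open>K\<close>, and Hermitian symmetry makes the two contributions cancel. In the final
  comparison the two directions differ. A finite moment gives strong convergence of the quotients of
  the datum, hence a Cauchy sequence and a limit on the other side. A gradient of \<open>w\<close>
  gives only a uniform bound, from which Fatou's lemma recovers the moment.\<close>

lemma L2_iff:
  "f \<in> L2 \<longleftrightarrow> f \<in> borel_measurable borel \<and> integrable lborel (\<lambda>x. (cmod (f x))\<^sup>2)"
  by (simp add: L2_def)

lemma L2_measurable [measurable_dest]: "f \<in> L2 \<Longrightarrow> f \<in> borel_measurable borel"
  by (simp add: L2_iff)

lemma L2_square_integrable: "f \<in> L2 \<Longrightarrow> integrable lborel (\<lambda>x. (cmod (f x))\<^sup>2)"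
  by (simp add: L2_iff)

lemma L2_norm_nonneg [simp]: "0 \<le> L2_norm f"
  by (simp add: L2_norm_def)

lemma L2_norm_power2: "(L2_norm f)\<^sup>2 = (\<integral>x. (cmod (f x))\<^sup>2 \<partial>lborel)"
  by (simp add: L2_norm_def)

lemma L2_dominated:
  assumes "f \<in> borel_measurable borel" "integrable lborel g" "\<And>x. (cmod (f x))\<^sup>2 \<le> g x"
  shows "f \<in> L2"
  unfolding L2_iff
proof
  show "integrable lborel (\<lambda>x. (cmod (f x))\<^sup>2)"
    by (rule Bochner_Integration.integrable_bound[OF assms(2)])
       (use assms in \<open>auto intro: order_trans[OF _ abs_ge_self]\<close>)
qed fact

lemma L2_mult_bounded:
  assumes "f \<in> L2" "g \<in> borel_measurable borel" "\<And>x. cmod (g x) \<le> C"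
  shows "(\<lambda>x. g x * f x) \<in> L2"
proof (rule L2_dominated[where g = "\<lambda>x. C\<^sup>2 * (cmod (f x))\<^sup>2"])
  note [measurable] = assms(2) L2_measurable[OF assms(1)]
  show "(\<lambda>x. g x * f x) \<in> borel_measurable borel" by measurable
  show "integrable lborel (\<lambda>x. C\<^sup>2 * (cmod (f x))\<^sup>2)"
    using L2_square_integrable[OF assms(1)] by simp
  show "(cmod (g x * f x))\<^sup>2 \<le> C\<^sup>2 * (cmod (f x))\<^sup>2" for x
    using assms(3)[of x] by (simp add: norm_mult power_mult_distrib mult_right_mono power_mono)
qed

lemma L2_cmult: "f \<in> L2 \<Longrightarrow> (\<lambda>x. c * f x) \<in> L2"
  by (rule L2_mult_bounded[where C = "cmod c"]) auto

lemma cmod_add_power2_le: "(cmod (a + b))\<^sup>2 \<le> 2 * (cmod a)\<^sup>2 + 2 * (cmod b)\<^sup>2"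
proof -
  have "(cmod (a + b))\<^sup>2 \<le> (cmod a + cmod b)\<^sup>2"
    by (intro power_mono norm_triangle_ineq) auto
  also have "\<dots> \<le> 2 * (cmod a)\<^sup>2 + 2 * (cmod b)\<^sup>2"
    using sum_squares_bound[of "cmod a" "cmod b"] by (simp add: power2_sum)
  finally show ?thesis .
qed

lemma L2_add:
  assumes "f \<in> L2" "g \<in> L2"
  shows "(\<lambda>x. f x + g x) \<in> L2"
proof (rule L2_dominated[where g = "\<lambda>x. 2 * (cmod (f x))\<^sup>2 + 2 * (cmod (g x))\<^sup>2"])
  note [measurable] = L2_measurable[OF assms(1)] L2_measurable[OF assms(2)]
  show "(\<lambda>x. f x + g x) \<in> borel_measurable borel" by measurable
qed (use assms cmod_add_power2_le in \<open>auto simp: L2_iff\<close>)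

lemma L2_diff: "f \<in> L2 \<Longrightarrow> g \<in> L2 \<Longrightarrow> (\<lambda>x. f x - g x) \<in> L2"
  using L2_add[of f "\<lambda>x. - g x"] L2_cmult[of g "-1"] by simp

lemma L2_zero [simp]: "(\<lambda>x. 0) \<in> L2"
  by (simp add: L2_iff)

lemma L2_cnj [simp]: "f \<in> L2 \<Longrightarrow> (\<lambda>x. cnj (f x)) \<in> L2"
  unfolding L2_iff by (auto intro!: borel_measurable_continuous_on[where f = cnj] continuous_intros)

lemma L2_norm_cong_cmod: "(\<And>x. cmod (f x) = cmod (g x)) \<Longrightarrow> L2_norm f = L2_norm g"
  by (simp add: L2_norm_def)

lemma L2_norm_cnj [simp]: "L2_norm (\<lambda>x. cnj (f x)) = L2_norm f"
  by (rule L2_norm_cong_cmod) simp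

lemma L2_norm_minus_commute: "L2_norm (\<lambda>x. f x - g x) = L2_norm (\<lambda>x. g x - f x)"
  by (rule L2_norm_cong_cmod) (simp add: norm_minus_commute)

lemma L2_norm_cmult: "L2_norm (\<lambda>x. c * f x) = cmod c * L2_norm f"
  by (simp add: L2_norm_def norm_mult power_mult_distrib real_sqrt_mult)

lemma L2_norm_AE_cong:
  assumes "f \<in> L2" "g \<in> L2" "AE x in lborel. f x = g x"
  shows "L2_norm f = L2_norm g"
  unfolding L2_norm_def
  using assms by (intro arg_cong[where f = sqrt] integral_cong_AE) (auto simp: L2_def)

lemma L2_norm_mono:
  assumes "f \<in> borel_measurable borel" "g \<in> L2" "\<And>x. cmod (f x) \<le> C * cmod (g x)" "0 \<le> C"
  shows "L2_norm f \<le> C * L2_norm g"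
proof -
  have le: "(cmod (f x))\<^sup>2 \<le> C\<^sup>2 * (cmod (g x))\<^sup>2" for x
    using power_mono[OF assms(3)[of x], of 2] by (simp add: power_mult_distrib)
  have i: "integrable lborel (\<lambda>x. C\<^sup>2 * (cmod (g x))\<^sup>2)"
    using assms(2) by (simp add: L2_iff)
  have "(\<integral>x. (cmod (f x))\<^sup>2 \<partial>lborel) \<le> (\<integral>x. C\<^sup>2 * (cmod (g x))\<^sup>2 \<partial>lborel)"
    using L2_dominated[OF assms(1) i le] i le by (intro integral_mono) (auto simp: L2_iff)
  then have "(L2_norm f)\<^sup>2 \<le> (C * L2_norm g)\<^sup>2"
    by (simp add: L2_norm_power2 power_mult_distrib)
  then show ?thesis
    using assms(4) by (simp add: power2_le_iff_abs_le)
qed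

lemma L2_mult_integrable:
  assumes "f \<in> L2" "g \<in> L2"
  shows "integrable lborel (\<lambda>x. f x * g x)"
proof (rule Bochner_Integration.integrable_bound)
  show "integrable lborel (\<lambda>x. (cmod (f x))\<^sup>2 + (cmod (g x))\<^sup>2)"
    using assms by (simp add: L2_iff)
  show "(\<lambda>x. f x * g x) \<in> borel_measurable lborel"
    using assms by (auto simp: L2_iff intro: borel_measurable_times)
  show "AE x in lborel. norm (f x * g x) \<le> norm ((cmod (f x))\<^sup>2 + (cmod (g x))\<^sup>2)"
  proof (intro AE_I2)
    fix x
    show "norm (f x * g x) \<le> norm ((cmod (f x))\<^sup>2 + (cmod (g x))\<^sup>2)"
      using sum_squares_bound[of "cmod (f x)" "cmod (g x)"] mult_nonneg_nonneg[OF norm_ge_zero norm_ge_zero, of "f x" "g x"]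
      by (simp only: norm_mult real_norm_def)
  qed
qed

text \<open>Weighted AM-GM \<open>2 a b \<le> r a\<^sup>2 + b\<^sup>2 / r\<close>, optimised over \<open>r > 0\<close>.\<close>

lemma product_bound_from_AM_GM:
  fixes a b :: real
  assumes "\<And>r. r > 0 \<Longrightarrow> 2 * c \<le> r * a\<^sup>2 + b\<^sup>2 / r" "0 \<le> a" "0 \<le> b"
  shows "c \<le> a * b"
proof (rule field_le_epsilon)
  fix e :: real assume e: "0 < e"
  \<comment> \<open>Since \<open>a\<close> or \<open>b\<close> may be 0, the optimal ratio
    \<open>b / a\<close> is replaced by \<open>(b + d) / (a + d)\<close>; \<open>d\<close> is so
    small that the excess \<open>d * (a + b + d)\<close> is at most \<open>e\<close>.\<close>
  define d where "d = min 1 (e / (a + b + 1))"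
  have d: "0 < d" "d \<le> 1" using e assms(2,3) by (auto simp: d_def)
  have "d * (a + b + 1) \<le> e / (a + b + 1) * (a + b + 1)"
    using assms(2,3) by (intro mult_right_mono) (auto simp: d_def)
  then have d': "d * (a + b + 1) \<le> e" using assms(2,3) by simp
  have "2 * c \<le> (b + d) / (a + d) * a\<^sup>2 + b\<^sup>2 / ((b + d) / (a + d))"
    using d assms(2,3) by (intro assms(1)) auto
  also have "\<dots> \<le> (b + d) / (a + d) * (a + d)\<^sup>2 + (b + d)\<^sup>2 / ((b + d) / (a + d))"
    using d assms(2,3) by (intro add_mono mult_left_mono divide_right_mono power_mono) auto
  also have "\<dots> = 2 * ((a + d) * (b + d))"
    using d assms(2,3) by (simp add: power2_eq_square add_pos_nonneg add_nonneg_pos)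
  finally have "c \<le> (a + d) * (b + d)" by simp
  also have "\<dots> = a * b + d * (a + b + d)" by (simp add: algebra_simps)
  also have "\<dots> \<le> a * b + d * (a + b + 1)" using d by simp
  finally show "c \<le> a * b + e" using d' by simp
qed

lemma weighted_AM_GM:
  fixes a b r :: real
  assumes "r > 0"
  shows "2 * (a * b) \<le> r * a\<^sup>2 + b\<^sup>2 / r"
proof -
  have "0 \<le> (r * a - b)\<^sup>2 / r" using assms by simp
  also have "\<dots> = r * a\<^sup>2 + b\<^sup>2 / r - 2 * (a * b)"
    using assms by (simp add: field_simps power2_eq_square)
  finally show ?thesis by simp
qed

lemma L2_integral_norm_mult_le:
  assumes "f \<in> L2" "g \<in> L2"
  shows "(\<integral>x. cmod (f x * g x) \<partial>lborel) \<le> L2_norm f * L2_norm g"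
proof (rule product_bound_from_AM_GM)
  fix r :: real assume r: "r > 0"
  have "2 * (\<integral>x. cmod (f x * g x) \<partial>lborel) = (\<integral>x. 2 * cmod (f x * g x) \<partial>lborel)" by simp
  also have "\<dots> \<le> (\<integral>x. r * (cmod (f x))\<^sup>2 + (cmod (g x))\<^sup>2 / r \<partial>lborel)"
    using integrable_norm[OF L2_mult_integrable[OF assms]] assms weighted_AM_GM[OF r]
    by (intro integral_mono) (auto simp: L2_iff norm_mult)
  also have "\<dots> = r * (L2_norm f)\<^sup>2 + (L2_norm g)\<^sup>2 / r"
    using assms by (simp add: L2_iff L2_norm_power2)
  finally show "2 * (\<integral>x. cmod (f x * g x) \<partial>lborel) \<le> r * (L2_norm f)\<^sup>2 + (L2_norm g)\<^sup>2 / r" .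
qed auto

lemma L2_Cauchy_Schwarz:
  assumes "f \<in> L2" "g \<in> L2"
  shows "cmod (\<integral>x. f x * g x \<partial>lborel) \<le> L2_norm f * L2_norm g"
  using integral_norm_bound[of lborel "\<lambda>x. f x * g x"] L2_integral_norm_mult_le[OF assms] by linarith

lemma L2_norm_triangle:
  assumes "f \<in> L2" "g \<in> L2"
  shows "L2_norm (\<lambda>x. f x + g x) \<le> L2_norm f + L2_norm g"
proof -
  have i: "integrable lborel (\<lambda>x. cmod (f x * g x))"
    using L2_mult_integrable[OF assms] by simp
  have "(L2_norm (\<lambda>x. f x + g x))\<^sup>2 \<le> (\<integral>x. (cmod (f x))\<^sup>2 + (cmod (g x))\<^sup>2 + 2 * cmod (f x * g x) \<partial>lborel)"
    unfolding L2_norm_power2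
  proof (rule integral_mono)
    show "integrable lborel (\<lambda>x. (cmod (f x + g x))\<^sup>2)"
      using L2_add[OF assms] by (simp add: L2_iff)
    show "integrable lborel (\<lambda>x. (cmod (f x))\<^sup>2 + (cmod (g x))\<^sup>2 + 2 * cmod (f x * g x))"
      using i assms by (auto simp: L2_iff)
    show "(cmod (f x + g x))\<^sup>2 \<le> (cmod (f x))\<^sup>2 + (cmod (g x))\<^sup>2 + 2 * cmod (f x * g x)" for x
      using power_mono[OF norm_triangle_ineq[of "f x" "g x"], of 2] by (simp add: power2_sum norm_mult)
  qed
  also have "\<dots> = (L2_norm f)\<^sup>2 + (L2_norm g)\<^sup>2 + 2 * (\<integral>x. cmod (f x * g x) \<partial>lborel)"
    using i assms by (simp add: L2_norm_power2 L2_iff)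
  also have "\<dots> \<le> (L2_norm f + L2_norm g)\<^sup>2"
    using L2_integral_norm_mult_le[OF assms] by (simp add: power2_sum)
  finally show ?thesis
    by (rule power2_le_imp_le) simp
qed

lemma L2_norm_triangle_diff:
  assumes "f \<in> L2" "g \<in> L2" "h \<in> L2"
  shows "L2_norm (\<lambda>x. f x - h x) \<le> L2_norm (\<lambda>x. f x - g x) + L2_norm (\<lambda>x. g x - h x)"
  using L2_norm_triangle[OF L2_diff[OF assms(1,2)] L2_diff[OF assms(2,3)]] by simp

lemma L2_norm_diff_le:
  assumes "f \<in> L2" "g \<in> L2"
  shows "\<bar>L2_norm f - L2_norm g\<bar> \<le> L2_norm (\<lambda>x. f x - g x)"
  using L2_norm_triangle_diff[OF assms L2_zero] L2_norm_triangle_diff[OF assms(2,1) L2_zero]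
    L2_norm_minus_commute[of f g] by simp

lemma tendsto_L2_norm:
  assumes "((\<lambda>t. L2_norm (\<lambda>x. f t x - g x)) \<longlongrightarrow> 0) F" "g \<in> L2" "eventually (\<lambda>t. f t \<in> L2) F"
  shows "((\<lambda>t. L2_norm (f t)) \<longlongrightarrow> L2_norm g) F"
proof (rule LIM_zero_cancel, rule Lim_null_comparison[OF _ assms(1)])
  show "\<forall>\<^sub>F t in F. norm (L2_norm (f t) - L2_norm g) \<le> L2_norm (\<lambda>x. f t x - g x)"
    using assms(3) by eventually_elim (simp add: L2_norm_diff_le assms(2))
qed

lemma tendsto_integral_L2_mult2:
  assumes f: "((\<lambda>t. L2_norm (\<lambda>x. f t x - g x)) \<longlongrightarrow> 0) F" "g \<in> L2" "eventually (\<lambda>t. f t \<in> L2) F"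
    and h: "((\<lambda>t. L2_norm (\<lambda>x. h t x - k x)) \<longlongrightarrow> 0) F" "k \<in> L2" "eventually (\<lambda>t. h t \<in> L2) F"
  shows "((\<lambda>t. \<integral>x. f t x * h t x \<partial>lborel) \<longlongrightarrow> (\<integral>x. g x * k x \<partial>lborel)) F"
proof (rule LIM_zero_cancel, rule Lim_null_comparison)
  show "\<forall>\<^sub>F t in F. norm ((\<integral>x. f t x * h t x \<partial>lborel) - (\<integral>x. g x * k x \<partial>lborel))
      \<le> L2_norm (\<lambda>x. f t x - g x) * L2_norm (h t) + L2_norm g * L2_norm (\<lambda>x. h t x - k x)"
    using f(3) h(3)
  proof eventually_elim
    case (elim t)
    have "(\<integral>x. f t x * h t x \<partial>lborel) - (\<integral>x. g x * k x \<partial>lborel)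
        = (\<integral>x. (f t x - g x) * h t x \<partial>lborel) + (\<integral>x. g x * (h t x - k x) \<partial>lborel)"
      using L2_mult_integrable[of "f t" "h t"] L2_mult_integrable[of g "h t"] L2_mult_integrable[of g k]
        elim f(2) h(2) by (simp add: left_diff_distrib right_diff_distrib)
    then show ?case
      using L2_Cauchy_Schwarz[OF L2_diff[OF elim(1) f(2)] elim(2)]
        L2_Cauchy_Schwarz[OF f(2) L2_diff[OF elim(2) h(2)]]
      by (simp only:) (rule order_trans[OF norm_triangle_ineq add_mono])
  qed
  have "((\<lambda>t. L2_norm (\<lambda>x. f t x - g x) * L2_norm (h t) + L2_norm g * L2_norm (\<lambda>x. h t x - k x))
      \<longlongrightarrow> 0 * L2_norm k + L2_norm g * 0) F"
    by (intro tendsto_intros f(1) h(1) tendsto_L2_norm h)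
  then show "((\<lambda>t. L2_norm (\<lambda>x. f t x - g x) * L2_norm (h t) + L2_norm g * L2_norm (\<lambda>x. h t x - k x))
      \<longlongrightarrow> 0) F" by simp
qed

lemma tendsto_integral_L2_mult:
  assumes "((\<lambda>t. L2_norm (\<lambda>x. f t x - g x)) \<longlongrightarrow> 0) F" "g \<in> L2" "eventually (\<lambda>t. f t \<in> L2) F" "h \<in> L2"
  shows "((\<lambda>t. \<integral>x. f t x * h x \<partial>lborel) \<longlongrightarrow> (\<integral>x. g x * h x \<partial>lborel)) F"
  by (rule tendsto_integral_L2_mult2[OF assms(1-3) _ assms(4)]) (use assms(4) in \<open>simp_all add: L2_norm_def\<close>)

lemma L2_dominated_convergence:
  fixes f :: "nat \<Rightarrow> real ^ 'n \<Rightarrow> complex"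
  assumes "\<And>m. f m \<in> borel_measurable borel" "g \<in> borel_measurable borel"
    and "integrable lborel b"
    and "\<And>m. AE x in lborel. (cmod (f m x - g x))\<^sup>2 \<le> b x"
    and "AE x in lborel. (\<lambda>m. f m x) \<longlonglongrightarrow> g x"
  shows "(\<lambda>m. L2_norm (\<lambda>x. f m x - g x)) \<longlonglongrightarrow> 0"
proof -
  note [measurable] = assms(1,2)
  have "(\<lambda>m. \<integral>x. (cmod (f m x - g x))\<^sup>2 \<partial>lborel) \<longlonglongrightarrow> (\<integral>x. 0 \<partial>(lborel :: (real ^ 'n) measure))"
  proof (rule integral_dominated_convergence[OF _ _ assms(3)])
    show "AE x in lborel. (\<lambda>m. (cmod (f m x - g x))\<^sup>2) \<longlonglongrightarrow> 0"
      using assms(5)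
    proof eventually_elim
      case (elim x)
      have "(\<lambda>m. (cmod (f m x - g x))\<^sup>2) \<longlonglongrightarrow> (cmod (g x - g x))\<^sup>2"
        by (intro tendsto_intros elim)
      then show ?case by simp
    qed
  qed (use assms(4) in auto)
  from tendsto_real_sqrt[OF this] show ?thesis by (simp add: L2_norm_def)
qed

text \<open>Fatou's lemma for the squared moduli. It serves twice: to identify the limit in the
  completeness proof, and to recover the second moment from a uniform bound on difference
  quotients.\<close>

lemma L2_liminf:
  fixes f :: "nat \<Rightarrow> real ^ 'n \<Rightarrow> complex"
  assumes f: "\<And>m. f m \<in> L2" and g: "g \<in> borel_measurable borel"
    and lim: "AE x in lborel. (\<lambda>m. f m x) \<longlonglongrightarrow> g x"
    and bd: "\<And>m. m \<ge> N \<Longrightarrow> L2_norm (f m) \<le> C"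
  shows "g \<in> L2" "L2_norm g \<le> C"
proof -
  note [measurable] = L2_measurable[OF f] g
  have C: "C \<ge> 0" using order_trans[OF L2_norm_nonneg bd[of N]] by simp
  have "(\<integral>\<^sup>+x. ennreal ((cmod (g x))\<^sup>2) \<partial>lborel)
      \<le> (\<integral>\<^sup>+x. liminf (\<lambda>m. ennreal ((cmod (f m x))\<^sup>2)) \<partial>lborel)"
  proof (rule nn_integral_mono_AE, use lim in eventually_elim)
    case (elim x)
    have "(\<lambda>m. ennreal ((cmod (f m x))\<^sup>2)) \<longlonglongrightarrow> ennreal ((cmod (g x))\<^sup>2)"
      by (intro tendsto_intros elim)
    then show ?case using lim_imp_Liminf[OF sequentially_bot] by fastforce
  qed
  also have "\<dots> \<le> liminf (\<lambda>m. \<integral>\<^sup>+x. ennreal ((cmod (f m x))\<^sup>2) \<partial>lborel)"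
    by (rule nn_integral_liminf) simp
  also have "\<dots> \<le> liminf (\<lambda>m. ennreal (C\<^sup>2))"
  proof (rule Liminf_mono, rule eventually_sequentiallyI)
    fix m assume m: "N \<le> m"
    have "(\<integral>\<^sup>+x. ennreal ((cmod (f m x))\<^sup>2) \<partial>lborel) = ennreal ((L2_norm (f m))\<^sup>2)"
      unfolding L2_norm_power2 using f by (intro nn_integral_eq_integral) (auto simp: L2_iff)
    also have "\<dots> \<le> ennreal (C\<^sup>2)"
      using bd[OF m] by (intro ennreal_leI power_mono) auto
    finally show "(\<integral>\<^sup>+x. ennreal ((cmod (f m x))\<^sup>2) \<partial>lborel) \<le> ennreal (C\<^sup>2)" .
  qed
  also have "\<dots> = ennreal (C\<^sup>2)" by (simp add: Liminf_const)
  finally have le: "(\<integral>\<^sup>+x. ennreal ((cmod (g x))\<^sup>2) \<partial>lborel) \<le> ennreal (C\<^sup>2)" .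
  then have i: "integrable lborel (\<lambda>x. (cmod (g x))\<^sup>2)"
    by (intro integrableI_bounded) (auto intro: le_less_trans)
  then show "g \<in> L2" using g by (simp add: L2_iff)
  have "ennreal ((L2_norm g)\<^sup>2) \<le> ennreal (C\<^sup>2)"
    using le nn_integral_eq_integral[OF i] by (simp add: L2_norm_power2)
  then have "(L2_norm g)\<^sup>2 \<le> C\<^sup>2" by simp
  then show "L2_norm g \<le> C" using C by (rule power2_le_imp_le)
qed

text \<open>Weighting the squares by \<open>2\<^sup>k\<close> makes a fast Cauchy subsequence converge pointwise without
  appealing to Minkowski's inequality for infinite sums.\<close>

lemma L2_fast_Cauchy_converges_AE:
  fixes f :: "nat \<Rightarrow> real ^ 'n \<Rightarrow> complex"
  assumes f: "\<And>k. f k \<in> L2" and fast: "\<And>k. L2_norm (\<lambda>x. f (Suc k) x - f k x) \<le> (1/2) ^ k"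
  shows "AE x in lborel. convergent (\<lambda>k. f k x)"
proof -
  define d where "d k x = f (Suc k) x - f k x" for k x
  have d: "d k \<in> L2" for k unfolding d_def by (intro L2_diff f)
  note [measurable] = L2_measurable[OF d]
  define S where "S x = (\<Sum>k. ennreal (2 ^ k * (cmod (d k x))\<^sup>2))" for x
  have "(\<integral>\<^sup>+x. S x \<partial>lborel) = (\<Sum>k. \<integral>\<^sup>+x. ennreal (2 ^ k * (cmod (d k x))\<^sup>2) \<partial>lborel)"
    unfolding S_def by (rule nn_integral_suminf) simp
  also have "\<dots> = (\<Sum>k. ennreal (2 ^ k * (L2_norm (d k))\<^sup>2))"
  proof (intro suminf_cong)
    fix k
    have "(\<integral>\<^sup>+x. ennreal (2 ^ k * (cmod (d k x))\<^sup>2) \<partial>lborel)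
        = ennreal (\<integral>x. 2 ^ k * (cmod (d k x))\<^sup>2 \<partial>lborel)"
      using d by (intro nn_integral_eq_integral) (auto simp: L2_iff)
    then show "(\<integral>\<^sup>+x. ennreal (2 ^ k * (cmod (d k x))\<^sup>2) \<partial>lborel) = ennreal (2 ^ k * (L2_norm (d k))\<^sup>2)"
      by (simp add: L2_norm_power2)
  qed
  also have "\<dots> \<le> (\<Sum>k. ennreal ((1/2) ^ k))"
  proof (intro suminf_le ennreal_leI)
    fix k
    have "2 ^ k * (L2_norm (d k))\<^sup>2 \<le> 2 ^ k * ((1/2) ^ k)\<^sup>2"
      using fast[of k] by (intro mult_left_mono power_mono) (auto simp: d_def[abs_def])
    also have "\<dots> = (2 * (1/2) * (1/2::real)) ^ k"
      unfolding power_mult_distrib power2_eq_square by simp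
    finally show "2 ^ k * (L2_norm (d k))\<^sup>2 \<le> (1/2) ^ k" by simp
  qed auto
  also have "\<dots> < \<infinity>"
  proof -
    have "(\<Sum>k. ennreal ((1/2) ^ k)) = ennreal 2"
      using geometric_sums[of "1/2::real"] by (intro suminf_ennreal_eq) auto
    then show ?thesis by simp
  qed
  finally have "(\<integral>\<^sup>+x. S x \<partial>lborel) \<noteq> \<infinity>" by simp
  then have "AE x in lborel. S x \<noteq> \<infinity>"
    by (intro nn_integral_PInf_AE) (auto simp: S_def)
  then show ?thesis
  proof eventually_elim
    case (elim x)
    \<comment> \<open>A single term of the convergent series \<open>S x\<close> is at most its sum,
      so the increments decay geometrically with ratio \<open>sqrt (1/2)\<close>.\<close>
    have *: "cmod (d k x) \<le> sqrt (enn2real (S x)) * sqrt (1/2) ^ k" for k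
    proof -
      have "(\<Sum>k\<in>{k}. ennreal (2 ^ k * (cmod (d k x))\<^sup>2)) \<le> S x"
        unfolding S_def by (rule sum_le_suminf) (rule summableI, rule finite.intros, rule finite.intros, rule zero_le)
      then have "ennreal (2 ^ k * (cmod (d k x))\<^sup>2) \<le> S x"
        by (simp only: sum.insert[OF finite.emptyI] empty_iff not_False_eq_True sum.empty add_0_right)
      then have "2 ^ k * (cmod (d k x))\<^sup>2 \<le> enn2real (S x)"
        using ennreal_enn2real[of "S x"] elim
        by (metis ennreal_le_iff enn2real_nonneg infinity_ennreal_def less_top)
      then have "(cmod (d k x))\<^sup>2 \<le> enn2real (S x) * (1/2) ^ k"
        by (simp add: power_divide field_simps)
      from real_sqrt_le_mono[OF this] show ?thesis
        by (simp add: real_sqrt_mult real_sqrt_power)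
    qed
    have "summable (\<lambda>k. sqrt (enn2real (S x)) * sqrt (1/2) ^ k)"
      by (intro summable_mult summable_geometric) (auto simp: real_sqrt_lt_1_iff)
    then have "summable (\<lambda>k. d k x)"
      by (rule summable_comparison_test[rotated]) (use * in auto)
    then have "convergent (\<lambda>n. \<Sum>k<n. d k x)" by (simp add: summable_iff_convergent)
    moreover have "(\<Sum>k<n. d k x) = f n x - f 0 x" for n
      unfolding d_def by (rule sum_lessThan_telescope)
    ultimately show ?case by (simp add: convergent_diff_const_right_iff)
  qed
qed

theorem L2_complete:
  fixes f :: "nat \<Rightarrow> real ^ 'n \<Rightarrow> complex"
  assumes f: "\<And>k. f k \<in> L2"
    and Cauchy: "\<And>e. e > 0 \<Longrightarrow> \<exists>N. \<forall>m\<ge>N. \<forall>l\<ge>N. L2_norm (\<lambda>x. f m x - f l x) \<le> e"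
  shows "\<exists>g\<in>L2. (\<lambda>k. L2_norm (\<lambda>x. f k x - g x)) \<longlonglongrightarrow> 0"
proof -
  have "\<exists>N. \<forall>k. \<forall>m\<ge>N k. \<forall>l\<ge>N k. L2_norm (\<lambda>x. f m x - f l x) \<le> (1/2) ^ k"
    by (intro choice allI Cauchy) simp
  then obtain N where N: "\<And>k m l. m \<ge> N k \<Longrightarrow> l \<ge> N k \<Longrightarrow> L2_norm (\<lambda>x. f m x - f l x) \<le> (1/2) ^ k"
    by blast
  \<comment> \<open>Summing the thresholds makes \<open>s k\<close> and \<open>s (Suc k)\<close>
    both at least \<open>N k\<close>; the summand \<open>k\<close> forces \<open>s\<close> to
    infinity.\<close>
  define s where "s k = (\<Sum>i\<le>k. N i) + k" for k
  have sN: "s k \<ge> N k" "s k \<ge> k" for k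
    by (auto simp: s_def intro: member_le_sum trans_le_add1)
  have sN': "s (Suc k) \<ge> N k" for k
    using sN(1)[of k] by (simp add: s_def)
  define g where "g x = lim (\<lambda>k. f (s k) x)" for x
  have [measurable]: "f k \<in> borel_measurable borel" for k by (rule L2_measurable[OF f])
  have g: "g \<in> borel_measurable borel" unfolding g_def by measurable
  have AE: "AE x in lborel. (\<lambda>k. f (s k) x) \<longlonglongrightarrow> g x"
    using L2_fast_Cauchy_converges_AE[of "\<lambda>k. f (s k)", OF f N[OF sN' sN(1)]]
    by (auto simp: g_def convergent_LIMSEQ_iff)
  \<comment> \<open>Fatou along \<open>l\<close> in \<open>f m - f (s l)\<close> turns the Cauchy
    bound into a bound on the distance to the limit, and yields \<open>g \<in> L2\<close> at the
    same time.\<close>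
  have lim: "g \<in> L2 \<and> L2_norm (\<lambda>x. f m x - g x) \<le> (1/2) ^ k" if "m \<ge> N k" for m k
  proof -
    have "(\<lambda>x. f m x - g x) \<in> L2" and le: "L2_norm (\<lambda>x. f m x - g x) \<le> (1/2) ^ k"
    proof (atomize (full), intro conjI)
      have 1: "\<And>l. (\<lambda>x. f m x - f (s l) x) \<in> L2" by (intro L2_diff f)
      have 2: "(\<lambda>x. f m x - g x) \<in> borel_measurable borel" using g by measurable
      have 3: "AE x in lborel. (\<lambda>l. f m x - f (s l) x) \<longlonglongrightarrow> f m x - g x"
        using AE by eventually_elim (intro tendsto_intros)
      have 4: "L2_norm (\<lambda>x. f m x - f (s l) x) \<le> (1/2) ^ k" if "l \<ge> N k" for l
        using \<open>m \<ge> N k\<close> that sN(2)[of l] by (intro N) auto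
      show "(\<lambda>x. f m x - g x) \<in> L2" by (rule L2_liminf(1)[OF 1 2 3 4])
      show "L2_norm (\<lambda>x. f m x - g x) \<le> (1/2) ^ k" by (rule L2_liminf(2)[OF 1 2 3 4])
    qed
    then show ?thesis using L2_diff[OF f, of "\<lambda>x. f m x - g x" m] by simp
  qed
  have "(\<lambda>k. L2_norm (\<lambda>x. f k x - g x)) \<longlonglongrightarrow> 0"
  proof (rule LIMSEQ_I)
    fix e :: real assume "e > 0"
    then obtain k where k: "(1/2) ^ k < e" using real_arch_pow_inv[of e "1/2"] by auto
    show "\<exists>n0. \<forall>n\<ge>n0. norm (L2_norm (\<lambda>x. f n x - g x) - 0) < e"
    proof (intro exI[of _ "N k"] allI impI)
      fix n assume "n \<ge> N k"
      then show "norm (L2_norm (\<lambda>x. f n x - g x) - 0) < e"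
        using conjunct2[OF lim[of k n]] k by simp
    qed
  qed
  then show ?thesis using lim[of 0 "N 0"] by auto
qed

subsection \<open>Affine substitutions\<close>

lemma lborel_integrable_affine:
  fixes f :: "'a::euclidean_space \<Rightarrow> 'b::{banach, second_countable_topology}"
  assumes "c \<noteq> 0" "integrable lborel f"
  shows "integrable lborel (\<lambda>x. f (t + c *\<^sub>R x))"
proof -
  have "integrable (density (distr lborel borel (\<lambda>x. t + c *\<^sub>R x)) (\<lambda>_. ennreal (\<bar>c\<bar> ^ DIM('a)))) f"
    using assms lborel_affine[of c t] by simp
  then have "integrable (distr lborel borel (\<lambda>x. t + c *\<^sub>R x)) (\<lambda>x. \<bar>c\<bar> ^ DIM('a) *\<^sub>R f x)"
    using assms by (subst (asm) integrable_density) (auto dest: borel_measurable_integrable)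
  then have "integrable lborel (\<lambda>x. \<bar>c\<bar> ^ DIM('a) *\<^sub>R f (t + c *\<^sub>R x))"
    by (subst (asm) integrable_distr_eq) (use assms in \<open>auto dest: borel_measurable_integrable\<close>)
  from integrable_scaleR_right[OF this, of "1 / \<bar>c\<bar> ^ DIM('a)"] show ?thesis
    using assms(1) by simp
qed

lemma lborel_integral_affine:
  fixes f :: "'a::euclidean_space \<Rightarrow> 'b::{banach, second_countable_topology}"
  assumes "c \<noteq> 0" "f \<in> borel_measurable borel"
  shows "(\<integral>x. f x \<partial>lborel) = \<bar>c\<bar> ^ DIM('a) *\<^sub>R (\<integral>x. f (t + c *\<^sub>R x) \<partial>lborel)"
proof -
  have "(\<integral>x. f x \<partial>lborel)
      = (\<integral>x. f x \<partial>density (distr lborel borel (\<lambda>x. t + c *\<^sub>R x)) (\<lambda>_. ennreal (\<bar>c\<bar> ^ DIM('a))))"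
    using lborel_affine[OF assms(1), of t] by simp
  also have "\<dots> = (\<integral>x. \<bar>c\<bar> ^ DIM('a) *\<^sub>R f x \<partial>distr lborel borel (\<lambda>x. t + c *\<^sub>R x))"
    using assms(2) by (intro integral_density) auto
  also have "\<dots> = (\<integral>x. \<bar>c\<bar> ^ DIM('a) *\<^sub>R f (t + c *\<^sub>R x) \<partial>lborel)"
    using assms(2) by (intro integral_distr) auto
  finally show ?thesis by simp
qed

lemma lborel_integral_translate:
  fixes f :: "'a::euclidean_space \<Rightarrow> 'b::{banach, second_countable_topology}"
  assumes "f \<in> borel_measurable borel"
  shows "(\<integral>x. f (x + a) \<partial>lborel) = (\<integral>x. f x \<partial>lborel)"
  using lborel_integral_affine[of 1 f a] assms by (simp add: add.commute)

lemma L2_affine: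
  fixes f :: "real ^ 'n \<Rightarrow> complex"
  assumes "c \<noteq> 0" "f \<in> L2"
  shows "(\<lambda>x. f (t + c *\<^sub>R x)) \<in> L2"
  using assms lborel_integrable_affine[of c "\<lambda>x. (cmod (f x))\<^sup>2" t]
  by (auto simp: L2_iff intro: measurable_compose[where g = f])

lemma L2_norm_affine:
  fixes f :: "real ^ 'n \<Rightarrow> complex"
  assumes "c \<noteq> 0" "f \<in> L2"
  shows "L2_norm (\<lambda>x. f (t + c *\<^sub>R x)) = \<bar>c\<bar> powr - (real CARD('n) / 2) * L2_norm f"
proof -
  have "(L2_norm f)\<^sup>2 = \<bar>c\<bar> ^ CARD('n) * (L2_norm (\<lambda>x. f (t + c *\<^sub>R x)))\<^sup>2"
    unfolding L2_norm_power2
    by (subst lborel_integral_affine[OF assms(1), of _ t]) (use L2_measurable[OF assms(2)] in auto)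
  also have "\<bar>c\<bar> ^ CARD('n) = (\<bar>c\<bar> powr (real CARD('n) / 2))\<^sup>2"
    using assms(1) powr_realpow[of "\<bar>c\<bar>" "CARD('n)"]
    by (simp add: power2_eq_square powr_add[symmetric])
  finally have "L2_norm f = \<bar>c\<bar> powr (real CARD('n) / 2) * L2_norm (\<lambda>x. f (t + c *\<^sub>R x))"
    by (simp add: power_mult_distrib[symmetric])
  then show ?thesis using assms(1) by (simp add: powr_minus field_simps)
qed

lemma L2_translate: "f \<in> L2 \<Longrightarrow> (\<lambda>x. f (x + a)) \<in> L2"
  using L2_affine[of 1 f a] by (simp add: add.commute)

lemma L2_norm_translate: "f \<in> L2 \<Longrightarrow> L2_norm (\<lambda>x. f (x + a)) = L2_norm f"
  using L2_norm_affine[of 1 f a] by (simp add: add.commute)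

subsection \<open>Difference quotients of curves\<close>

text \<open>In this form a derivative is a limit of complex quotients, to which dominated
  convergence and \<open>L2\<close> limits can be applied.\<close>

lemma has_vector_derivative_iff_quotient:
  fixes f :: "real \<Rightarrow> complex"
  shows "(f has_vector_derivative D) (at t) \<longleftrightarrow>
    ((\<lambda>s. (f s - f t) / of_real (s - t)) \<longlongrightarrow> D) (at t)"
proof -
  have "norm (f s - f t - (s - t) *\<^sub>R D) / norm (s - t) = norm ((f s - f t) / of_real (s - t) - D)"
    if "s \<noteq> t" for s
  proof -
    have "f s - f t - (s - t) *\<^sub>R D = of_real (s - t) * ((f s - f t) / of_real (s - t) - D)"
      using that by (simp add: field_simps scaleR_conv_of_real)
    then show ?thesis
      using that by (simp add: norm_mult del: of_real_diff)
  qed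
  then have "eventually (\<lambda>s. norm (f s - f t - (s - t) *\<^sub>R D) / norm (s - t)
      = norm ((f s - f t) / of_real (s - t) - D)) (at t)"
    by (auto simp: eventually_at_filter)
  from tendsto_cong[OF this] show ?thesis
    unfolding has_vector_derivative_def has_derivative_iff_norm
    by (simp add: tendsto_norm_zero_iff LIM_zero_iff bounded_linear_scaleR_left)
qed

lemma vector_derivative_mean_value_bound:
  fixes f :: "real \<Rightarrow> 'a::real_normed_vector"
  assumes "convex S" "\<And>s. s \<in> S \<Longrightarrow> (f has_vector_derivative f' s) (at s)"
    and "\<And>s. s \<in> S \<Longrightarrow> norm (f' s) \<le> B" "a \<in> S" "b \<in> S"
  shows "norm (f a - f b) \<le> B * \<bar>a - b\<bar>"
proof -
  have "norm (f a - f b) \<le> B * norm (a - b)"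
  proof (rule differentiable_bound[OF assms(1), where f' = "\<lambda>s h. h *\<^sub>R f' s"])
    show "(f has_derivative (\<lambda>h. h *\<^sub>R f' s)) (at s within S)" if "s \<in> S" for s
      using assms(2)[OF that] has_derivative_at_withinI by (auto simp: has_vector_derivative_def)
    show "onorm (\<lambda>h. h *\<^sub>R f' s) \<le> B" if "s \<in> S" for s
    proof (rule onorm_le)
      show "norm (h *\<^sub>R f' s) \<le> B * norm h" for h
        using assms(3)[OF that] by (simp add: mult.commute[of B] mult_left_mono)
    qed
  qed fact+
  then show ?thesis by simp
qed

text \<open>Subtracting \<open>\<Theta> t\<close> isolates the motion of the profile; the remaining part of the derivative
  of \<open>\<integral> v s \<Theta> s\<close> is that of the pairing with the fixed profile \<open>\<Theta> t\<close>.\<close>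

lemma has_vector_derivative_moving_profile:
  fixes v :: "real \<Rightarrow> real ^ 'n \<Rightarrow> complex"
  assumes v: "\<And>s. v s \<in> L2" "((\<lambda>s. L2_norm (\<lambda>x. v s x - v t x)) \<longlongrightarrow> 0) (at t)"
    and meas: "\<And>s. \<Theta> s \<in> borel_measurable borel" "\<Theta>' \<in> borel_measurable borel"
    and deriv: "\<And>x. ((\<lambda>s. \<Theta> s x) has_vector_derivative \<Theta>' x) (at t)"
    and bound: "\<And>s x. \<bar>s - t\<bar> < 1 \<Longrightarrow> cmod (\<Theta> s x - \<Theta> t x) \<le> M * \<bar>s - t\<bar>"
    and supp: "\<And>s x. \<bar>s - t\<bar> < 1 \<Longrightarrow> norm x > R \<Longrightarrow> \<Theta> s x = 0"
  shows "((\<lambda>s. \<integral>x. v s x * (\<Theta> s x - \<Theta> t x) \<partial>lborel) has_vector_derivative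
    (\<integral>x. v t x * \<Theta>' x \<partial>lborel)) (at t)"
proof -
  define q where "q s x = (\<Theta> s x - \<Theta> t x) / of_real (s - t)" for s x
  note [measurable] = meas
  have q_meas [measurable]: "q s \<in> borel_measurable borel" for s unfolding q_def by measurable
  have q_lim: "((\<lambda>s. q s x) \<longlongrightarrow> \<Theta>' x) (at t)" for x
    using deriv[of x] unfolding has_vector_derivative_iff_quotient q_def .
  have near: "eventually (\<lambda>s. \<bar>s - t\<bar> < 1) (at t)"
    unfolding eventually_at by (intro exI[of _ 1]) (auto simp: dist_real_def)
  have M: "M \<ge> 0" using order_trans[OF norm_ge_zero bound[of "t + 1/2"]] by simp
  \<comment> \<open>At \<open>s = t\<close> the quotient is a division by zero and hence 0. For
    \<open>norm x > R\<close> both profiles vanish, including \<open>\<Theta> t\<close>, because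
    \<open>t\<close> lies in its own window.\<close>
  have q_bound: "cmod (q s x) \<le> M * indicator (cball 0 R) x" if "\<bar>s - t\<bar> < 1" for s x
  proof (cases "norm x > R \<or> s = t")
    case True
    then show ?thesis using supp[OF that, of x] supp[of t x] M by (auto simp: q_def)
  next
    case False
    then have "cmod (q s x) = cmod (\<Theta> s x - \<Theta> t x) / \<bar>s - t\<bar>"
      by (simp add: q_def norm_divide del: of_real_diff)
    also have "\<dots> \<le> M" using bound[OF that, of x] False by (simp add: divide_le_eq)
    finally show ?thesis using False by simp
  qed
  have lim_bound: "cmod (\<Theta>' x) \<le> M * indicator (cball 0 R) x" for x
  proof (rule tendsto_upperbound[OF tendsto_norm[OF q_lim]])
    show "\<forall>\<^sub>F s in at t. cmod (q s x) \<le> M * indicator (cball 0 R) x"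
      using near by eventually_elim (rule q_bound)
  qed simp
  \<comment> \<open>The factor 2 lets the same majorant dominate the difference between the quotient
    and its limit.\<close>
  have ind: "integrable lborel (\<lambda>x::real^'n. (2 * M * indicator (cball 0 R) x)\<^sup>2)"
  proof -
    have "integrable lborel (\<lambda>x::real^'n. indicator (cball 0 R) x *\<^sub>R (2 * M)\<^sup>2)"
      by (intro integrable_indicator) (use emeasure_bounded_finite[OF bounded_cball] in auto)
    then show ?thesis
      by (rule Bochner_Integration.integrable_cong[THEN iffD1, rotated 2]) (auto split: split_indicator)
  qed
  have q_L2: "q s \<in> L2" if "\<bar>s - t\<bar> < 1" for s
  proof (rule L2_dominated[OF q_meas ind])
    show "(cmod (q s x))\<^sup>2 \<le> (2 * M * indicator (cball 0 R) x)\<^sup>2" for x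
      using order_trans[OF q_bound[OF that, of x], of "2 * M * indicator (cball 0 R) x"] M
      by (intro power_mono) (auto split: split_indicator)
  qed
  have lim_L2: "\<Theta>' \<in> L2"
  proof (rule L2_dominated[OF _ ind])
    show "(cmod (\<Theta>' x))\<^sup>2 \<le> (2 * M * indicator (cball 0 R) x)\<^sup>2" for x
      using order_trans[OF lim_bound[of x], of "2 * M * indicator (cball 0 R) x"] M
      by (intro power_mono) (auto split: split_indicator)
  qed measurable
  have "((\<lambda>s. L2_norm (\<lambda>x. q s x - \<Theta>' x)) \<longlongrightarrow> 0) (at t)"
    \<comment> \<open>Dominated convergence is a statement about sequences, so the limit is tested
      along sequences; discarding \<open>N\<close> terms keeps all indices where the bounds
      hold.\<close>
    unfolding tendsto_at_iff_sequentially comp_def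
  proof (intro allI impI)
    fix X :: "nat \<Rightarrow> real" assume X: "\<forall>i. X i \<in> UNIV - {t}" "X \<longlonglongrightarrow> t"
    then have Xt: "filterlim X (at t) sequentially"
      by (auto simp: filterlim_at intro: always_eventually)
    obtain N where N: "\<And>i. i \<ge> N \<Longrightarrow> \<bar>X i - t\<bar> < 1"
      using filterlim_iff[THEN iffD1, OF Xt, rule_format, OF near] unfolding eventually_sequentially by blast
    have "(\<lambda>i. L2_norm (\<lambda>x. q (X (i + N)) x - \<Theta>' x)) \<longlonglongrightarrow> 0"
    proof (rule L2_dominated_convergence[OF _ _ ind])
      show "AE x in lborel. (cmod (q (X (i + N)) x - \<Theta>' x))\<^sup>2 \<le> (2 * M * indicator (cball 0 R) x)\<^sup>2" for i
      proof (intro AE_I2 power_mono norm_ge_zero)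
        fix x
        show "cmod (q (X (i + N)) x - \<Theta>' x) \<le> 2 * M * indicator (cball 0 R) x"
          using norm_triangle_ineq4[of "q (X (i + N)) x" "\<Theta>' x"] q_bound[OF N[of "i + N"], of x]
            lim_bound[of x] by simp
      qed
      show "AE x in lborel. (\<lambda>i. q (X (i + N)) x) \<longlonglongrightarrow> \<Theta>' x"
        using filterlim_compose[OF q_lim Xt]
        by (intro AE_I2) (auto intro: LIMSEQ_ignore_initial_segment)
    qed measurable
    then show "(\<lambda>i. L2_norm (\<lambda>x. q (X i) x - \<Theta>' x)) \<longlonglongrightarrow> 0"
      by (rule LIMSEQ_offset)
  qed
  then have "((\<lambda>s. \<integral>x. v s x * q s x \<partial>lborel) \<longlongrightarrow> (\<integral>x. v t x * \<Theta>' x \<partial>lborel)) (at t)"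
    using near by (intro tendsto_integral_L2_mult2 v lim_L2) (auto simp: v elim: eventually_mono intro: q_L2)
  moreover have "(\<integral>x. v s x * q s x \<partial>lborel)
      = ((\<integral>x. v s x * (\<Theta> s x - \<Theta> t x) \<partial>lborel) - (\<integral>x. v t x * (\<Theta> t x - \<Theta> t x) \<partial>lborel)) / of_real (s - t)" for s
    unfolding q_def times_divide_eq_right by (simp del: of_real_diff)
  ultimately show ?thesis
    unfolding has_vector_derivative_iff_quotient by simp
qed

subsection \<open>Smooth functions\<close>

lemma partial_eqI: "(f has_derivative f') (at x) \<Longrightarrow> partial j f x = f' (axis j 1)"
  using frechet_derivative_at[of f f' x] by (simp add: partial_def)

lemma has_derivative_frechet_derivative:
  "f differentiable_on UNIV \<Longrightarrow> (f has_derivative frechet_derivative f (at x)) (at x)"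
  by (simp add: differentiable_on_def frechet_derivative_works)

lemma has_vector_derivative_along_axis:
  assumes "f differentiable_on UNIV"
  shows "((\<lambda>s. f (x + s *\<^sub>R axis j 1)) has_vector_derivative partial j f (x + s *\<^sub>R axis j 1)) (at s)"
proof -
  let ?D = "frechet_derivative f (at (x + s *\<^sub>R axis j 1))"
  have D: "(f has_derivative ?D) (at (x + s *\<^sub>R axis j 1))"
    by (rule has_derivative_frechet_derivative[OF assms])
  have "((\<lambda>s. f (x + s *\<^sub>R axis j 1)) has_derivative (\<lambda>h. ?D (h *\<^sub>R axis j 1))) (at s)"
    by (rule has_derivative_compose[where g = f and f = "\<lambda>s. x + s *\<^sub>R axis j 1", OF _ D]) (auto intro!: derivative_eq_intros)
  moreover have "?D (h *\<^sub>R axis j 1) = h *\<^sub>R ?D (axis j 1)" for h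
    using has_derivative_bounded_linear[OF D] by (simp add: bounded_linear.linear linear_cmul)
  ultimately show ?thesis
    by (simp add: has_vector_derivative_def partial_def)
qed

lemma C_diff_imp_continuous: "C_diff m f \<Longrightarrow> continuous_on UNIV f"
  by (cases m) (auto intro: differentiable_imp_continuous_on)

lemma C_diff_Suc_D: "C_diff (Suc m) f \<Longrightarrow> C_diff m f"
  by (induction m arbitrary: f) (auto intro: differentiable_imp_continuous_on)

text \<open>A family of differentiable functions that is closed under all partial derivatives
  consists of smooth functions. This avoids formulas for iterated derivatives.\<close>

lemma C_diff_coinduct:
  assumes "\<And>f. f \<in> S \<Longrightarrow> f differentiable_on UNIV" "\<And>f j. f \<in> S \<Longrightarrow> partial j f \<in> S"
  shows "f \<in> S \<Longrightarrow> C_diff m f"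
  by (induction m arbitrary: f) (use assms in \<open>auto intro: differentiable_imp_continuous_on\<close>)

lemma partial_add:
  assumes "f differentiable_on UNIV" "g differentiable_on UNIV"
  shows "partial j (\<lambda>x. f x + g x) = (\<lambda>x. partial j f x + partial j g x)"
proof
  fix x show "partial j (\<lambda>x. f x + g x) x = partial j f x + partial j g x"
    by (subst partial_eqI[OF has_derivative_add[OF assms[THEN has_derivative_frechet_derivative]]])
       (simp add: partial_def)
qed

lemma partial_mult:
  assumes "f differentiable_on UNIV" "g differentiable_on UNIV"
  shows "partial j (\<lambda>x. f x * g x) = (\<lambda>x. f x * partial j g x + partial j f x * g x)"
proof
  fix x show "partial j (\<lambda>x. f x * g x) x = f x * partial j g x + partial j f x * g x"
    by (subst partial_eqI[OF has_derivative_mult[OF assms[THEN has_derivative_frechet_derivative]]])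
       (simp add: partial_def)
qed

lemma partial_const: "partial j (\<lambda>x. c) = (\<lambda>x. 0)"
  by (rule ext) (simp add: partial_def)

lemma differentiable_on_translate:
  "f differentiable_on UNIV \<Longrightarrow> (\<lambda>x. f (x + a)) differentiable_on UNIV"
  unfolding differentiable_on_def
  by (auto intro!: differentiable_compose[where f = f and g = "\<lambda>x. x + a"])

lemma partial_translate:
  assumes "f differentiable_on UNIV"
  shows "partial j (\<lambda>x. f (x + a)) = (\<lambda>x. partial j f (x + a))"
proof
  fix x
  have "((\<lambda>x. f (x + a)) has_derivative (\<lambda>h. frechet_derivative f (at (x + a)) h)) (at x)"
    by (rule has_derivative_compose[OF _ has_derivative_frechet_derivative[OF assms]])
       (auto intro!: derivative_eq_intros)
  from partial_eqI[OF this] show "partial j (\<lambda>x. f (x + a)) x = partial j f (x + a)"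
    by (simp add: partial_def)
qed

lemma C_diff_const: "C_diff m (\<lambda>x. c)"
  by (rule C_diff_coinduct[where S = "range (\<lambda>c x. c)"]) (auto simp: partial_const)

lemma C_diff_add: "C_diff m f \<Longrightarrow> C_diff m g \<Longrightarrow> C_diff m (\<lambda>x. f x + g x)"
  by (induction m arbitrary: f g) (auto simp: partial_add intro: continuous_intros differentiable_on_add)

lemma C_diff_mult: "C_diff m f \<Longrightarrow> C_diff m g \<Longrightarrow> C_diff m (\<lambda>x. f x * g x)"
proof (induction m arbitrary: f g)
  case 0
  then show ?case by (auto intro: continuous_intros)
next
  case (Suc m)
  from Suc.prems[THEN C_diff_Suc_D] Suc.prems show ?case
    by (auto simp: partial_mult intro!: C_diff_add Suc.IH differentiable_on_mult)
qed

lemma C_diff_translate: "C_diff m f \<Longrightarrow> C_diff m (\<lambda>x. f (x + a))"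
proof (induction m arbitrary: f)
  case 0
  then show ?case
    by (auto intro!: continuous_on_compose2[where g = f and t = UNIV] continuous_intros)
qed (auto simp: partial_translate differentiable_on_translate)

lemma C_diff_prod: "(\<And>i. i \<in> A \<Longrightarrow> C_diff m (F i)) \<Longrightarrow> C_diff m (\<lambda>x. \<Prod>i\<in>A. F i x)"
  by (induction A rule: infinite_finite_induct) (auto intro: C_diff_const C_diff_mult)

lemma has_derivative_coordinate:
  fixes G :: "real \<Rightarrow> complex"
  assumes "\<And>s. (G has_vector_derivative G' s) (at s)"
  shows "((\<lambda>x::real^'n. c * G (a * x $ i + b)) has_derivative (\<lambda>h. c * ((a * h $ i) *\<^sub>R G' (a * x $ i + b)))) (at x)"
proof -
  have "((\<lambda>x::real^'n. G (a * x $ i + b)) has_derivative (\<lambda>h. (a * h $ i) *\<^sub>R G' (a * x $ i + b))) (at x)"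
  proof (rule has_derivative_compose[where g = G])
    show "((\<lambda>x::real^'n. a * x $ i + b) has_derivative (\<lambda>h. a * h $ i)) (at x)"
      by (auto intro!: derivative_eq_intros bounded_linear.has_derivative[OF bounded_linear_vec_nth])
    show "(G has_derivative (\<lambda>h. h *\<^sub>R G' (a * x $ i + b))) (at (a * x $ i + b))"
      using assms by (simp add: has_vector_derivative_def)
  qed
  then show ?thesis by (rule has_derivative_mult_right)
qed

text \<open>\<open>G k\<close> plays the role of the \<open>k\<close>-th derivative of a
  one-dimensional profile. The multiples \<open>c * G k (a * x $ i + b)\<close> form a family closed
  under partial derivatives; the free constant \<open>c\<close> absorbs the inner derivative, which
  is 0 in directions other than \<open>i\<close>.\<close>

lemma C_diff_coordinate:
  fixes G :: "nat \<Rightarrow> real \<Rightarrow> complex" and i :: "'n::finite"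
  assumes "\<And>k s. (G k has_vector_derivative G (Suc k) s) (at s)"
  shows "C_diff m (\<lambda>x. G 0 (a * x $ i + b))"
proof (rule C_diff_coinduct[where S = "{\<lambda>x. c * G k (a * x $ i + b) | c k. True}"])
  fix f :: "real^'n \<Rightarrow> complex" assume "f \<in> {\<lambda>x. c * G k (a * x $ i + b) | c k. True}"
  then obtain c k where f: "f = (\<lambda>x. c * G k (a * x $ i + b))" by auto
  note D = has_derivative_coordinate[of "G k", OF assms, of c a i b, folded f]
  show "f differentiable_on UNIV"
    unfolding differentiable_on_def differentiable_def using D by blast
  show "partial j f \<in> {\<lambda>x. c * G k (a * x $ i + b) | c k. True}" for j
  proof -
    have "partial j f = (\<lambda>x. (c * of_real (a * axis j 1 $ i)) * G (Suc k) (a * x $ i + b))"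
      by (rule ext) (simp add: partial_eqI[OF D] scaleR_conv_of_real)
    then show ?thesis by blast
  qed
next
  show "(\<lambda>x. G 0 (a * x $ i + b)) \<in> {\<lambda>x. c * G k (a * x $ i + b) | c k. True}"
    by (rule CollectI, intro exI[of _ 1] exI[of _ 0]) simp
qed

lemma cis_line_has_vector_derivative:
  "((\<lambda>s. cis (a * s)) has_vector_derivative \<i> * of_real a * cis (a * s)) (at s)"
proof -
  have "((\<lambda>z. exp (\<i> * of_real a * z)) has_field_derivative \<i> * of_real a * exp (\<i> * of_real a * of_real s))
      (at (of_real s))"
    by (auto intro!: derivative_eq_intros)
  from has_vector_derivative_real_field[OF this] show ?thesis
    by (simp add: cis_conv_exp mult.assoc)
qed

lemma C_diff_cis: "C_diff m (\<lambda>x. cis (\<eta> * x $ j))"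
proof -
  have "((\<lambda>s. (\<i> * of_real \<eta>) ^ k * cis (\<eta> * s)) has_vector_derivative
      (\<i> * of_real \<eta>) ^ Suc k * cis (\<eta> * s)) (at s)" for k s
    using has_vector_derivative_mult_right[OF cis_line_has_vector_derivative, of "(\<i> * of_real \<eta>) ^ k" \<eta> s]
    by (simp only: power_Suc2 mult.assoc)
  from C_diff_coordinate[where G = "\<lambda>k s. (\<i> * of_real \<eta>) ^ k * cis (\<eta> * s)" and a = 1 and b = 0, OF this]
  show ?thesis by simp
qed

lemma partial_cis:
  fixes j :: "'n::finite"
  shows "partial i (\<lambda>x. cis (\<eta> * x $ j)) = (\<lambda>x. (if i = j then \<i> * of_real \<eta> else 0) * cis (\<eta> * x $ j))"
proof
  fix x :: "real ^ 'n"
  show "partial i (\<lambda>x. cis (\<eta> * x $ j)) x = (if i = j then \<i> * of_real \<eta> else 0) * cis (\<eta> * x $ j)"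
    using partial_eqI[OF has_derivative_coordinate[OF cis_line_has_vector_derivative[of \<eta>], of 1 1 j 0 x], of i]
    by (auto simp: axis_def scaleR_conv_of_real)
qed

text \<open>Differentiating \<open>P(1/s) exp (- 1/s)\<close> reproduces this form with \<open>P\<close> replaced by
  \<open>y\<^sup>2 (P - P')\<close>; this is why the flat function \<open>exp (- 1/s)\<close> is smooth.\<close>

definition flat :: "real poly \<Rightarrow> real \<Rightarrow> real" where
  "flat P s = (if s > 0 then poly P (1 / s) * exp (- (1 / s)) else 0)"

definition flat_deriv :: "real poly \<Rightarrow> real poly" where
  "flat_deriv P = [:0, 0, 1:] * (P - pderiv P)"

lemma poly_times_exp_tendsto_0: "((\<lambda>y. y ^ k * poly P y * exp (- y)) \<longlongrightarrow> 0) at_top" for P :: "real poly"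
proof (induction P arbitrary: k)
  case (pCons a p)
  have "((\<lambda>y. a * (y ^ k / exp y) + y ^ Suc k * poly p y * exp (- y)) \<longlongrightarrow> a * 0 + 0) at_top"
    by (intro tendsto_add tendsto_mult_left tendsto_power_div_exp_0 pCons)
  then show ?case by (simp add: exp_minus field_simps)
qed simp

lemma flat_has_derivative: "(flat P has_field_derivative flat (flat_deriv P) s) (at s)"
proof -
  consider "s > 0" | "s < 0" | "s = 0" by linarith
  then show ?thesis
  proof cases
    case 1
    have "((\<lambda>s. poly P (1 / s) * exp (- (1 / s))) has_field_derivative flat (flat_deriv P) s) (at s)"
      using 1 by (auto intro!: derivative_eq_intros simp: flat_def flat_deriv_def field_simps power2_eq_square)
    then show ?thesis
      by (rule has_field_derivative_transform_within_open[of _ _ _ "{0<..}"]) (use 1 in \<open>auto simp: flat_def\<close>)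
  next
    case 2
    have "((\<lambda>s. 0) has_field_derivative flat (flat_deriv P) s) (at s)"
      using 2 by (simp add: flat_def)
    then show ?thesis
      by (rule has_field_derivative_transform_within_open[of _ _ _ "{..<0}"]) (use 2 in \<open>auto simp: flat_def\<close>)
  next
    case 3
    \<comment> \<open>At the junction the right-hand quotient is
      \<open>y * poly P y * exp (- y)\<close> with \<open>y = 1 / h\<close> tending to infinity, so
      all derivatives match the value 0 from the left.\<close>
    have "((\<lambda>h. flat P h / h) \<longlongrightarrow> 0) (at 0)"
    proof (rule filterlim_split_at)
      show "((\<lambda>h. flat P h / h) \<longlongrightarrow> 0) (at_left 0)"
        by (rule tendsto_eventually) (auto simp: eventually_at_filter flat_def)
      have "((\<lambda>h. (1 / h) ^ 1 * poly P (1 / h) * exp (- (1 / h))) \<longlongrightarrow> 0) (at_right 0)"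
        by (rule filterlim_compose[OF poly_times_exp_tendsto_0])
           (use filterlim_inverse_at_top_right in \<open>simp add: inverse_eq_divide\<close>)
      then show "((\<lambda>h. flat P h / h) \<longlongrightarrow> 0) (at_right 0)"
        by (rule Lim_transform_eventually) (auto simp: eventually_at_filter flat_def)
    qed
    then show ?thesis using 3 by (simp add: DERIV_def flat_def)
  qed
qed

definition bump :: "real \<Rightarrow> real" where
  "bump s = (if s > 0 then exp (- (1 / s)) else 0)"

lemma bump_bounds [simp]: "0 \<le> bump s" "bump s \<le> 1"
  by (auto simp: bump_def)

lemma bump_pos_iff [simp]: "0 < bump s \<longleftrightarrow> 0 < s" "bump s = 0 \<longleftrightarrow> s \<le> 0"
  by (auto simp: bump_def)

lemma bump_tendsto: "(\<lambda>m. bump (real (Suc m) * s)) \<longlonglongrightarrow> (if s > 0 then 1 else 0)"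
proof (cases "s > 0")
  case True
  have "(\<lambda>m. exp (- (inverse (real (Suc m)) * (1 / s)))) \<longlonglongrightarrow> exp (- (0 * (1 / s)))"
    by (intro tendsto_intros LIMSEQ_inverse_real_of_nat)
  then show ?thesis using True by (simp add: bump_def inverse_eq_divide zero_less_mult_iff)
next
  case False
  then have "(\<lambda>m. bump (real (Suc m) * s)) = (\<lambda>m. 0)"
    by (intro ext) (simp add: mult_le_0_iff del: of_nat_Suc)
  then show ?thesis using False by (simp only: if_False tendsto_const)
qed

lemma bump_eq_flat: "bump s = flat 1 s"
  by (simp add: bump_def flat_def)

lemma C_diff_bump: "C_diff m (\<lambda>x. complex_of_real (bump (a * x $ i + b)))"
proof -
  define G where "G k s = complex_of_real (flat ((flat_deriv ^^ k) 1) s)" for k s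
  have "(G k has_vector_derivative G (Suc k) s) (at s)" for k s
    unfolding G_def using flat_has_derivative[of "(flat_deriv ^^ k) 1" s]
    by (intro has_vector_derivative_of_real) (simp add: has_real_derivative_iff_has_vector_derivative)
  from C_diff_coordinate[where G = G, OF this, of m a i b] show ?thesis
    by (simp add: G_def bump_eq_flat)
qed

subsection \<open>Test functions\<close>

lemma test_functions_iff: "\<theta> \<in> test_functions \<longleftrightarrow> (\<forall>m. C_diff m \<theta>) \<and> bounded {x. \<theta> x \<noteq> 0}"
  by (simp add: test_functions_def)

lemma test_functions_C_diff: "\<theta> \<in> test_functions \<Longrightarrow> C_diff m \<theta>"
  by (simp add: test_functions_iff)

lemma test_functions_differentiable: "\<theta> \<in> test_functions \<Longrightarrow> \<theta> differentiable_on UNIV"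
  using test_functions_C_diff[of \<theta> "Suc 0"] by simp

lemma test_functions_continuous: "\<theta> \<in> test_functions \<Longrightarrow> continuous_on UNIV \<theta>"
  by (rule C_diff_imp_continuous[OF test_functions_C_diff[of \<theta> 0]])

lemma test_functions_measurable [measurable_dest]: "\<theta> \<in> test_functions \<Longrightarrow> \<theta> \<in> borel_measurable borel"
  by (intro borel_measurable_continuous_onI test_functions_continuous)

lemma test_functions_support:
  assumes "\<theta> \<in> test_functions"
  obtains R where "R > 0" "\<And>x. norm x > R \<Longrightarrow> \<theta> x = 0"
proof -
  obtain R where "R > 0" "\<forall>x\<in>{x. \<theta> x \<noteq> 0}. norm x \<le> R"
    using assms by (auto simp: test_functions_iff bounded_pos)
  then show ?thesis by (intro that[of R]) force+
qed

lemma test_functions_bounded: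
  assumes "\<theta> \<in> test_functions"
  obtains M where "M > 0" "\<And>x. cmod (\<theta> x) \<le> M"
proof -
  obtain R where R: "\<And>x. norm x > R \<Longrightarrow> \<theta> x = 0" by (rule test_functions_support[OF assms]) blast
  have "compact (\<theta> ` cball 0 R)"
    by (intro compact_continuous_image continuous_on_subset[OF test_functions_continuous[OF assms]]) auto
  then obtain M where M: "M > 0" "\<forall>y\<in>\<theta> ` cball 0 R. cmod y \<le> M"
    using compact_imp_bounded bounded_pos by metis
  have "cmod (\<theta> x) \<le> M" for x
    using M R[of x] by (cases "norm x > R") auto
  with M(1) show ?thesis by (rule that)
qed

lemma test_functions_integrable_power:
  fixes \<theta> :: "real ^ 'n \<Rightarrow> complex"
  assumes "\<theta> \<in> test_functions" "k > 0"
  shows "integrable lborel (\<lambda>x. cmod (\<theta> x) ^ k)"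
proof -
  obtain R where R: "\<And>x. norm x > R \<Longrightarrow> \<theta> x = 0" by (rule test_functions_support[OF assms(1)]) blast
  obtain M where M: "\<And>x. cmod (\<theta> x) \<le> M" by (rule test_functions_bounded[OF assms(1)]) blast
  note [measurable] = test_functions_measurable[OF assms(1)]
  show ?thesis
  proof (rule Bochner_Integration.integrable_bound)
    show "integrable lborel (\<lambda>x::real ^ 'n. indicator (cball 0 R) x *\<^sub>R (M ^ k))"
      by (intro integrable_indicator) (use emeasure_bounded_finite[OF bounded_cball] in auto)
    show "AE x in lborel. norm (cmod (\<theta> x) ^ k) \<le> norm (indicator (cball 0 R) x *\<^sub>R M ^ k)"
    proof (intro AE_I2)
      fix x
      show "norm (cmod (\<theta> x) ^ k) \<le> norm (indicator (cball 0 R) x *\<^sub>R M ^ k)"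
        using R[of x] power_mono[OF M[of x], of k] assms(2)
        by (cases "norm x > R") (auto simp: power_0_left intro: order_trans[OF _ abs_ge_self])
    qed
  qed measurable
qed

lemma test_functions_integrable:
  assumes "\<theta> \<in> test_functions"
  shows "integrable lborel (\<lambda>x. cmod (\<theta> x))" "integrable lborel \<theta>"
proof -
  show *: "integrable lborel (\<lambda>x. cmod (\<theta> x))"
    using test_functions_integrable_power[OF assms, of 1] by simp
  show "integrable lborel \<theta>"
    using test_functions_measurable[OF assms] * by (simp add: integrable_norm_iff)
qed

lemma test_functions_L2: "\<theta> \<in> test_functions \<Longrightarrow> \<theta> \<in> L2"
  using test_functions_integrable_power[of \<theta> 2] test_functions_measurable[of \<theta>] by (simp add: L2_iff)

lemma test_functions_zero: "(\<lambda>x. 0) \<in> test_functions"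
  by (simp add: test_functions_iff C_diff_const)

lemma test_functions_add:
  assumes "f \<in> test_functions" "g \<in> test_functions"
  shows "(\<lambda>x. f x + g x) \<in> test_functions"
proof -
  have "bounded {x. f x + g x \<noteq> 0}"
    by (rule bounded_subset[of "{x. f x \<noteq> 0} \<union> {x. g x \<noteq> 0}"])
       (use assms in \<open>auto simp: test_functions_iff\<close>)
  then show ?thesis using assms by (auto simp: test_functions_iff C_diff_add)
qed

lemma test_functions_mult:
  assumes "f \<in> test_functions" "\<And>m. C_diff m g"
  shows "(\<lambda>x. g x * f x) \<in> test_functions"
proof -
  have "bounded {x. g x * f x \<noteq> 0}"
    by (rule bounded_subset[of "{x. f x \<noteq> 0}"]) (use assms in \<open>auto simp: test_functions_iff\<close>)
  then show ?thesis using assms by (auto simp: test_functions_iff C_diff_mult)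
qed

lemma test_functions_cmult: "f \<in> test_functions \<Longrightarrow> (\<lambda>x. c * f x) \<in> test_functions"
  by (rule test_functions_mult, assumption, rule C_diff_const)

lemma test_functions_sum:
  "(\<And>i. i \<in> A \<Longrightarrow> f i \<in> test_functions) \<Longrightarrow> (\<lambda>x. \<Sum>i\<in>A. f i x) \<in> test_functions"
  by (induction A rule: infinite_finite_induct) (auto intro: test_functions_zero test_functions_add)

lemma test_functions_translate:
  assumes "f \<in> test_functions"
  shows "(\<lambda>x. f (x + a)) \<in> test_functions"
proof -
  have "{x. f (x + a) \<noteq> 0} = (\<lambda>x. x - a) ` {x. f x \<noteq> 0}"
    by (auto simp: image_iff intro!: exI[of _ "_ + a"])
  then have "bounded {x. f (x + a) \<noteq> 0}"
    using assms by (simp add: test_functions_iff bounded_translation_minus)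
  then show ?thesis using assms by (auto simp: test_functions_iff C_diff_translate)
qed

lemma test_functions_partial:
  assumes "f \<in> test_functions"
  shows "partial j f \<in> test_functions"
proof -
  \<comment> \<open>Outside the closure of the support \<open>f\<close> is locally constant 0, so
    its derivative vanishes there.\<close>
  have "{x. partial j f x \<noteq> 0} \<subseteq> closure {x. f x \<noteq> 0}"
  proof (rule subsetI, rule ccontr)
    fix x assume x: "x \<in> {x. partial j f x \<noteq> 0}" "x \<notin> closure {x. f x \<noteq> 0}"
    have "((\<lambda>x. 0) has_derivative (\<lambda>h. 0)) (at x)" by simp
    then have "(f has_derivative (\<lambda>h. 0)) (at x)"
      by (rule has_derivative_transform_within_open[where s = "- closure {x. f x \<noteq> 0}"])
         (use x(2) closure_subset[of "{x. f x \<noteq> 0}"] in auto)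
    from partial_eqI[OF this, of j] x(1) show False by simp
  qed
  then have "bounded {x. partial j f x \<noteq> 0}"
    by (rule bounded_subset[rotated]) (use assms in \<open>auto simp: test_functions_iff\<close>)
  moreover have "C_diff m (partial j f)" for m
    using test_functions_C_diff[OF assms, of "Suc m"] by simp
  ultimately show ?thesis by (simp add: test_functions_iff)
qed

lemma test_functions_laplacian: "f \<in> test_functions \<Longrightarrow> laplacian f \<in> test_functions"
  unfolding laplacian_def[abs_def] by (intro test_functions_sum test_functions_partial)

lemma laplacian_translate:
  assumes "f \<in> test_functions"
  shows "laplacian (\<lambda>x. f (x + a)) = (\<lambda>x. laplacian f (x + a))"
  using assms unfolding laplacian_def[abs_def]
  by (simp add: partial_translate test_functions_differentiable test_functions_partial)

text \<open>One factor for each face of the box. The parameter \<open>m\<close> only steepens the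
  profile: the support stays the same while the values on the open box tend to 1.\<close>

definition box_bump :: "real \<Rightarrow> real ^ 'n \<Rightarrow> real ^ 'n \<Rightarrow> real ^ 'n \<Rightarrow> real" where
  "box_bump m a b x = (\<Prod>i\<in>UNIV. bump (m * (x $ i - a $ i)) * bump (m * (b $ i - x $ i)))"

lemma box_bump_bounds: "0 \<le> box_bump m a b x" "box_bump m a b x \<le> 1"
  unfolding box_bump_def by (auto intro!: prod_nonneg prod_le_1 mult_le_one)

lemma box_bump_pos_iff: "m > 0 \<Longrightarrow> box_bump m a b x > 0 \<longleftrightarrow> x \<in> box a b"
  using box_bump_bounds(1)[of m a b x]
  by (auto simp: less_le box_bump_def mem_box_cart mult_le_0_iff not_le)

lemma box_bump_test_function:
  assumes "m > 0"
  shows "(\<lambda>x. of_real (box_bump m a b x)) \<in> test_functions"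
proof -
  have "C_diff k (\<lambda>x. complex_of_real (bump (m * x $ i + - m * a $ i)) *
      of_real (bump (- m * x $ i + m * b $ i)))" for k i
    by (intro C_diff_mult C_diff_bump)
  then have "C_diff k (\<lambda>x. \<Prod>i\<in>UNIV. complex_of_real (bump (m * x $ i + - m * a $ i)) *
      of_real (bump (- m * x $ i + m * b $ i)))" for k
    by (intro C_diff_prod)
  then have "C_diff k (\<lambda>x. complex_of_real (box_bump m a b x))" for k
    by (simp add: box_bump_def algebra_simps)
  moreover have "{x. complex_of_real (box_bump m a b x) \<noteq> 0} \<subseteq> box a b"
    using box_bump_pos_iff[OF assms, of a b] box_bump_bounds(1)[of m a b] by (force simp: less_le)
  ultimately show ?thesis
    by (auto simp: test_functions_iff intro: bounded_subset[OF bounded_box])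
qed

lemma box_bump_tendsto: "(\<lambda>m. box_bump (real (Suc m)) a b x) \<longlonglongrightarrow> indicator (box a b) x"
proof -
  have "(\<lambda>m. box_bump (real (Suc m)) a b x)
      \<longlonglongrightarrow> (\<Prod>i\<in>UNIV. (if x $ i - a $ i > 0 then 1 else 0) * (if b $ i - x $ i > 0 then 1 else 0))"
    unfolding box_bump_def by (intro tendsto_intros bump_tendsto)
  also have "(\<Prod>i\<in>UNIV. (if x $ i - a $ i > 0 then 1 else 0) * (if b $ i - x $ i > 0 then 1 else 0)) =
      (indicator (box a b) x :: real)"
  proof (cases "x \<in> box a b")
    case False
    then obtain i where "\<not> (a $ i < x $ i \<and> x $ i < b $ i)" by (auto simp: mem_box_cart)
    then have "(\<Prod>i\<in>UNIV. (if x $ i - a $ i > 0 then 1 else 0) * (if b $ i - x $ i > 0 then 1 else 0)) = (0::real)"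
      by (intro prod_zero) (auto intro!: exI[of _ i])
    then show ?thesis using False by simp
  qed (auto simp: mem_box_cart)
  finally show ?thesis .
qed

subsection \<open>Density of the test functions\<close>

text \<open>Density is phrased as a property that is closed under linear combinations and
  \<open>L2\<close> limits, so that it can be propagated by induction over the Borel sets.\<close>

definition approximable :: "(real ^ 'n \<Rightarrow> complex) \<Rightarrow> bool" where
  "approximable f \<longleftrightarrow> f \<in> L2 \<and> (\<forall>e>0. \<exists>\<theta>\<in>test_functions. L2_norm (\<lambda>x. f x - \<theta> x) < e)"

lemma approximable_L2: "approximable f \<Longrightarrow> f \<in> L2"
  by (simp add: approximable_def)

lemma approximable_test: "\<theta> \<in> test_functions \<Longrightarrow> approximable \<theta>"
  unfolding approximable_def
  by (auto intro!: bexI[of _ \<theta>] test_functions_L2 simp: L2_norm_def)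

lemma approximable_limit:
  fixes f :: "nat \<Rightarrow> real ^ 'n \<Rightarrow> complex"
  assumes f: "\<And>k. approximable (f k)" and g: "g \<in> L2"
    and lim: "(\<lambda>k. L2_norm (\<lambda>x. f k x - g x)) \<longlonglongrightarrow> 0"
  shows "approximable g"
  unfolding approximable_def
proof (intro conjI allI impI g)
  fix e :: real assume e: "e > 0"
  then obtain k where k: "L2_norm (\<lambda>x. f k x - g x) < e / 2"
    using order_tendstoD(2)[OF lim, of "e / 2"] by (auto simp: eventually_sequentially)
  obtain \<theta> where \<theta>: "\<theta> \<in> test_functions" "L2_norm (\<lambda>x. f k x - \<theta> x) < e / 2"
    using f[of k] e by (auto simp: approximable_def dest!: spec[of _ "e / 2"])
  have "L2_norm (\<lambda>x. g x - \<theta> x) \<le> L2_norm (\<lambda>x. g x - f k x) + L2_norm (\<lambda>x. f k x - \<theta> x)"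
    by (intro L2_norm_triangle_diff g approximable_L2 f test_functions_L2 \<theta>)
  then have "L2_norm (\<lambda>x. g x - \<theta> x) < e"
    using k \<theta>(2) by (simp add: L2_norm_minus_commute[of g])
  then show "\<exists>\<theta>\<in>test_functions. L2_norm (\<lambda>x. g x - \<theta> x) < e" using \<theta>(1) by blast
qed

lemma approximable_add:
  assumes "approximable f" "approximable g"
  shows "approximable (\<lambda>x. f x + g x)"
  unfolding approximable_def
proof (intro conjI allI impI)
  note L2 = assms[THEN approximable_L2]
  show "(\<lambda>x. f x + g x) \<in> L2" by (intro L2_add L2)
  fix e :: real assume e: "e > 0"
  obtain \<theta> where \<theta>: "\<theta> \<in> test_functions" "L2_norm (\<lambda>x. f x - \<theta> x) < e / 2"
    using assms(1) e by (auto simp: approximable_def dest!: spec[of _ "e / 2"])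
  obtain \<eta> where \<eta>: "\<eta> \<in> test_functions" "L2_norm (\<lambda>x. g x - \<eta> x) < e / 2"
    using assms(2) e by (auto simp: approximable_def dest!: spec[of _ "e / 2"])
  have "L2_norm (\<lambda>x. f x + g x - (\<theta> x + \<eta> x)) \<le> L2_norm (\<lambda>x. f x - \<theta> x) + L2_norm (\<lambda>x. g x - \<eta> x)"
    using L2_norm_triangle[OF L2_diff[OF L2(1) test_functions_L2[OF \<theta>(1)]]
      L2_diff[OF L2(2) test_functions_L2[OF \<eta>(1)]]] by (simp add: algebra_simps)
  then show "\<exists>\<theta>\<in>test_functions. L2_norm (\<lambda>x. f x + g x - \<theta> x) < e"
    using \<theta> \<eta> by (intro bexI[OF _ test_functions_add[OF \<theta>(1) \<eta>(1)]]) simp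
qed

lemma approximable_cmult:
  assumes "approximable f"
  shows "approximable (\<lambda>x. c * f x)"
  unfolding approximable_def
proof (intro conjI allI impI)
  show "(\<lambda>x. c * f x) \<in> L2" by (intro L2_cmult approximable_L2 assms)
  fix e :: real assume e: "e > 0"
  have "e / (cmod c + 1) > 0" using e by (simp add: add_nonneg_pos)
  then obtain \<theta> where \<theta>: "\<theta> \<in> test_functions" "L2_norm (\<lambda>x. f x - \<theta> x) < e / (cmod c + 1)"
    using assms unfolding approximable_def by blast
  have "L2_norm (\<lambda>x. c * f x - c * \<theta> x) = cmod c * L2_norm (\<lambda>x. f x - \<theta> x)"
    by (simp add: L2_norm_cmult[symmetric] right_diff_distrib)
  also have "\<dots> \<le> cmod c * (e / (cmod c + 1))"
    using \<theta>(2) by (intro mult_left_mono) auto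
  also have "\<dots> = e * (cmod c / (cmod c + 1))" by simp
  also have "\<dots> < e * 1"
    using e by (intro mult_strict_left_mono) (auto simp: divide_less_eq add_nonneg_pos)
  finally have "L2_norm (\<lambda>x. c * f x - c * \<theta> x) < e" by simp
  then show "\<exists>\<theta>\<in>test_functions. L2_norm (\<lambda>x. c * f x - \<theta> x) < e"
    using test_functions_cmult[OF \<theta>(1), of c] by (rule bexI)
qed

lemma approximable_sum:
  "finite A \<Longrightarrow> (\<And>i. i \<in> A \<Longrightarrow> approximable (f i)) \<Longrightarrow> approximable (\<lambda>x. \<Sum>i\<in>A. f i x)"
  by (induction A rule: finite_induct) (auto intro: approximable_add approximable_test test_functions_zero)

lemma integrable_indicator_box: "integrable lborel (\<lambda>x::real^'n. indicator (box a b) x :: real)"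
  by (intro integrable_real_indicator) (use emeasure_bounded_finite[OF bounded_box] in auto)

lemma approximable_box: "approximable (\<lambda>x. of_real (indicator (box a b) x))"
proof (rule approximable_limit)
  show "approximable (\<lambda>x. of_real (box_bump (real (Suc m)) a b x))" for m
    by (intro approximable_test box_bump_test_function) simp
  show "(\<lambda>x. complex_of_real (indicator (box a b) x)) \<in> L2"
    by (rule L2_dominated[OF _ integrable_indicator_box[of a b]]) (auto split: split_indicator)
  have "(\<lambda>m. L2_norm (\<lambda>x. of_real (box_bump (real (Suc m)) a b x) - of_real (indicator (box a b) x))) \<longlonglongrightarrow> 0"
  proof (rule L2_dominated_convergence[OF _ _ integrable_indicator_box[of a b]])
    show "(\<lambda>x. complex_of_real (box_bump (real (Suc m)) a b x)) \<in> borel_measurable borel" for m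
      by (intro test_functions_measurable box_bump_test_function) simp
    show "AE x in lborel. (cmod (complex_of_real (box_bump (real (Suc m)) a b x) - of_real (indicator (box a b) x)))\<^sup>2
        \<le> indicator (box a b) x" for m
    proof (intro AE_I2)
      fix x
      show "(cmod (complex_of_real (box_bump (real (Suc m)) a b x) - of_real (indicator (box a b) x)))\<^sup>2
        \<le> indicator (box a b) x"
        using box_bump_pos_iff[of "real (Suc m)" a b x] box_bump_bounds[of "real (Suc m)" a b x]
        by (auto simp flip: of_real_diff simp del: of_nat_Suc split: split_indicator
            simp: abs_square_le_1 less_le)
    qed
    show "AE x in lborel. (\<lambda>m. complex_of_real (box_bump (real (Suc m)) a b x))
        \<longlonglongrightarrow> of_real (indicator (box a b) x)"
      by (intro AE_I2 tendsto_of_real box_bump_tendsto)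
  qed measurable
  then show "(\<lambda>k. L2_norm (\<lambda>x. complex_of_real (box_bump (real (Suc k)) a b x) - of_real (indicator (box a b) x))) \<longlonglongrightarrow> 0" .
qed

text \<open>Dynkin's pi-lambda theorem: the open boxes are stable under intersection and generate
  the Borel sets. Intersecting throughout with one fixed box keeps every indicator in
  \<open>L2\<close>, which complements would otherwise violate.\<close>

lemma approximable_bounded_set:
  fixes A :: "(real ^ 'n) set"
  assumes "A \<in> sets borel"
  shows "approximable (\<lambda>x. of_real (indicator (A \<inter> box a b) x))"
proof -
  define G where "G = range (\<lambda>(a, b). box a b :: (real ^ 'n) set)"
  have L2: "(\<lambda>x. complex_of_real (indicator (A \<inter> box a b) x)) \<in> L2" if "A \<in> sets borel" for A
    by (rule L2_dominated[OF _ integrable_indicator_box[of a b]])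
       (use that in \<open>auto split: split_indicator\<close>)
  have sigma: "A \<in> sigma_sets UNIV G"
    using assms unfolding borel_eq_box G_def by simp
  have stable: "Int_stable G"
    unfolding G_def Int_stable_def by (auto simp: box_Int_box)
  have "G \<subseteq> Pow UNIV" by simp
  with stable show ?thesis using sigma
  proof (induction rule: sigma_sets_induct_disjoint)
    case (basic A)
    then show ?case by (auto simp: G_def box_Int_box intro: approximable_box)
  next
    case empty
    show ?case by (simp add: approximable_test test_functions_zero)
  next
    case (compl A)
    have "(\<lambda>x. complex_of_real (indicator ((UNIV - A) \<inter> box a b) x)) =
      (\<lambda>x. of_real (indicator (box a b) x) + (-1) * of_real (indicator (A \<inter> box a b) x))"
      by (auto split: split_indicator)
    then show ?case by (simp only:) (intro approximable_add approximable_cmult approximable_box compl)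
  next
    case (union A)
    have sets: "A i \<in> sets borel" for i
      using union(2) unfolding borel_eq_box G_def by auto
    show ?case
    proof (rule approximable_limit)
      show "approximable (\<lambda>x. \<Sum>i<k. complex_of_real (indicator (A i \<inter> box a b) x))" for k
        by (intro approximable_sum union) auto
      show "(\<lambda>x. complex_of_real (indicator (\<Union> (range A) \<inter> box a b) x)) \<in> L2"
        using sets by (intro L2) auto
      \<comment> \<open>Disjointness turns the sums of indicators into indicators of unions, which
        are dominated by that of the fixed box.\<close>
      have partial_sum: "(\<Sum>i<k. complex_of_real (indicator (A i \<inter> box a b) x)) =
          of_real (indicator ((\<Union>i<k. A i) \<inter> box a b) x)" for k x
      proof -
        have "disjoint_family_on (\<lambda>i. A i \<inter> box a b) {..<k}"
          using union(1) unfolding disjoint_family_on_def by blast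
        then have "indicator (\<Union>i\<in>{..<k}. A i \<inter> box a b) x = (\<Sum>i<k. indicator (A i \<inter> box a b) x :: real)"
          by (intro indicator_UN_disjoint) auto
        then show ?thesis by (simp flip: of_real_sum)
      qed
      show "(\<lambda>k. L2_norm (\<lambda>x. (\<Sum>i<k. complex_of_real (indicator (A i \<inter> box a b) x)) -
          of_real (indicator (\<Union> (range A) \<inter> box a b) x))) \<longlonglongrightarrow> 0"
        unfolding partial_sum
      proof (rule L2_dominated_convergence[OF _ _ integrable_indicator_box[of a b]])
        show "AE x in lborel. (\<lambda>k. complex_of_real (indicator ((\<Union>i<k. A i) \<inter> box a b) x)) \<longlonglongrightarrow>
            of_real (indicator (\<Union> (range A) \<inter> box a b) x)"
        proof (intro AE_I2 tendsto_eventually)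
          fix x
          show "\<forall>\<^sub>F k in sequentially. complex_of_real (indicator ((\<Union>i<k. A i) \<inter> box a b) x) =
            of_real (indicator (\<Union> (range A) \<inter> box a b) x)"
          proof (cases "\<exists>i. x \<in> A i")
            case True
            then obtain i where "x \<in> A i" ..
            then show ?thesis
              by (intro eventually_sequentiallyI[of "Suc i"]) (auto split: split_indicator)
          qed (auto split: split_indicator)
        qed
      qed (use sets in \<open>auto split: split_indicator\<close>)
    qed
  qed
qed

theorem test_functions_dense:
  fixes f :: "real ^ 'n \<Rightarrow> complex"
  assumes "f \<in> L2"
  shows "approximable f"
proof -
  have [measurable]: "f \<in> borel_measurable borel" by (rule L2_measurable[OF assms])
  obtain s where s: "\<And>i. simple_function borel (s i)" "\<And>x. (\<lambda>i. s i x) \<longlonglongrightarrow> f x"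
      "\<And>i x. cmod (s i x) \<le> 2 * cmod (f x)"
    using borel_measurable_implies_sequence_metric[of f borel 0] by (auto simp: dist_norm)
  \<comment> \<open>Truncation makes each simple approximation a finite combination of indicators of
    bounded Borel sets.\<close>
  define Q :: "nat \<Rightarrow> (real ^ 'n) set" where "Q k = box (\<chi> i. - real k) (\<chi> i. real k)" for k
  define g where "g k x = s k x * of_real (indicator (Q k) x)" for k x
  have s_meas [measurable]: "s k \<in> borel_measurable borel" for k
    using s(1) by (rule borel_measurable_simple_function)
  have Q_meas [measurable]: "Q k \<in> sets borel" for k unfolding Q_def by simp
  have "approximable (g k)" for k
  proof -
    have fin: "finite (range (s k))" using s(1)[of k] by (simp add: simple_function_def)
    have "g k = (\<lambda>x. \<Sum>y\<in>range (s k). y * of_real (indicator (s k -` {y} \<inter> Q k) x))"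
    proof
      fix x
      have "(\<Sum>y\<in>range (s k). y * of_real (indicator (s k -` {y} \<inter> Q k) x)) =
          (\<Sum>y\<in>range (s k). if y = s k x then s k x * of_real (indicator (Q k) x) else 0)"
        by (intro sum.cong) (auto split: split_indicator)
      then show "g k x = (\<Sum>y\<in>range (s k). y * of_real (indicator (s k -` {y} \<inter> Q k) x))"
        using fin by (simp add: g_def)
    qed
    moreover have "s k -` {y} \<in> sets borel" for y
      using measurable_sets[OF s_meas, of "{y}" k] by simp
    ultimately show ?thesis
      using fin by (auto simp: Q_def intro!: approximable_sum approximable_cmult approximable_bounded_set)
  qed
  moreover have "(\<lambda>k. L2_norm (\<lambda>x. g k x - f x)) \<longlonglongrightarrow> 0"
  proof (rule L2_dominated_convergence)
    \<comment> \<open>The approximations satisfy \<open>cmod (s k x) \<le> 2 * cmod (f x)\<close>,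
      so the error is at most three times \<open>cmod (f x)\<close>; hence 9.\<close>
    show "integrable lborel (\<lambda>x. 9 * (cmod (f x))\<^sup>2)"
      using assms by (simp add: L2_iff)
    show "AE x in lborel. (cmod (g k x - f x))\<^sup>2 \<le> 9 * (cmod (f x))\<^sup>2" for k
    proof (intro AE_I2)
      fix x
      have "cmod (g k x) \<le> 2 * cmod (f x)"
        using s(3)[of k x] by (auto simp: g_def split: split_indicator)
      then have "cmod (g k x - f x) \<le> 3 * cmod (f x)"
        using norm_triangle_ineq4[of "g k x" "f x"] by linarith
      from power_mono[OF this, of 2] show "(cmod (g k x - f x))\<^sup>2 \<le> 9 * (cmod (f x))\<^sup>2"
        by (simp add: power_mult_distrib)
    qed
    show "AE x in lborel. (\<lambda>k. g k x) \<longlonglongrightarrow> f x"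
    proof (intro AE_I2)
      fix x :: "real ^ 'n"
      obtain N where N: "real N > norm x" using reals_Archimedean2 by blast
      have "g k x = s k x" if "k \<ge> N" for k
      proof -
        have "\<bar>x $ i\<bar> < real k" for i
          using component_le_norm_cart[of x i] N that by linarith
        then have "- real k < x $ i \<and> x $ i < real k" for i
          by (simp add: abs_less_iff minus_less_iff)
        then have "x \<in> Q k" by (simp add: Q_def mem_box_cart)
        then show ?thesis by (simp add: g_def)
      qed
      then have "eventually (\<lambda>k. s k x = g k x) sequentially"
        by (intro eventually_sequentiallyI[of N]) simp
      with s(2) show "(\<lambda>k. g k x) \<longlonglongrightarrow> f x" by (rule Lim_transform_eventually)
    qed
    show "g k \<in> borel_measurable borel" for k unfolding g_def by measurable
  qed measurable
  ultimately show ?thesis using assms by (blast intro: approximable_limit)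
qed

lemma test_functions_denseE:
  assumes "f \<in> L2" "e > 0"
  obtains \<theta> where "\<theta> \<in> test_functions" "L2_norm (\<lambda>x. f x - \<theta> x) < e"
  using test_functions_dense[OF assms(1)] assms(2) unfolding approximable_def by blast

lemma test_functions_dense_sequence:
  assumes "f \<in> L2"
  obtains \<theta> where "\<And>k::nat. \<theta> k \<in> test_functions" "(\<lambda>k. L2_norm (\<lambda>x. \<theta> k x - f x)) \<longlonglongrightarrow> 0"
proof -
  have "\<forall>k. \<exists>\<theta>. \<theta> \<in> test_functions \<and> L2_norm (\<lambda>x. f x - \<theta> x) < inverse (real (Suc k))"
    using test_functions_denseE[OF assms] by (metis inverse_positive_iff_positive of_nat_0_less_iff zero_less_Suc)
  then obtain \<theta> where \<theta>: "\<And>k. \<theta> k \<in> test_functions" "\<And>k. L2_norm (\<lambda>x. f x - \<theta> k x) < inverse (real (Suc k))"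
    by metis
  have "(\<lambda>k. L2_norm (\<lambda>x. \<theta> k x - f x)) \<longlonglongrightarrow> 0"
  proof (rule Lim_null_comparison[OF _ LIMSEQ_inverse_real_of_nat], intro always_eventually allI)
    show "norm (L2_norm (\<lambda>x. \<theta> k x - f x)) \<le> inverse (real (Suc k))" for k
      using \<theta>(2)[of k] by (simp add: L2_norm_minus_commute[of "\<theta> k"])
  qed
  with \<theta>(1) show ?thesis by (rule that)
qed

text \<open>Duality: test against functions approximating \<open>cnj f\<close>.\<close>

lemma L2_norm_le_by_duality:
  assumes f: "f \<in> L2" and C: "0 \<le> C" and le: "\<And>\<theta>. \<theta> \<in> test_functions \<Longrightarrow> cmod (\<integral>x. f x * \<theta> x \<partial>lborel) \<le> C * L2_norm \<theta>"
  shows "L2_norm f \<le> C"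
proof -
  obtain \<theta> where \<theta>: "\<And>k::nat. \<theta> k \<in> test_functions" "(\<lambda>k. L2_norm (\<lambda>x. \<theta> k x - cnj (f x))) \<longlonglongrightarrow> 0"
    by (rule test_functions_dense_sequence[OF L2_cnj[OF f]]) blast
  note L = test_functions_L2[OF \<theta>(1)]
  have lim1: "(\<lambda>k. \<integral>x. \<theta> k x * f x \<partial>lborel) \<longlonglongrightarrow> (\<integral>x. cnj (f x) * f x \<partial>lborel)"
    by (rule tendsto_integral_L2_mult[OF \<theta>(2) L2_cnj[OF f] always_eventually[OF allI[OF L]] f])
  have lim2: "(\<lambda>k. C * L2_norm (\<theta> k)) \<longlonglongrightarrow> C * L2_norm (\<lambda>x. cnj (f x))"
    by (rule tendsto_mult_left[OF tendsto_L2_norm[OF \<theta>(2) L2_cnj[OF f] always_eventually[OF allI[OF L]]]])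
  have "cmod (\<integral>x. cnj (f x) * f x \<partial>lborel) \<le> C * L2_norm (\<lambda>x. cnj (f x))"
    by (rule LIMSEQ_le[OF tendsto_norm[OF lim1] lim2]) (use le[OF \<theta>(1)] in \<open>auto simp: mult.commute\<close>)
  moreover have "(\<integral>x. cnj (f x) * f x \<partial>lborel) = of_real ((L2_norm f)\<^sup>2)"
  proof -
    have "cnj (f x) * f x = of_real ((cmod (f x))\<^sup>2)" for x
      unfolding complex_norm_square by (rule mult.commute)
    then show ?thesis by (simp only: L2_norm_power2 integral_complex_of_real)
  qed
  ultimately have *: "(L2_norm f)\<^sup>2 \<le> C * L2_norm f" by (simp add: norm_power)
  show ?thesis
  proof (cases "L2_norm f = 0")
    case True
    then show ?thesis using C by simp
  next
    case False
    then have "L2_norm f > 0" using L2_norm_nonneg[of f] by linarith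
    then show ?thesis using * by (simp add: power2_eq_square)
  qed
qed

subsection \<open>Hermitian convolution forms\<close>

text \<open>Tonelli: the substitution \<open>y = x - z\<close>, with Jacobian of modulus one, shows
  that the inner integral over \<open>y\<close> is the same for every \<open>x\<close>.\<close>

lemma integrable_convolution_kernel:
  fixes h k :: "'a::euclidean_space \<Rightarrow> real"
  assumes h: "integrable lborel h" "\<And>x. 0 \<le> h x" and k: "integrable lborel k" "\<And>x. 0 \<le> k x"
  shows "integrable (lborel \<Otimes>\<^sub>M lborel) (\<lambda>p. h (fst p) * k (fst p - snd p))" (is ?A)
    and "(\<integral>p. h (fst p) * k (fst p - snd p) \<partial>(lborel \<Otimes>\<^sub>M lborel)) =
      (\<integral>x. h x \<partial>lborel) * (\<integral>x. k x \<partial>lborel)" (is ?B)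
proof -
  have [measurable]: "h \<in> borel_measurable borel" "k \<in> borel_measurable borel"
    using h k by (auto dest: borel_measurable_integrable)
  have shift: "integrable lborel (\<lambda>y. k (x - y))" "(\<integral>y. k (x - y) \<partial>lborel) = (\<integral>y. k y \<partial>lborel)" for x
    using lborel_integrable_affine[of "-1" k x] lborel_integral_affine[of "-1" k x] k by simp_all
  show A: ?A
  proof (rule lborel_pair.Fubini_integrable)
    show "integrable lborel (\<lambda>x. \<integral>y. norm (h (fst (x, y)) * k (fst (x, y) - snd (x, y))) \<partial>lborel)"
      using h k shift by (simp add: abs_mult)
    show "AE x in lborel. integrable lborel (\<lambda>y. h (fst (x, y)) * k (fst (x, y) - snd (x, y)))"
      using shift by simp
  qed measurable
  show ?B
    using lborel_pair.integral_fst'[OF A] shift by simp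
qed

lemma integrable_convolution_kernel_snd:
  fixes h k :: "'a::euclidean_space \<Rightarrow> real"
  assumes h: "integrable lborel h" "\<And>x. 0 \<le> h x" and k: "integrable lborel k" "\<And>x. 0 \<le> k x"
  shows "integrable (lborel \<Otimes>\<^sub>M lborel) (\<lambda>p. h (snd p) * k (fst p - snd p))" (is ?A)
    and "(\<integral>p. h (snd p) * k (fst p - snd p) \<partial>(lborel \<Otimes>\<^sub>M lborel)) =
      (\<integral>x. h x \<partial>lborel) * (\<integral>x. k x \<partial>lborel)" (is ?B)
proof -
  have k': "integrable lborel (\<lambda>x. k (- x))" "(\<integral>x. k (- x) \<partial>lborel) = (\<integral>x. k x \<partial>lborel)"
    using lborel_integrable_affine[of "-1" k 0] lborel_integral_affine[of "-1" k 0] k by simp_all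
  note * = integrable_convolution_kernel[OF h k'(1) k(2)]
  from lborel_pair.integrable_product_swap[OF *(1)] show ?A by (simp add: case_prod_beta')
  from lborel_pair.integral_product_swap[OF borel_measurable_integrable[OF *(1)]] *(2) k'(2)
  show ?B by (simp add: case_prod_beta')
qed

text \<open>A smoothed version of the \<open>L2\<close> inner product, close to
  \<open>(\<integral>x. K x \<partial>lborel)\<close> times it if \<open>K\<close> is concentrated
  near 0. Only \<open>K\<close> has to be differentiable, so it can be studied along solutions that
  are merely in \<open>L2\<close>.\<close>

definition conv_form :: "(real ^ 'n \<Rightarrow> complex) \<Rightarrow> (real ^ 'n \<Rightarrow> complex) \<Rightarrow> (real ^ 'n \<Rightarrow> complex) \<Rightarrow> complex" where
  "conv_form K f g = (\<integral>p. f (fst p) * cnj (g (snd p)) * K (fst p - snd p) \<partial>(lborel \<Otimes>\<^sub>M lborel))"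

text \<open>The weight \<open>r\<close> remains free so that the later bound can be optimised over
  it; the choice \<open>r = 1\<close> already gives integrability.\<close>

lemma conv_form_AM_GM:
  fixes f g :: "real ^ 'n \<Rightarrow> complex"
  assumes "f \<in> L2" "g \<in> L2" "K \<in> test_functions" "r > 0"
  defines "F \<equiv> \<lambda>p. f (fst p) * cnj (g (snd p)) * K (fst p - snd p)"
    and "H \<equiv> \<lambda>p. r * ((cmod (f (fst p)))\<^sup>2 * cmod (K (fst p - snd p))) +
      (cmod (g (snd p)))\<^sup>2 * cmod (K (fst p - snd p)) / r"
  shows "2 * cmod (F p) \<le> H p" "integrable (lborel \<Otimes>\<^sub>M lborel) H"
    "(\<integral>p. H p \<partial>(lborel \<Otimes>\<^sub>M lborel)) = (\<integral>x. cmod (K x) \<partial>lborel) * (r * (L2_norm f)\<^sup>2 + (L2_norm g)\<^sup>2 / r)"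
proof -
  let ?k = "\<lambda>x. cmod (K x)"
  have k: "integrable lborel ?k" "\<And>x. 0 \<le> ?k x"
    using test_functions_integrable(1)[OF assms(3)] by auto
  note f = integrable_convolution_kernel[OF L2_square_integrable[OF assms(1)] zero_le_power2 k]
  note g = integrable_convolution_kernel_snd[OF L2_square_integrable[OF assms(2)] zero_le_power2 k]
  have "2 * cmod (F p) = 2 * (cmod (f (fst p)) * cmod (g (snd p))) * ?k (fst p - snd p)"
    by (simp add: F_def norm_mult)
  also have "\<dots> \<le> (r * (cmod (f (fst p)))\<^sup>2 + (cmod (g (snd p)))\<^sup>2 / r) * ?k (fst p - snd p)"
    by (intro mult_right_mono weighted_AM_GM assms) auto
  finally show "2 * cmod (F p) \<le> H p" by (simp add: H_def algebra_simps)
  show "integrable (lborel \<Otimes>\<^sub>M lborel) H"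
    unfolding H_def using f(1) g(1) by simp
  have "(\<integral>p. H p \<partial>(lborel \<Otimes>\<^sub>M lborel)) =
    r * (\<integral>p. (cmod (f (fst p)))\<^sup>2 * ?k (fst p - snd p) \<partial>(lborel \<Otimes>\<^sub>M lborel)) +
    (\<integral>p. (cmod (g (snd p)))\<^sup>2 * ?k (fst p - snd p) \<partial>(lborel \<Otimes>\<^sub>M lborel)) / r"
    unfolding H_def using f(1) g(1) by simp
  also have "\<dots> = (\<integral>x. cmod (K x) \<partial>lborel) * (r * (L2_norm f)\<^sup>2 + (L2_norm g)\<^sup>2 / r)"
    unfolding f(2) g(2) L2_norm_power2 by (simp add: algebra_simps)
  finally show "(\<integral>p. H p \<partial>(lborel \<Otimes>\<^sub>M lborel)) = (\<integral>x. cmod (K x) \<partial>lborel) * (r * (L2_norm f)\<^sup>2 + (L2_norm g)\<^sup>2 / r)" .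
qed

lemma conv_form_integrable:
  assumes "f \<in> L2" "g \<in> L2" "K \<in> test_functions"
  shows "integrable (lborel \<Otimes>\<^sub>M lborel) (\<lambda>p. f (fst p) * cnj (g (snd p)) * K (fst p - snd p))"
proof (rule Bochner_Integration.integrable_bound[OF conv_form_AM_GM(2)[OF assms zero_less_one]])
  note [measurable] = L2_measurable[OF assms(1)] L2_measurable[OF L2_cnj[OF assms(2)]] test_functions_measurable[OF assms(3)]
  show "(\<lambda>p. f (fst p) * cnj (g (snd p)) * K (fst p - snd p)) \<in> borel_measurable (lborel \<Otimes>\<^sub>M lborel)"
    by measurable
  show "AE p in lborel \<Otimes>\<^sub>M lborel. norm (f (fst p) * cnj (g (snd p)) * K (fst p - snd p)) \<le>
      norm (1 * ((cmod (f (fst p)))\<^sup>2 * cmod (K (fst p - snd p))) + (cmod (g (snd p)))\<^sup>2 * cmod (K (fst p - snd p)) / 1)"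
  proof (intro AE_I2)
    fix p
    show "norm (f (fst p) * cnj (g (snd p)) * K (fst p - snd p)) \<le>
      norm (1 * ((cmod (f (fst p)))\<^sup>2 * cmod (K (fst p - snd p))) + (cmod (g (snd p)))\<^sup>2 * cmod (K (fst p - snd p)) / 1)"
      using conv_form_AM_GM(1)[OF assms zero_less_one, of p]
        norm_ge_zero[of "f (fst p) * cnj (g (snd p)) * K (fst p - snd p)"]
      unfolding real_norm_def by linarith
  qed
qed

text \<open>Young's inequality in the form of Schur's test: integrating the modulus of the kernel
  over either variable gives the \<open>L1\<close> norm of \<open>K\<close>.\<close>

lemma conv_form_bound:
  assumes "f \<in> L2" "g \<in> L2" "K \<in> test_functions"
  shows "cmod (conv_form K f g) \<le> (\<integral>x. cmod (K x) \<partial>lborel) * (L2_norm f * L2_norm g)"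
proof -
  define k where "k = (\<integral>x. cmod (K x) \<partial>lborel)"
  have k: "k \<ge> 0" by (simp add: k_def)
  \<comment> \<open>The constant \<open>k\<close> is shared out as \<open>sqrt k\<close> to each
    side, to fit the bound by a product of two numbers.\<close>
  have "cmod (conv_form K f g) \<le> (sqrt k * L2_norm f) * (sqrt k * L2_norm g)"
  proof (rule product_bound_from_AM_GM)
    fix r :: real assume r: "r > 0"
    note AG = conv_form_AM_GM[OF assms r]
    have "2 * cmod (conv_form K f g) \<le>
        (\<integral>p. 2 * cmod (f (fst p) * cnj (g (snd p)) * K (fst p - snd p)) \<partial>(lborel \<Otimes>\<^sub>M lborel))"
      unfolding conv_form_def using integral_norm_bound by simp
    also have "\<dots> \<le> k * (r * (L2_norm f)\<^sup>2 + (L2_norm g)\<^sup>2 / r)"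
      unfolding k_def AG(3)[symmetric]
      by (intro integral_mono AG integrable_mult_right integrable_norm conv_form_integrable assms)
    also have "\<dots> = r * (sqrt k * L2_norm f)\<^sup>2 + (sqrt k * L2_norm g)\<^sup>2 / r"
      using k by (simp add: power_mult_distrib algebra_simps)
    finally show "2 * cmod (conv_form K f g) \<le> r * (sqrt k * L2_norm f)\<^sup>2 + (sqrt k * L2_norm g)\<^sup>2 / r" .
  qed (use k in auto)
  also have "\<dots> = (sqrt k * sqrt k) * (L2_norm f * L2_norm g)" by (simp only: ac_simps)
  also have "\<dots> = k * (L2_norm f * L2_norm g)" using k by simp
  finally show ?thesis by (simp add: k_def)
qed

lemma conv_form_diff_left:
  assumes "f \<in> L2" "f' \<in> L2" "g \<in> L2" "K \<in> test_functions"
  shows "conv_form K (\<lambda>x. f x - f' x) g = conv_form K f g - conv_form K f' g"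
  unfolding conv_form_def using conv_form_integrable[OF assms(1,3,4)] conv_form_integrable[OF assms(2,3,4)]
  by (subst Bochner_Integration.integral_diff[symmetric]) (auto simp: algebra_simps)

lemma conv_form_diff_right:
  assumes "f \<in> L2" "g \<in> L2" "g' \<in> L2" "K \<in> test_functions"
  shows "conv_form K f (\<lambda>x. g x - g' x) = conv_form K f g - conv_form K f g'"
  unfolding conv_form_def using conv_form_integrable[OF assms(1,2,4)] conv_form_integrable[OF assms(1,3,4)]
  by (subst Bochner_Integration.integral_diff[symmetric]) (auto simp: algebra_simps)

text \<open>The inner integral is the pairing of \<open>f\<close> with a translated test function,
  which is where the weak equation can be used.\<close>

lemma conv_form_iterated:
  assumes "f \<in> L2" "g \<in> L2" "K \<in> test_functions"
  shows "conv_form K f g = (\<integral>y. cnj (g y) * (\<integral>x. f x * K (x - y) \<partial>lborel) \<partial>lborel)"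
    and "integrable lborel (\<lambda>y. cnj (g y) * (\<integral>x. f x * K (x - y) \<partial>lborel))"
proof -
  have int: "integrable (lborel \<Otimes>\<^sub>M lborel) (case_prod (\<lambda>x y. f x * cnj (g y) * K (x - y)))"
    using conv_form_integrable[OF assms] by (simp add: case_prod_beta')
  have eq: "(\<integral>x. f x * cnj (g y) * K (x - y) \<partial>lborel) = cnj (g y) * (\<integral>x. f x * K (x - y) \<partial>lborel)" for y
    by (subst integral_mult_right_zero[symmetric]) (simp only: ac_simps)
  show "conv_form K f g = (\<integral>y. cnj (g y) * (\<integral>x. f x * K (x - y) \<partial>lborel) \<partial>lborel)"
    using lborel_pair.integral_snd[OF int] by (simp add: eq conv_form_def case_prod_beta')
  show "integrable lborel (\<lambda>y. cnj (g y) * (\<integral>x. f x * K (x - y) \<partial>lborel))"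
    using lborel_pair.integrable_snd[OF int] by (simp add: eq)
qed

text \<open>Exchanging the two variables turns \<open>K (x - y)\<close> into
  \<open>K (y - x)\<close>. In particular the diagonal values are real, which drives the
  cancellation in the conservation law.\<close>

lemma conv_form_hermitian:
  assumes "f \<in> L2" "g \<in> L2" "K \<in> test_functions" "\<And>x. K (- x) = cnj (K x)"
  shows "cnj (conv_form K f g) = conv_form K g f"
proof -
  have "cnj (conv_form K f g) = (\<integral>p. cnj (f (fst p) * cnj (g (snd p)) * K (fst p - snd p)) \<partial>(lborel \<Otimes>\<^sub>M lborel))"
    unfolding conv_form_def by (rule Bochner_Integration.integral_cnj[symmetric])
  also have "\<dots> = (\<integral>p. g (snd p) * cnj (f (fst p)) * K (snd p - fst p) \<partial>(lborel \<Otimes>\<^sub>M lborel))"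
    by (intro Bochner_Integration.integral_cong refl) (simp flip: assms(4))
  also have "\<dots> = conv_form K g f"
    using lborel_pair.integral_product_swap[OF borel_measurable_integrable[OF conv_form_integrable[OF assms(2,1,3)]]]
    by (simp add: conv_form_def case_prod_beta')
  finally show ?thesis .
qed

lemma partial_reflect_cnj:
  assumes "f differentiable_on UNIV"
  shows "partial j (\<lambda>x. cnj (f (- x))) = (\<lambda>x. - cnj (partial j f (- x)))"
proof
  fix x
  let ?D = "frechet_derivative f (at (- x))"
  have D: "(f has_derivative ?D) (at (- x))" by (rule has_derivative_frechet_derivative[OF assms])
  have "((\<lambda>x. f (- x)) has_derivative (\<lambda>h. ?D (- h))) (at x)"
    by (rule has_derivative_compose[where g = f and f = uminus, OF _ D]) (auto intro!: derivative_eq_intros)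
  then have "((\<lambda>x. cnj (f (- x))) has_derivative (\<lambda>h. cnj (?D (- h)))) (at x)"
    by (rule bounded_linear.has_derivative[OF bounded_linear_cnj])
  from partial_eqI[OF this] show "partial j (\<lambda>x. cnj (f (- x))) x = - cnj (partial j f (- x))"
    using linear_neg[OF bounded_linear.linear[OF has_derivative_bounded_linear[OF D]]] by (simp add: partial_def)
qed

lemma partial_minus:
  assumes "f differentiable_on UNIV"
  shows "partial j (\<lambda>x. - f x) = (\<lambda>x. - partial j f x)"
  using partial_mult[OF _ assms, of "\<lambda>x. -1"] by (simp add: partial_const)

text \<open>Each derivative of a reflected function produces a minus sign, and two of them
  cancel.\<close>

lemma laplacian_hermitian:
  assumes "K \<in> test_functions" "\<And>x. K (- x) = cnj (K x)"
  shows "laplacian K (- x) = cnj (laplacian K x)"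
proof -
  have K: "K = (\<lambda>x. cnj (K (- x)))" by (simp add: assms(2))
  have 1: "partial j K = (\<lambda>x. - cnj (partial j K (- x)))" for j
    by (subst K) (rule partial_reflect_cnj[OF test_functions_differentiable[OF assms(1)]])
  have d: "partial j K differentiable_on UNIV" for j
    by (intro test_functions_differentiable test_functions_partial assms)
  have "(\<lambda>x. cnj (partial j K (- x))) = (\<lambda>x. - partial j K x)" for j
    by (subst 1) simp
  then have d': "(\<lambda>x. cnj (partial j K (- x))) differentiable_on UNIV" for j
    using d[of j] by (simp add: differentiable_on_minus)
  have "partial j (partial j K) = (\<lambda>x. cnj (partial j (partial j K) (- x)))" for j
    by (subst 1) (simp add: partial_minus[OF d'] partial_reflect_cnj[OF d])
  from fun_cong[OF this, of _ x] show ?thesis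
    by (metis (no_types, lifting) K complex_cnj_cnj cnj_sum laplacian_def sum.cong)
qed

subsection \<open>Convolution with an approximate identity\<close>

lemma test_functions_uniformly_continuous:
  assumes "\<theta> \<in> test_functions" "e > 0"
  obtains d where "d > 0" "\<And>x y. norm (x - y) \<le> d \<Longrightarrow> cmod (\<theta> x - \<theta> y) < e"
proof -
  obtain R where R: "\<And>x. norm x > R \<Longrightarrow> \<theta> x = 0" by (rule test_functions_support[OF assms(1)]) blast
  have "uniformly_continuous_on (cball 0 (R + 1)) \<theta>"
    by (intro compact_uniformly_continuous continuous_on_subset[OF test_functions_continuous[OF assms(1)]]) auto
  then obtain d where d: "d > 0"
      "\<And>x y. x \<in> cball 0 (R + 1) \<Longrightarrow> y \<in> cball 0 (R + 1) \<Longrightarrow> dist y x < d \<Longrightarrow> dist (\<theta> y) (\<theta> x) < e"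
    using assms(2) unfolding uniformly_continuous_on_def by metis
  \<comment> \<open>The 1 keeps both points in the enlarged ball as soon as one of them is in the
    support ball; \<open>d / 2\<close> makes up for the non-strict inequality.\<close>
  have "cmod (\<theta> x - \<theta> y) < e" if *: "norm (x - y) \<le> min (d / 2) 1" for x y
  proof (cases "norm x > R \<and> norm y > R")
    case True
    then show ?thesis using R assms(2) by simp
  next
    case False
    have "norm x \<le> norm (x - y) + norm y" "norm y \<le> norm (x - y) + norm x"
      using norm_triangle_ineq[of "x - y" y] norm_triangle_ineq[of "y - x" x] by (simp_all add: norm_minus_commute)
    then have "x \<in> cball 0 (R + 1)" "y \<in> cball 0 (R + 1)" using False * by auto
    then show ?thesis using d(1) d(2)[of y x] * by (simp add: dist_norm)
  qed
  then show ?thesis using d(1) by (intro that[of "min (d / 2) 1"]) auto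
qed

text \<open>The mass of the kernel is left arbitrary: the estimates below are relative to it, so a
  box bump fits without computing its integral.\<close>

definition kernel_within :: "real \<Rightarrow> (real ^ 'n \<Rightarrow> real) \<Rightarrow> bool" where
  "kernel_within d \<kappa> \<longleftrightarrow> (\<lambda>x. of_real (\<kappa> x)) \<in> test_functions \<and> (\<forall>x. 0 \<le> \<kappa> x) \<and>
    (\<forall>x. norm x > d \<longrightarrow> \<kappa> x = 0)"

lemma conv_form_approximate_identity_test:
  assumes "\<theta> \<in> test_functions" "e > 0"
  obtains d where "d > 0" "\<And>\<kappa>. kernel_within d \<kappa> \<Longrightarrow>
    cmod (conv_form (\<lambda>x. of_real (\<kappa> x)) \<theta> \<theta> - of_real ((\<integral>x. \<kappa> x \<partial>lborel) * (L2_norm \<theta>)\<^sup>2)) \<le> e * (\<integral>x. \<kappa> x \<partial>lborel)"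
proof -
  \<comment> \<open>A modulus of continuity \<open>w\<close> will cost \<open>w\<close> times the
    \<open>L1\<close> norm of \<open>\<theta>\<close>, which must not exceed \<open>e\<close>;
    adding 1 keeps the denominator positive.\<close>
  define w where "w = e / ((\<integral>x. cmod (\<theta> x) \<partial>lborel) + 1)"
  have T: "(\<integral>x. cmod (\<theta> x) \<partial>lborel) \<ge> 0" by simp
  have w: "w > 0" "w * (\<integral>x. cmod (\<theta> x) \<partial>lborel) \<le> e"
    unfolding w_def using T assms(2) by (auto simp: divide_le_eq add_nonneg_pos intro!: divide_pos_pos)
  obtain d where d: "d > 0" "\<And>x y. norm (x - y) \<le> d \<Longrightarrow> cmod (\<theta> x - \<theta> y) < w"
    using test_functions_uniformly_continuous[OF assms(1) w(1)] by blast
  show ?thesis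
  proof (rule that[OF d(1)])
    fix \<kappa> :: "real ^ 'a \<Rightarrow> real"
    assume \<kappa>_within: "kernel_within d \<kappa>"
    then have K: "(\<lambda>x. complex_of_real (\<kappa> x)) \<in> test_functions"
      and nonneg: "\<And>x. 0 \<le> \<kappa> x" and supp: "\<And>x. norm x > d \<Longrightarrow> \<kappa> x = 0"
      by (auto simp: kernel_within_def)
    let ?k = "\<integral>x. \<kappa> x \<partial>lborel"
    have \<kappa>: "integrable lborel \<kappa>"
      using test_functions_integrable(1)[OF K] nonneg by simp
    have k: "?k \<ge> 0" using nonneg by simp
    have [measurable]: "\<theta> \<in> borel_measurable borel" by (rule test_functions_measurable[OF assms(1)])
    note L = test_functions_L2[OF assms(1)]
    have shift: "integrable lborel (\<lambda>x. \<kappa> (x - y))" "(\<integral>x. \<kappa> (x - y) \<partial>lborel) = ?k" for y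
      using lborel_integrable_affine[of 1 \<kappa> "-y"] lborel_integral_affine[of 1 \<kappa> "-y"] \<kappa>
      by (auto simp: dest: borel_measurable_integrable)
    \<comment> \<open>The kernel lives on \<open>norm (x - y) \<le> d\<close>, where replacing
      \<open>\<theta> x\<close> by \<open>\<theta> y\<close> costs less than
      \<open>w\<close>.\<close>
    have inner: "cmod ((\<integral>x. \<theta> x * of_real (\<kappa> (x - y)) \<partial>lborel) - \<theta> y * of_real ?k) \<le> w * ?k" for y
    proof -
      have K_shift: "(\<lambda>x. complex_of_real (\<kappa> (x - y))) \<in> test_functions"
        using test_functions_translate[OF K, of "- y"] by simp
      have i1: "integrable lborel (\<lambda>x. \<theta> x * complex_of_real (\<kappa> (x - y)))"
        by (rule L2_mult_integrable[OF L test_functions_L2[OF K_shift]])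
      have i2: "integrable lborel (\<lambda>x. \<theta> y * complex_of_real (\<kappa> (x - y)))"
        using shift(1)[of y] by (intro integrable_mult_right integrable_of_real)
      have "(\<integral>x. \<theta> x * of_real (\<kappa> (x - y)) \<partial>lborel) - \<theta> y * of_real ?k =
          (\<integral>x. (\<theta> x - \<theta> y) * of_real (\<kappa> (x - y)) \<partial>lborel)"
        using i1 i2 shift(2)[of y] by (simp add: left_diff_distrib)
      also have "cmod \<dots> \<le> (\<integral>x. cmod ((\<theta> x - \<theta> y) * of_real (\<kappa> (x - y))) \<partial>lborel)"
        by (rule integral_norm_bound)
      also have "\<dots> \<le> (\<integral>x. w * \<kappa> (x - y) \<partial>lborel)"
      proof (rule integral_mono)
        show "integrable lborel (\<lambda>x. cmod ((\<theta> x - \<theta> y) * of_real (\<kappa> (x - y))))"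
          using Bochner_Integration.integrable_diff[OF i1 i2]
          by (intro integrable_norm) (simp add: left_diff_distrib)
        show "cmod ((\<theta> x - \<theta> y) * of_real (\<kappa> (x - y))) \<le> w * \<kappa> (x - y)" for x
          using d(2)[of x y] supp[of "x - y"] nonneg[of "x - y"]
          by (cases "norm (x - y) > d") (auto simp: norm_mult intro!: mult_right_mono)
      qed (use shift in simp)
      also have "\<dots> = w * ?k" using shift by simp
      finally show ?thesis .
    qed
    have i3: "integrable lborel (\<lambda>y. cnj (\<theta> y) * (\<theta> y * of_real ?k))"
      using integrable_mult_left[OF L2_mult_integrable[OF L2_cnj[OF L] L]] by (simp add: mult.assoc)
    have eq: "(\<integral>y. cnj (\<theta> y) * (\<theta> y * of_real ?k) \<partial>lborel) = of_real (?k * (L2_norm \<theta>)\<^sup>2)"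
    proof -
      have "cnj (\<theta> y) * (\<theta> y * of_real ?k) = of_real (?k * (cmod (\<theta> y))\<^sup>2)" for y
        by (simp only: of_real_mult complex_norm_square ac_simps)
      then show ?thesis by (simp only: L2_norm_power2 integral_complex_of_real integral_mult_right_zero)
    qed
    note it = conv_form_iterated[OF L L K]
    have "cmod (conv_form (\<lambda>x. of_real (\<kappa> x)) \<theta> \<theta> - of_real (?k * (L2_norm \<theta>)\<^sup>2)) =
        cmod (\<integral>y. cnj (\<theta> y) * ((\<integral>x. \<theta> x * of_real (\<kappa> (x - y)) \<partial>lborel) - \<theta> y * of_real ?k) \<partial>lborel)"
      unfolding it(1) eq[symmetric] by (subst Bochner_Integration.integral_diff[symmetric, OF it(2) i3]) (simp only: right_diff_distrib)
    also have "\<dots> \<le> (\<integral>y. cmod (cnj (\<theta> y) * ((\<integral>x. \<theta> x * of_real (\<kappa> (x - y)) \<partial>lborel) - \<theta> y * of_real ?k)) \<partial>lborel)"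
      by (rule integral_norm_bound)
    also have "\<dots> \<le> (\<integral>y. (w * ?k) * cmod (\<theta> y) \<partial>lborel)"
    proof (rule integral_mono)
      show "integrable lborel (\<lambda>y. cmod (cnj (\<theta> y) * ((\<integral>x. \<theta> x * of_real (\<kappa> (x - y)) \<partial>lborel) - \<theta> y * of_real ?k)))"
        using Bochner_Integration.integrable_diff[OF it(2) i3]
        by (intro integrable_norm) (simp only: right_diff_distrib)
      show "integrable lborel (\<lambda>y. (w * ?k) * cmod (\<theta> y))"
        using test_functions_integrable(1)[OF assms(1)] by simp
      show "cmod (cnj (\<theta> y) * ((\<integral>x. \<theta> x * of_real (\<kappa> (x - y)) \<partial>lborel) - \<theta> y * of_real ?k)) \<le> (w * ?k) * cmod (\<theta> y)" for y
        using inner[of y] by (simp add: norm_mult mult.commute[of "cmod (\<theta> y)"] mult_right_mono)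
    qed
    also have "\<dots> = (w * (\<integral>x. cmod (\<theta> x) \<partial>lborel)) * ?k" by simp
    also have "\<dots> \<le> e * ?k" using w(2) k by (rule mult_right_mono)
    finally show "cmod (conv_form (\<lambda>x. of_real (\<kappa> x)) \<theta> \<theta> - of_real (?k * (L2_norm \<theta>)\<^sup>2)) \<le> e * ?k" .
  qed
qed

lemma conv_form_approximate_identity:
  assumes f: "f \<in> L2" and "e > 0"
  obtains d where "d > 0" "\<And>\<kappa>. kernel_within d \<kappa> \<Longrightarrow>
    cmod (conv_form (\<lambda>x. of_real (\<kappa> x)) f f - of_real ((\<integral>x. \<kappa> x \<partial>lborel) * (L2_norm f)\<^sup>2)) \<le> e * (\<integral>x. \<kappa> x \<partial>lborel)"
proof -
  \<comment> \<open>The error budget: exchanging \<open>f\<close> for \<open>\<theta>\<close> in the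
    form and in the norm costs at most \<open>e / 4\<close> each, relative to the mass, and the test
    function case costs \<open>e / 2\<close>. The cap 1 ensures
    \<open>L2_norm \<theta> \<le> L2_norm f + 1\<close>.\<close>
  define h where "h = min 1 (e / (4 * (2 * L2_norm f + 1)))"
  have den: "0 < 4 * (2 * L2_norm f + 1)"
    by (intro mult_pos_pos add_nonneg_pos) auto
  have h: "h > 0" "h \<le> 1" "4 * (h * (2 * L2_norm f + 1)) \<le> e"
  proof -
    show "h > 0" "h \<le> 1" unfolding h_def using den assms(2) by auto
    have "h \<le> e / (4 * (2 * L2_norm f + 1))" by (simp add: h_def)
    then show "4 * (h * (2 * L2_norm f + 1)) \<le> e" using den by (simp add: le_divide_eq algebra_simps)
  qed
  obtain \<theta> where \<theta>: "\<theta> \<in> test_functions" "L2_norm (\<lambda>x. f x - \<theta> x) < h"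
    by (rule test_functions_denseE[OF f h(1)])
  note L = test_functions_L2[OF \<theta>(1)]
  have norm_diff: "\<bar>L2_norm f - L2_norm \<theta>\<bar> \<le> h"
    using L2_norm_diff_le[OF f L] \<theta>(2) by linarith
  have sum: "L2_norm f + L2_norm \<theta> \<le> 2 * L2_norm f + 1" using norm_diff h(2) by linarith
  have "e / 2 > 0" using assms(2) by simp
  then obtain d where d: "d > 0" "\<And>\<kappa>. kernel_within d \<kappa> \<Longrightarrow>
    cmod (conv_form (\<lambda>x. of_real (\<kappa> x)) \<theta> \<theta> - of_real ((\<integral>x. \<kappa> x \<partial>lborel) * (L2_norm \<theta>)\<^sup>2)) \<le> e / 2 * (\<integral>x. \<kappa> x \<partial>lborel)"
    by (rule conv_form_approximate_identity_test[OF \<theta>(1)]) blast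
  show ?thesis
  proof (rule that[OF d(1)])
    fix \<kappa> :: "real ^ 'a \<Rightarrow> real"
    assume \<kappa>_within: "kernel_within d \<kappa>"
    then have K: "(\<lambda>x. complex_of_real (\<kappa> x)) \<in> test_functions"
      and nonneg: "\<And>x. 0 \<le> \<kappa> x" and supp: "\<And>x. norm x > d \<Longrightarrow> \<kappa> x = 0"
      by (auto simp: kernel_within_def)
    let ?k = "\<integral>x. \<kappa> x \<partial>lborel"
    let ?S = "conv_form (\<lambda>x. of_real (\<kappa> x))"
    have k: "?k \<ge> 0" using nonneg by simp
    have kk: "(\<integral>x. cmod (complex_of_real (\<kappa> x)) \<partial>lborel) = ?k" using nonneg by simp
    note L' = L2_diff[OF f L]
    have "?S f f - ?S \<theta> \<theta> = ?S (\<lambda>x. f x - \<theta> x) f + ?S \<theta> (\<lambda>x. f x - \<theta> x)"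
      by (simp add: conv_form_diff_left[OF f L f K] conv_form_diff_right[OF L f L K])
    then have "cmod (?S f f - ?S \<theta> \<theta>) \<le> cmod (?S (\<lambda>x. f x - \<theta> x) f) + cmod (?S \<theta> (\<lambda>x. f x - \<theta> x))"
      by (simp only: norm_triangle_ineq)
    also have "\<dots> \<le> ?k * (L2_norm (\<lambda>x. f x - \<theta> x) * L2_norm f) + ?k * (L2_norm \<theta> * L2_norm (\<lambda>x. f x - \<theta> x))"
      using conv_form_bound[OF L' f K] conv_form_bound[OF L L' K] by (intro add_mono) (simp_all only: kk)
    also have "\<dots> = ?k * (L2_norm (\<lambda>x. f x - \<theta> x) * (L2_norm f + L2_norm \<theta>))"
      by (simp add: algebra_simps)
    also have "\<dots> \<le> ?k * (h * (2 * L2_norm f + 1))"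
      using \<theta>(2) sum h(1) by (intro mult_left_mono[OF _ k] mult_mono) auto
    finally have 1: "cmod (?S f f - ?S \<theta> \<theta>) \<le> ?k * (h * (2 * L2_norm f + 1))" .
    have "\<bar>(L2_norm \<theta>)\<^sup>2 - (L2_norm f)\<^sup>2\<bar> = \<bar>L2_norm f - L2_norm \<theta>\<bar> * (L2_norm f + L2_norm \<theta>)"
    proof -
      have "(L2_norm \<theta>)\<^sup>2 - (L2_norm f)\<^sup>2 = - ((L2_norm f - L2_norm \<theta>) * (L2_norm f + L2_norm \<theta>))"
        by (simp add: power2_eq_square algebra_simps)
      then show ?thesis by (simp only: abs_minus abs_mult) simp
    qed
    also have "\<dots> \<le> h * (2 * L2_norm f + 1)"
      using norm_diff sum h(1) by (intro mult_mono) auto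
    finally have 2: "cmod (of_real (?k * (L2_norm \<theta>)\<^sup>2) - of_real (?k * (L2_norm f)\<^sup>2)) \<le> ?k * (h * (2 * L2_norm f + 1))"
      using k by (simp only: of_real_diff[symmetric] norm_of_real right_diff_distrib[symmetric] abs_mult abs_of_nonneg mult_left_mono)
    have 3: "cmod (?S \<theta> \<theta> - of_real (?k * (L2_norm \<theta>)\<^sup>2)) \<le> e / 2 * ?k"
      by (rule d(2)[OF \<kappa>_within])
    have "cmod (?S f f - of_real (?k * (L2_norm f)\<^sup>2)) \<le> cmod (?S f f - ?S \<theta> \<theta>)
        + cmod (?S \<theta> \<theta> - of_real (?k * (L2_norm \<theta>)\<^sup>2)) + cmod (of_real (?k * (L2_norm \<theta>)\<^sup>2) - of_real (?k * (L2_norm f)\<^sup>2))"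
      using norm_triangle_ineq[of "?S f f - ?S \<theta> \<theta> + (?S \<theta> \<theta> - of_real (?k * (L2_norm \<theta>)\<^sup>2))"
          "of_real (?k * (L2_norm \<theta>)\<^sup>2) - of_real (?k * (L2_norm f)\<^sup>2)"]
        norm_triangle_ineq[of "?S f f - ?S \<theta> \<theta>" "?S \<theta> \<theta> - of_real (?k * (L2_norm \<theta>)\<^sup>2)"] by simp
    also have "\<dots> \<le> ?k * (2 * (h * (2 * L2_norm f + 1)) + e / 2)"
      using 1 2 3 by (simp add: algebra_simps)
    also have "\<dots> \<le> ?k * e"
      using h(3) by (intro mult_left_mono[OF _ k]) simp
    finally show "cmod (?S f f - of_real (?k * (L2_norm f)\<^sup>2)) \<le> e * ?k" by (simp add: mult.commute)
  qed
qed

subsection \<open>Mass conservation for weak solutions of the free equation\<close>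

text \<open>This is \<open>free_evolution\<close> without the initial condition, a class that is
  closed under linear combinations and boosts.\<close>

definition weak_free :: "(real \<Rightarrow> real ^ 'n \<Rightarrow> complex) \<Rightarrow> bool" where
  "weak_free v \<longleftrightarrow> continuous_in_L2 v \<and> schroedinger_equation (\<lambda>z. 0) v"

lemma weak_free_L2: "weak_free v \<Longrightarrow> v t \<in> L2"
  by (simp add: weak_free_def continuous_in_L2_def)

lemma weak_free_tendsto: "weak_free v \<Longrightarrow> ((\<lambda>s. L2_norm (\<lambda>x. v s x - v t x)) \<longlongrightarrow> 0) (at t)"
  by (simp add: weak_free_def continuous_in_L2_def)

lemma weak_free_pairing_derivative:
  assumes "weak_free v" "\<theta> \<in> test_functions"
  shows "((\<lambda>s. \<integral>x. v s x * \<theta> x \<partial>lborel) has_vector_derivative \<i> * (\<integral>x. v t x * laplacian \<theta> x \<partial>lborel)) (at t)"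
proof -
  obtain D where D: "((\<lambda>s. \<integral>x. v s x * \<theta> x \<partial>lborel) has_vector_derivative D) (at t)"
      "\<i> * D + (\<integral>x. v t x * laplacian \<theta> x \<partial>lborel) = 0"
    using assms unfolding weak_free_def schroedinger_equation_def by fastforce
  have "D = - (\<i> * (\<i> * D))" by (simp flip: mult.assoc)
  also have "\<i> * D = - (\<integral>x. v t x * laplacian \<theta> x \<partial>lborel)"
    using D(2) by (simp add: eq_neg_iff_add_eq_0)
  finally show ?thesis using D(1) by simp
qed

lemma weak_freeI:
  assumes "\<And>t. v t \<in> L2" "\<And>t. ((\<lambda>s. L2_norm (\<lambda>x. v s x - v t x)) \<longlongrightarrow> 0) (at t)"
    and "\<And>\<theta> t. \<theta> \<in> test_functions \<Longrightarrow> ((\<lambda>s. \<integral>x. v s x * \<theta> x \<partial>lborel) has_vector_derivative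
      \<i> * (\<integral>x. v t x * laplacian \<theta> x \<partial>lborel)) (at t)"
  shows "weak_free v"
  unfolding weak_free_def continuous_in_L2_def schroedinger_equation_def
proof (intro conjI allI ballI)
  fix \<theta> :: "real ^ 'a \<Rightarrow> complex" and t assume \<theta>: "\<theta> \<in> test_functions"
  show "\<exists>D. ((\<lambda>s. \<integral>x. v s x * \<theta> x \<partial>lborel) has_vector_derivative D) (at t) \<and>
      \<i> * D + (\<integral>x. v t x * laplacian \<theta> x \<partial>lborel) - (\<integral>x. 0 * \<theta> x \<partial>lborel) = 0"
    using assms(3)[OF \<theta>, of t] by (intro exI conjI) (auto simp flip: mult.assoc)
qed (use assms(1,2) in auto)

lemma weak_free_linear_combination:
  assumes u: "weak_free u" and v: "weak_free v"
  shows "weak_free (\<lambda>t x. a * u t x + b * v t x)"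
proof (rule weak_freeI)
  show "(\<lambda>x. a * u t x + b * v t x) \<in> L2" for t
    by (intro L2_add L2_cmult weak_free_L2 assms)
  fix t
  show "((\<lambda>s. L2_norm (\<lambda>x. a * u s x + b * v s x - (a * u t x + b * v t x))) \<longlongrightarrow> 0) (at t)"
  proof (rule Lim_null_comparison)
    show "\<forall>\<^sub>F s in at t. norm (L2_norm (\<lambda>x. a * u s x + b * v s x - (a * u t x + b * v t x)))
      \<le> cmod a * L2_norm (\<lambda>x. u s x - u t x) + cmod b * L2_norm (\<lambda>x. v s x - v t x)"
    proof (intro always_eventually allI)
      fix s
      note L = L2_cmult[OF L2_diff[OF weak_free_L2[OF u, of s] weak_free_L2[OF u, of t]], of a]
        L2_cmult[OF L2_diff[OF weak_free_L2[OF v, of s] weak_free_L2[OF v, of t]], of b]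
      show "norm (L2_norm (\<lambda>x. a * u s x + b * v s x - (a * u t x + b * v t x)))
          \<le> cmod a * L2_norm (\<lambda>x. u s x - u t x) + cmod b * L2_norm (\<lambda>x. v s x - v t x)"
        using L2_norm_triangle[OF L] unfolding L2_norm_cmult by (simp add: algebra_simps)
    qed
    show "((\<lambda>s. cmod a * L2_norm (\<lambda>x. u s x - u t x) + cmod b * L2_norm (\<lambda>x. v s x - v t x)) \<longlongrightarrow> 0) (at t)"
      using tendsto_add[OF tendsto_mult_left[OF weak_free_tendsto[OF u]] tendsto_mult_left[OF weak_free_tendsto[OF v]]]
      by simp
  qed
  fix \<theta> :: "real ^ 'a \<Rightarrow> complex" assume \<theta>: "\<theta> \<in> test_functions"
  have split: "(\<integral>x. (a * u s x + b * v s x) * \<eta> x \<partial>lborel) =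
      a * (\<integral>x. u s x * \<eta> x \<partial>lborel) + b * (\<integral>x. v s x * \<eta> x \<partial>lborel)" if "\<eta> \<in> test_functions" for s \<eta>
    using L2_mult_integrable[OF weak_free_L2[OF u, of s] test_functions_L2[OF that]]
      L2_mult_integrable[OF weak_free_L2[OF v, of s] test_functions_L2[OF that]]
    by (simp add: distrib_right mult.assoc)
  show "((\<lambda>s. \<integral>x. (a * u s x + b * v s x) * \<theta> x \<partial>lborel) has_vector_derivative
      \<i> * (\<integral>x. (a * u t x + b * v t x) * laplacian \<theta> x \<partial>lborel)) (at t)"
    unfolding split[OF \<theta>] split[OF test_functions_laplacian[OF \<theta>]]
    using has_vector_derivative_add[OF has_vector_derivative_mult_right[OF weak_free_pairing_derivative[OF u \<theta>, of t], of a]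
      has_vector_derivative_mult_right[OF weak_free_pairing_derivative[OF v \<theta>, of t], of b]]
    by (simp add: algebra_simps)
qed

lemma tendsto_conv_form_right:
  fixes g :: "nat \<Rightarrow> real ^ 'n \<Rightarrow> complex"
  assumes "f \<in> L2" "h \<in> L2" "\<And>k. g k \<in> L2" "K \<in> test_functions" "(\<lambda>k. L2_norm (\<lambda>x. g k x - h x)) \<longlonglongrightarrow> 0"
  shows "(\<lambda>k. conv_form K f (g k)) \<longlonglongrightarrow> conv_form K f h"
proof (rule LIM_zero_cancel, rule Lim_null_comparison)
  show "\<forall>\<^sub>F k in sequentially. norm (conv_form K f (g k) - conv_form K f h) \<le>
      ((\<integral>x. cmod (K x) \<partial>lborel) * L2_norm f) * L2_norm (\<lambda>x. g k x - h x)"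
    using conv_form_bound[OF assms(1) L2_diff[OF assms(3,2)] assms(4)]
    by (simp add: conv_form_diff_right[OF assms(1,3,2,4)] mult.assoc)
  show "(\<lambda>k. ((\<integral>x. cmod (K x) \<partial>lborel) * L2_norm f) * L2_norm (\<lambda>x. g k x - h x)) \<longlonglongrightarrow> 0"
    using tendsto_mult_left[OF assms(5)] by simp
qed

text \<open>With \<open>g\<close> frozen, Fubini reduces the claim to differentiating the pairings
  \<open>\<psi> s y\<close> under an integral over \<open>y\<close>. Their quotients are bounded by
  \<open>M\<close> uniformly in \<open>y\<close>, so \<open>M * cmod (g y)\<close> is a majorant.
  This uses integrability of \<open>g\<close>, hence a test function in the second slot.\<close>

lemma weak_free_conv_form_derivative:
  fixes v :: "real \<Rightarrow> real ^ 'n \<Rightarrow> complex"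
  assumes v: "weak_free v" and K: "K \<in> test_functions" and g: "g \<in> test_functions"
  shows "((\<lambda>s. conv_form K (v s) g) has_vector_derivative \<i> * conv_form (laplacian K) (v t) g) (at t)"
proof -
  define \<psi> where "\<psi> s y = (\<integral>x. v s x * K (x - y) \<partial>lborel)" for s y
  define \<psi>' where "\<psi>' s y = \<i> * (\<integral>x. v s x * laplacian K (x - y) \<partial>lborel)" for s y
  have Ky: "(\<lambda>x. K (x - y)) \<in> test_functions" "laplacian (\<lambda>x. K (x - y)) = (\<lambda>x. laplacian K (x - y))" for y
    using test_functions_translate[OF K, of "- y"] laplacian_translate[OF K, of "- y"] by simp_all
  have LK: "laplacian K \<in> L2" by (intro test_functions_L2 test_functions_laplacian K)
  have deriv: "((\<lambda>s. \<psi> s y) has_vector_derivative \<psi>' s y) (at s)" for s y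
    using weak_free_pairing_derivative[OF v Ky(1)] by (simp add: \<psi>_def \<psi>'_def Ky(2))
  \<comment> \<open>Near \<open>t\<close> the norm of \<open>v s\<close> exceeds that of
    \<open>v t\<close> by less than 1; this and Cauchy-Schwarz bound the derivative of
    \<open>\<psi>\<close> for all \<open>y\<close> at once.\<close>
  define M where "M = (L2_norm (v t) + 1) * L2_norm (laplacian K)"
  have "((\<lambda>s. L2_norm (v s)) \<longlongrightarrow> L2_norm (v t)) (at t)"
    by (intro tendsto_L2_norm weak_free_tendsto v weak_free_L2 always_eventually allI)
  then have "eventually (\<lambda>s. L2_norm (v s) < L2_norm (v t) + 1) (at t)"
    by (rule order_tendstoD) simp
  then obtain d where d: "d > 0" "\<And>s. s \<noteq> t \<Longrightarrow> dist s t < d \<Longrightarrow> L2_norm (v s) < L2_norm (v t) + 1"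
    unfolding eventually_at by auto
  have bound: "cmod (\<psi>' s y) \<le> M" if "s \<in> ball t d" for s y
  proof -
    have "L2_norm (v s) \<le> L2_norm (v t) + 1"
      using d(2)[of s] that by (cases "s = t") (auto simp: dist_commute)
    moreover have "cmod (\<psi>' s y) \<le> L2_norm (v s) * L2_norm (laplacian K)"
      using L2_Cauchy_Schwarz[OF weak_free_L2[OF v, of s] L2_translate[OF LK, of "- y"]]
        L2_norm_translate[OF LK, of "- y"] by (simp add: \<psi>'_def norm_mult)
    ultimately show ?thesis
      unfolding M_def by (meson L2_norm_nonneg mult_right_mono order_trans)
  qed
  have incr: "cmod (\<psi> s y - \<psi> t y) \<le> M * \<bar>s - t\<bar>" if "s \<in> ball t d" for s y
    by (rule vector_derivative_mean_value_bound[where S = "ball t d"])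
       (use deriv bound that d(1) in auto)
  note it = conv_form_iterated[OF weak_free_L2[OF v] test_functions_L2[OF g] K, folded \<psi>_def]
  define q where "q s y = cnj (g y) * ((\<psi> s y - \<psi> t y) / of_real (s - t))" for s y
  have quotient: "(conv_form K (v s) g - conv_form K (v t) g) / of_real (s - t) = (\<integral>y. q s y \<partial>lborel)" for s
  proof -
    have "q s y = (cnj (g y) * \<psi> s y - cnj (g y) * \<psi> t y) / of_real (s - t)" for y
      by (simp add: q_def right_diff_distrib diff_divide_distrib)
    then show ?thesis using it by simp
  qed
  have limit: "\<i> * conv_form (laplacian K) (v t) g = (\<integral>y. cnj (g y) * \<psi>' t y \<partial>lborel)"
  proof -
    have "cnj (g y) * \<psi>' t y = \<i> * (cnj (g y) * (\<integral>x. v t x * laplacian K (x - y) \<partial>lborel))" for y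
      by (simp add: \<psi>'_def)
    then show ?thesis
      by (simp only: integral_mult_right_zero conv_form_iterated(1)[OF weak_free_L2[OF v] test_functions_L2[OF g] test_functions_laplacian[OF K]])
  qed
  have q_meas: "q s \<in> borel_measurable lborel" for s
  proof -
    have "q s = (\<lambda>y. (cnj (g y) * \<psi> s y - cnj (g y) * \<psi> t y) / of_real (s - t))"
      by (simp add: fun_eq_iff q_def right_diff_distrib diff_divide_distrib)
    then show ?thesis
      using borel_measurable_integrable[OF it(2), of s] borel_measurable_integrable[OF it(2), of t] by simp
  qed
  have "((\<lambda>s. \<integral>y. q s y \<partial>lborel) \<longlongrightarrow> (\<integral>y. cnj (g y) * \<psi>' t y \<partial>lborel)) (at t)"
    unfolding tendsto_at_iff_sequentially comp_def
  proof (intro allI impI)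
    fix X :: "nat \<Rightarrow> real" assume X: "\<forall>i. X i \<in> UNIV - {t}" "X \<longlonglongrightarrow> t"
    then have Xt: "filterlim X (at t) sequentially"
      by (auto simp: filterlim_at intro: always_eventually)
    obtain N where N: "\<And>i. i \<ge> N \<Longrightarrow> X i \<in> ball t d"
      using X(2) d(1) unfolding lim_sequentially by (metis dist_commute mem_ball)
    have pw: "(\<lambda>i. q (X i) y) \<longlonglongrightarrow> cnj (g y) * \<psi>' t y" for y
      using filterlim_compose[OF deriv[of y t, unfolded has_vector_derivative_iff_quotient] Xt]
      unfolding q_def by (rule tendsto_mult_left)
    have "(\<lambda>i. \<integral>y. q (X (i + N)) y \<partial>lborel) \<longlonglongrightarrow> (\<integral>y. cnj (g y) * \<psi>' t y \<partial>lborel)"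
    proof (rule integral_dominated_convergence)
      show "integrable lborel (\<lambda>y. M * cmod (g y))"
        using test_functions_integrable(1)[OF g] by simp
      show "AE y in lborel. (\<lambda>i. q (X (i + N)) y) \<longlonglongrightarrow> cnj (g y) * \<psi>' t y"
        using pw by (intro AE_I2 LIMSEQ_ignore_initial_segment)
      show "(\<lambda>y. cnj (g y) * \<psi>' t y) \<in> borel_measurable lborel"
        by (rule borel_measurable_LIMSEQ_metric[OF q_meas pw])
      show "AE y in lborel. norm (q (X (i + N)) y) \<le> M * cmod (g y)" for i
      proof (intro AE_I2)
        fix y
        have "cmod ((\<psi> (X (i + N)) y - \<psi> t y) / of_real (X (i + N) - t)) \<le> M"
          using incr[OF N[of "i + N"], of y] X(1) by (simp add: norm_divide divide_le_eq del: of_real_diff)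
        then show "norm (q (X (i + N)) y) \<le> M * cmod (g y)"
          unfolding q_def norm_mult complex_mod_cnj mult.commute[of M] by (rule mult_left_mono) simp
      qed
    qed (rule q_meas)
    then show "(\<lambda>i. \<integral>y. q (X i) y \<partial>lborel) \<longlonglongrightarrow> (\<integral>y. cnj (g y) * \<psi>' t y \<partial>lborel)"
      by (rule LIMSEQ_offset)
  qed
  then show ?thesis
    unfolding has_vector_derivative_iff_quotient quotient limit .
qed

text \<open>In the conserved form the second slot is \<open>v s\<close> itself, which is no test
  function and moves with \<open>s\<close>. A mere derivative would not survive the passage from
  test functions to \<open>L2\<close>; a first-order expansion whose error is controlled by
  \<open>L2_norm g\<close> does, and it holds uniformly in \<open>g\<close>.\<close>

lemma weak_free_conv_form_increment:
  assumes v: "weak_free v" and K: "K \<in> test_functions" and g: "g \<in> L2"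
    and close: "\<And>r. r \<in> ball t d \<Longrightarrow> L2_norm (\<lambda>x. v r x - v t x) \<le> e" and s: "s \<in> ball t d" "t \<in> ball t d"
  shows "cmod (conv_form K (v s) g - conv_form K (v t) g - of_real (s - t) * (\<i> * conv_form (laplacian K) (v t) g))
    \<le> (\<integral>x. cmod (laplacian K x) \<partial>lborel) * e * L2_norm g * \<bar>s - t\<bar>"
proof -
  note LK = test_functions_laplacian[OF K]
  let ?k = "\<integral>x. cmod (laplacian K x) \<partial>lborel"
  have test: "cmod (conv_form K (v s) g - conv_form K (v t) g - of_real (s - t) * (\<i> * conv_form (laplacian K) (v t) g))
    \<le> ?k * e * L2_norm g * \<bar>s - t\<bar>" if g: "g \<in> test_functions" for g
  proof -
    \<comment> \<open>After subtracting the linear term, the derivative compares the form at times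
      \<open>r\<close> and \<open>t\<close>, and is small because \<open>v r\<close> is close to
      \<open>v t\<close>.\<close>
    define h where "h r = conv_form K (v r) g - of_real r * (\<i> * conv_form (laplacian K) (v t) g)" for r
    have "cmod (h s - h t) \<le> (?k * e * L2_norm g) * \<bar>s - t\<bar>"
    proof (rule vector_derivative_mean_value_bound[where S = "ball t d"])
      show "(h has_vector_derivative (\<i> * conv_form (laplacian K) (v r) g - 1 * (\<i> * conv_form (laplacian K) (v t) g))) (at r)" for r
        unfolding h_def
        by (intro has_vector_derivative_diff weak_free_conv_form_derivative v K g has_vector_derivative_mult_left)
           (use has_vector_derivative_of_real[OF DERIV_ident] in simp)
      show "cmod (\<i> * conv_form (laplacian K) (v r) g - 1 * (\<i> * conv_form (laplacian K) (v t) g)) \<le> ?k * e * L2_norm g"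
        if "r \<in> ball t d" for r
      proof -
        have "cmod (\<i> * conv_form (laplacian K) (v r) g - 1 * (\<i> * conv_form (laplacian K) (v t) g)) =
            cmod (conv_form (laplacian K) (\<lambda>x. v r x - v t x) g)"
          by (simp add: conv_form_diff_left[OF weak_free_L2[OF v] weak_free_L2[OF v] test_functions_L2[OF g] LK]
            norm_mult flip: right_diff_distrib)
        also have "\<dots> \<le> ?k * (L2_norm (\<lambda>x. v r x - v t x) * L2_norm g)"
          by (intro conv_form_bound L2_diff weak_free_L2 v test_functions_L2 g LK)
        also have "\<dots> \<le> ?k * (e * L2_norm g)"
          using close[OF that] by (intro mult_left_mono mult_right_mono) auto
        finally show ?thesis by (simp add: mult.assoc)
      qed
    qed (use s in auto)
    moreover have "h s - h t = conv_form K (v s) g - conv_form K (v t) g - of_real (s - t) * (\<i> * conv_form (laplacian K) (v t) g)"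
      by (simp add: h_def algebra_simps)
    ultimately show ?thesis by simp
  qed
  obtain \<theta> where \<theta>: "\<And>k::nat. \<theta> k \<in> test_functions" "(\<lambda>k. L2_norm (\<lambda>x. \<theta> k x - g x)) \<longlonglongrightarrow> 0"
    by (rule test_functions_dense_sequence[OF g]) blast
  note lim = tendsto_conv_form_right[OF weak_free_L2[OF v] g test_functions_L2[OF \<theta>(1)] _ \<theta>(2)]
  have lim1: "(\<lambda>k. cmod (conv_form K (v s) (\<theta> k) - conv_form K (v t) (\<theta> k) - of_real (s - t) * (\<i> * conv_form (laplacian K) (v t) (\<theta> k))))
      \<longlonglongrightarrow> cmod (conv_form K (v s) g - conv_form K (v t) g - of_real (s - t) * (\<i> * conv_form (laplacian K) (v t) g))"
    by (intro tendsto_norm tendsto_diff tendsto_mult_left lim K LK)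
  have lim2: "(\<lambda>k. ?k * e * L2_norm (\<theta> k) * \<bar>s - t\<bar>) \<longlonglongrightarrow> ?k * e * L2_norm g * \<bar>s - t\<bar>"
    by (intro tendsto_mult_right tendsto_mult_left
      tendsto_L2_norm[OF \<theta>(2) g always_eventually[OF allI[OF test_functions_L2[OF \<theta>(1)]]]])
  show ?thesis
    by (rule LIMSEQ_le[OF lim1 lim2]) (use test[OF \<theta>(1)] in blast)
qed

text \<open>A product rule by hand: the variation of the first slot contributes \<open>\<i>\<close>
  times a real number, and that of the second its complex conjugate.\<close>

lemma weak_free_conv_form_conserved:
  assumes v: "weak_free v" and K: "K \<in> test_functions" "\<And>x. K (- x) = cnj (K x)"
  shows "conv_form K (v t) (v t) = conv_form K (v 0) (v 0)"
proof -
  define A where "A t = conv_form K (v t) (v t)" for t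
  note L = weak_free_L2[OF v]
  note LK = test_functions_laplacian[OF K(1)]
  have LKh: "laplacian K (- x) = cnj (laplacian K x)" for x by (rule laplacian_hermitian[OF K])
  let ?k = "\<integral>x. cmod (laplacian K x) \<partial>lborel"
  have "(A has_vector_derivative 0) (at t)" for t
    unfolding has_vector_derivative_iff_quotient
  proof (rule tendstoI)
    fix e' :: real assume e': "e' > 0"
    define N where "N = L2_norm (v t)"
    \<comment> \<open>The three error terms below add up to \<open>e * (3 * N + e)\<close> times the
      \<open>L1\<close> norm of \<open>laplacian K\<close>; the final 1 makes \<open>C\<close>
      positive and the last estimate strict.\<close>
    define C where "C = ?k * (3 * N + 1) + 1"
    have N: "N \<ge> 0" by (simp add: N_def)
    have C: "C > 0" unfolding C_def using N by (intro add_nonneg_pos mult_nonneg_nonneg) auto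
    define e where "e = min 1 (e' / C)"
    have e: "e > 0" "e \<le> 1" "e * C \<le> e'"
      using e' C by (auto simp: e_def min_def field_simps)
    have "eventually (\<lambda>s. L2_norm (\<lambda>x. v s x - v t x) < e) (at t)"
      using order_tendstoD(2)[OF weak_free_tendsto[OF v] e(1)] .
    then obtain d where d: "d > 0" "\<And>s. s \<noteq> t \<Longrightarrow> dist s t < d \<Longrightarrow> L2_norm (\<lambda>x. v s x - v t x) < e"
      unfolding eventually_at by auto
    have close: "L2_norm (\<lambda>x. v s x - v t x) \<le> e" if "s \<in> ball t d" for s
      using d(2)[of s] that e(1) by (cases "s = t") (auto simp: dist_commute L2_norm_def)
    have main: "cmod ((A s - A t) / of_real (s - t)) < e'" if s: "s \<noteq> t" "dist s t < d" for s
    proof -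
      have sb: "s \<in> ball t d" "t \<in> ball t d" using s(2) d(1) by (auto simp: dist_commute)
      note inc = weak_free_conv_form_increment[OF v K(1) L close sb]
      let ?X = "\<lambda>g. of_real (s - t) * (\<i> * conv_form (laplacian K) (v t) g)"
      let ?E = "\<lambda>g. conv_form K (v s) g - conv_form K (v t) g - ?X g"
      have vs: "L2_norm (v s) \<le> N + e"
        using L2_norm_diff_le[OF L L, of s t] close[OF sb(1)] by (simp add: N_def)
      \<comment> \<open>Hermitian symmetry reduces an increment in the second slot to one in the
        first.\<close>
      have cross: "conv_form K (v t) (v s) - conv_form K (v t) (v t) = cnj (?E (v t)) + cnj (?X (v t))"
        by (simp add: conv_form_hermitian[OF L L K])
      \<comment> \<open>The diagonal value for \<open>laplacian K\<close> is real, so the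
        first-order term is purely imaginary. This is the cancellation behind mass
        conservation.\<close>
      have skew: "cnj (?X (v t)) = - ?X (v t)"
        by (simp add: conv_form_hermitian[OF L L LK LKh])
      have "A s - A t = ?E (v s) + cnj (?E (v t)) + (?X (v s) - ?X (v t))"
        using cross skew unfolding A_def by (simp add: algebra_simps)
      also have "?X (v s) - ?X (v t) = of_real (s - t) * (\<i> * conv_form (laplacian K) (v t) (\<lambda>x. v s x - v t x))"
        by (simp add: conv_form_diff_right[OF L L L LK] algebra_simps)
      finally have "cmod (A s - A t) \<le> cmod (?E (v s)) + cmod (?E (v t)) +
          cmod (of_real (s - t) * (\<i> * conv_form (laplacian K) (v t) (\<lambda>x. v s x - v t x)))"
        by (metis (no_types, lifting) add_mono complex_mod_cnj norm_triangle_ineq norm_triangle_le order_refl)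
      also have "\<dots> \<le> ?k * e * (N + e) * \<bar>s - t\<bar> + ?k * e * N * \<bar>s - t\<bar> + \<bar>s - t\<bar> * (?k * (N * e))"
      proof (intro add_mono)
        have "?k * e * L2_norm (v s) * \<bar>s - t\<bar> \<le> ?k * e * (N + e) * \<bar>s - t\<bar>"
          using vs e(1) by (intro mult_right_mono mult_left_mono) auto
        then show "cmod (?E (v s)) \<le> ?k * e * (N + e) * \<bar>s - t\<bar>"
          using inc[of s] by linarith
        show "cmod (?E (v t)) \<le> ?k * e * N * \<bar>s - t\<bar>"
          using inc[of t] by (simp add: N_def)
        have "cmod (conv_form (laplacian K) (v t) (\<lambda>x. v s x - v t x)) \<le> ?k * (N * L2_norm (\<lambda>x. v s x - v t x))"
          unfolding N_def by (intro conv_form_bound L2_diff L LK)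
        also have "\<dots> \<le> ?k * (N * e)"
          using close[OF sb(1)] N by (intro mult_left_mono) auto
        finally show "cmod (of_real (s - t) * (\<i> * conv_form (laplacian K) (v t) (\<lambda>x. v s x - v t x))) \<le> \<bar>s - t\<bar> * (?k * (N * e))"
          by (simp add: norm_mult mult_left_mono del: of_real_diff)
      qed
      also have "\<dots> = \<bar>s - t\<bar> * (e * (?k * (3 * N + e)))" by (simp add: algebra_simps)
      also have "\<dots> \<le> \<bar>s - t\<bar> * (e * (?k * (3 * N + 1)))"
        using e by (intro mult_left_mono) auto
      also have "\<dots> < \<bar>s - t\<bar> * (e * C)"
        using e(1) s(1) by (intro mult_strict_left_mono) (auto simp: C_def)
      also have "\<dots> \<le> \<bar>s - t\<bar> * e'" using e(3) by (intro mult_left_mono) auto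
      finally show ?thesis using s(1) by (simp add: norm_divide divide_less_eq mult.commute del: of_real_diff)
    qed
    show "\<forall>\<^sub>F s in at t. dist ((A s - A t) / of_real (s - t)) 0 < e'"
      unfolding eventually_at using d(1) main by (intro exI[of _ d]) (auto simp del: of_real_diff)
  qed
  from vector_derivative_mean_value_bound[of UNIV A "\<lambda>_. 0" 0 t 0, OF convex_UNIV this]
  show ?thesis by (simp add: A_def)
qed

lemma box_bump_integral_pos:
  assumes "c > 0"
  shows "(\<integral>x. box_bump 1 (\<chi> i. - c) (\<chi> i. c) (x :: real ^ 'n) \<partial>lborel) > 0"
proof -
  define \<kappa> :: "real ^ 'n \<Rightarrow> real" where "\<kappa> = box_bump 1 (\<chi> i. - c) (\<chi> i. c)"
  have i: "integrable lborel \<kappa>"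
    using test_functions_integrable(1)[OF box_bump_test_function[of 1 "\<chi> i. - c" "\<chi> i. c :: real ^ 'n"]]
    by (simp add: \<kappa>_def box_bump_bounds(1)[THEN abs_of_nonneg])
  have nonneg: "\<And>x. 0 \<le> \<kappa> x" by (simp add: \<kappa>_def box_bump_bounds)
  have "(\<integral>x. \<kappa> x \<partial>lborel) \<noteq> 0"
  proof
    \<comment> \<open>A zero integral would make the bump vanish almost everywhere, so the nonempty
      open box on which it is positive would be a null set.\<close>
    assume "(\<integral>x. \<kappa> x \<partial>lborel) = 0"
    then have "AE x in lborel. \<kappa> x = 0"
      using integral_nonneg_eq_0_iff_AE[OF i] nonneg by simp
    then have "AE x in lborel. x \<notin> (box (\<chi> i. - c) (\<chi> i. c) :: (real ^ 'n) set)"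
    proof eventually_elim
      case (elim x)
      then show ?case using box_bump_pos_iff[of 1 "\<chi> i. - c" "\<chi> i. c" x] by (simp add: \<kappa>_def)
    qed
    then have "emeasure lborel (box (\<chi> i. - c) (\<chi> i. c) :: (real ^ 'n) set) = 0"
      by (subst (asm) AE_iff_measurable[OF _ refl]) auto
    then have "negligible (box (\<chi> i. - c) (\<chi> i. c) :: (real ^ 'n) set)"
      unfolding negligible_iff_null_sets by (intro null_sets_completionI null_setsI) auto
    moreover have "(0 :: real ^ 'n) \<in> box (\<chi> i. - c) (\<chi> i. c)" using assms by (simp add: mem_box_cart)
    ultimately show False using open_not_negligible[OF open_box] by blast
  qed
  moreover have "(\<integral>x. \<kappa> x \<partial>lborel) \<ge> 0" using nonneg by simp
  ultimately show ?thesis by (simp add: \<kappa>_def)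
qed

text \<open>For a narrow kernel the conserved form equals its mass times the squared norm up to a
  relative error \<open>e / 2\<close>, at time \<open>t\<close> and at time 0. The positive mass is
  then divided out.\<close>

theorem weak_free_norm_conserved:
  fixes v :: "real \<Rightarrow> real ^ 'n \<Rightarrow> complex"
  assumes v: "weak_free v"
  shows "L2_norm (v t) = L2_norm (v 0)"
proof -
  have "\<bar>(L2_norm (v t))\<^sup>2 - (L2_norm (v 0))\<^sup>2\<bar> \<le> 0 + e" if "e > 0" for e
  proof -
    have e: "e / 2 > 0" using that by simp
    obtain d1 where d1: "d1 > 0" "\<And>\<kappa>. kernel_within d1 \<kappa> \<Longrightarrow>
        cmod (conv_form (\<lambda>x. of_real (\<kappa> x)) (v t) (v t) - of_real ((\<integral>x. \<kappa> x \<partial>lborel) * (L2_norm (v t))\<^sup>2)) \<le> e / 2 * (\<integral>x. \<kappa> x \<partial>lborel)"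
      by (rule conv_form_approximate_identity[OF weak_free_L2[OF v] e]) blast
    obtain d2 where d2: "d2 > 0" "\<And>\<kappa>. kernel_within d2 \<kappa> \<Longrightarrow>
        cmod (conv_form (\<lambda>x. of_real (\<kappa> x)) (v 0) (v 0) - of_real ((\<integral>x. \<kappa> x \<partial>lborel) * (L2_norm (v 0))\<^sup>2)) \<le> e / 2 * (\<integral>x. \<kappa> x \<partial>lborel)"
      by (rule conv_form_approximate_identity[OF weak_free_L2[OF v] e]) blast
    \<comment> \<open>The Euclidean norm is at most the sum of the moduli of the coordinates, so the
      box of half-width \<open>c\<close> lies within both admissible radii.\<close>
    define c where "c = min d1 d2 / real CARD('n)"
    have c: "c > 0" using d1(1) d2(1) by (simp add: c_def)
    define \<kappa> :: "real ^ 'n \<Rightarrow> real" where "\<kappa> = box_bump 1 (\<chi> i. - c) (\<chi> i. c)"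
    let ?k = "\<integral>x. \<kappa> x \<partial>lborel"
    have k: "?k > 0" unfolding \<kappa>_def by (rule box_bump_integral_pos[OF c])
    have K: "(\<lambda>x. complex_of_real (\<kappa> x)) \<in> test_functions"
      unfolding \<kappa>_def by (rule box_bump_test_function) simp
    have nonneg: "0 \<le> \<kappa> x" for x by (simp add: \<kappa>_def box_bump_bounds)
    \<comment> \<open>Reflection exchanges the two factors for opposite faces; a real even kernel is
      Hermitian.\<close>
    have even: "\<kappa> (- x) = \<kappa> x" for x
      by (simp add: \<kappa>_def box_bump_def add.commute mult.commute)
    have supp: "\<kappa> x = 0" if "norm x > min d1 d2" for x
    proof (rule ccontr)
      assume "\<kappa> x \<noteq> 0"
      then have "\<kappa> x > 0" using nonneg[of x] by simp
      then have "x \<in> box (\<chi> i. - c) (\<chi> i. c)"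
        unfolding \<kappa>_def by (subst (asm) box_bump_pos_iff) auto
      then have "\<bar>x $ i\<bar> \<le> c" for i
        by (simp add: mem_box_cart abs_le_iff) (metis less_imp_le minus_le_iff)
      then have "(\<Sum>i\<in>UNIV. \<bar>x $ i\<bar>) \<le> real CARD('n) * c"
        using sum_bounded_above[of UNIV "\<lambda>i. \<bar>x $ i\<bar>" c] by simp
      then have "norm x \<le> min d1 d2"
        using norm_le_l1_cart[of x] by (simp add: c_def)
      then show False using that by linarith
    qed
    have within: "kernel_within d1 \<kappa>" "kernel_within d2 \<kappa>"
      using K nonneg supp by (auto simp: kernel_within_def)
    have cons: "conv_form (\<lambda>x. of_real (\<kappa> x)) (v t) (v t) = conv_form (\<lambda>x. of_real (\<kappa> x)) (v 0) (v 0)"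
      by (rule weak_free_conv_form_conserved[OF v K]) (simp add: even)
    have "cmod (of_real (?k * (L2_norm (v t))\<^sup>2) - of_real (?k * (L2_norm (v 0))\<^sup>2)) \<le> e / 2 * ?k + e / 2 * ?k"
    proof (rule norm_diff_triangle_le)
      show "cmod (of_real (?k * (L2_norm (v t))\<^sup>2) - conv_form (\<lambda>x. of_real (\<kappa> x)) (v t) (v t)) \<le> e / 2 * ?k"
        using d1(2)[OF within(1)] by (simp add: norm_minus_commute)
      show "cmod (conv_form (\<lambda>x. of_real (\<kappa> x)) (v t) (v t) - of_real (?k * (L2_norm (v 0))\<^sup>2)) \<le> e / 2 * ?k"
        unfolding cons using d2(2)[OF within(2)] by simp
    qed
    then have "?k * \<bar>(L2_norm (v t))\<^sup>2 - (L2_norm (v 0))\<^sup>2\<bar> \<le> ?k * e"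
      using k by (simp only: of_real_diff[symmetric] norm_of_real right_diff_distrib[symmetric] abs_mult abs_of_pos) simp
    then show ?thesis using k by simp
  qed
  then have "\<bar>(L2_norm (v t))\<^sup>2 - (L2_norm (v 0))\<^sup>2\<bar> \<le> 0" by (rule field_le_epsilon)
  then show ?thesis by simp
qed

subsection \<open>Galilean invariance\<close>

lemma L2_translation_continuous:
  assumes f: "f \<in> L2" and e: "e > 0"
  obtains d where "d > 0" "\<And>a. norm a < d \<Longrightarrow> L2_norm (\<lambda>x. f (x + a) - f x) < e"
proof -
  obtain \<theta> where \<theta>: "\<theta> \<in> test_functions" "L2_norm (\<lambda>x. f x - \<theta> x) < e / 3"
    using test_functions_denseE[OF f, of "e / 3"] e by auto
  note L = test_functions_L2[OF \<theta>(1)]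
  obtain R where R: "R > 0" "\<And>x. norm x > R \<Longrightarrow> \<theta> x = 0" by (rule test_functions_support[OF \<theta>(1)]) blast
  \<comment> \<open>For shifts shorter than 1 the difference
    \<open>\<theta> (x + a) - \<theta> x\<close> vanishes outside the ball of radius
    \<open>R + 1\<close>, so a uniform bound on it becomes an \<open>L2\<close> bound.\<close>
  define I :: "real ^ 'a \<Rightarrow> complex" where "I = (\<lambda>x. of_real (indicator (cball 0 (R + 1)) x))"
  have I: "I \<in> L2"
  proof (rule L2_dominated)
    show "integrable lborel (\<lambda>x::real^'a. indicator (cball 0 (R + 1)) x :: real)"
      by (intro integrable_real_indicator) (use emeasure_bounded_finite[OF bounded_cball] in auto)
    have [measurable]: "cball (0::real^'a) (R + 1) \<in> sets borel" by simp
    show "I \<in> borel_measurable borel" unfolding I_def by measurable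
  qed (auto simp: I_def split: split_indicator)
  define N where "N = L2_norm I + 1"
  define w where "w = e / (3 * N)"
  have N: "N > 0" unfolding N_def by (intro add_nonneg_pos) auto
  have w: "w > 0" "w * L2_norm I < e / 3"
  proof -
    show "w > 0" unfolding w_def using e N by simp
    have "w * L2_norm I < w * N" using \<open>w > 0\<close> by (simp add: N_def)
    also have "\<dots> = e / 3" unfolding w_def using N by simp
    finally show "w * L2_norm I < e / 3" .
  qed
  obtain d where d: "d > 0" "\<And>x y. norm (x - y) \<le> d \<Longrightarrow> cmod (\<theta> x - \<theta> y) < w"
    by (rule test_functions_uniformly_continuous[OF \<theta>(1) w(1)]) blast
  show ?thesis
  proof (rule that[of "min d 1"])
    show "min d 1 > 0" using d(1) by simp
    fix a :: "real ^ 'a" assume a: "norm a < min d 1"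
    have "L2_norm (\<lambda>x. \<theta> (x + a) - \<theta> x) \<le> w * L2_norm I"
    proof (rule L2_norm_mono[OF L2_measurable[OF L2_diff[OF L2_translate[OF L] L]] I])
      fix x
      show "cmod (\<theta> (x + a) - \<theta> x) \<le> w * cmod (I x)"
      proof (cases "norm x > R + 1")
        case True
        then have "norm (x + a) > R"
          using norm_triangle_ineq4[of "x + a" a] a by simp
        then show ?thesis using R(2) True w(1) by simp
      next
        case False
        then show ?thesis using d(2)[of "x + a" x] a by (simp add: I_def)
      qed
    qed (use w in simp)
    moreover have "L2_norm (\<lambda>x. f (x + a) - f x) \<le>
        L2_norm (\<lambda>x. f (x + a) - \<theta> (x + a)) + (L2_norm (\<lambda>x. \<theta> (x + a) - \<theta> x) + L2_norm (\<lambda>x. \<theta> x - f x))"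
      using L2_norm_triangle_diff[OF L2_translate[OF f, of a] L2_translate[OF L, of a] f]
        L2_norm_triangle_diff[OF L2_translate[OF L, of a] L f] by linarith
    moreover have "L2_norm (\<lambda>x. f (x + a) - \<theta> (x + a)) = L2_norm (\<lambda>x. f x - \<theta> x)"
      by (rule L2_norm_translate[OF L2_diff[OF f L]])
    ultimately show "L2_norm (\<lambda>x. f (x + a) - f x) < e"
      using \<theta>(2) w(2) L2_norm_minus_commute[of f \<theta>] by simp
  qed
qed

lemma modulated_translate_has_vector_derivative:
  assumes "\<theta> \<in> test_functions"
  shows "((\<lambda>s. cis (\<alpha> * s + c) * \<theta> (x + (\<beta> * s) *\<^sub>R axis j 1)) has_vector_derivative
    cis (\<alpha> * s + c) * (\<i> * of_real \<alpha> * \<theta> (x + (\<beta> * s) *\<^sub>R axis j 1) +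
      of_real \<beta> * partial j \<theta> (x + (\<beta> * s) *\<^sub>R axis j 1))) (at s)"
proof -
  have "((\<lambda>s. \<beta> * s) has_vector_derivative \<beta>) (at s)"
    by (auto intro!: derivative_eq_intros simp: has_real_derivative_iff_has_vector_derivative[symmetric])
  from vector_diff_chain_at[OF this, of "\<lambda>s. \<theta> (x + s *\<^sub>R axis j 1)",
      OF has_vector_derivative_along_axis[OF test_functions_differentiable[OF assms]]]
  have 1: "((\<lambda>s. \<theta> (x + (\<beta> * s) *\<^sub>R axis j 1)) has_vector_derivative
      of_real \<beta> * partial j \<theta> (x + (\<beta> * s) *\<^sub>R axis j 1)) (at s)"
    by (simp add: o_def scaleR_conv_of_real)
  have 2: "((\<lambda>s. cis (\<alpha> * s + c)) has_vector_derivative \<i> * of_real \<alpha> * cis (\<alpha> * s + c)) (at s)"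
    using has_vector_derivative_mult_left[OF cis_line_has_vector_derivative[of \<alpha> s], of "cis c"]
    by (simp add: cis_mult mult.assoc)
  show ?thesis
    using has_vector_derivative_mult[OF 2 1] by (simp add: algebra_simps)
qed

text \<open>The parameters cover two uses: the boosted test function, with
  \<open>\<alpha> = \<eta>\<^sup>2\<close> and \<open>\<beta> = 2 * \<eta>\<close>, and the plain
  translation of a test function against a fixed \<open>w\<close>, with
  \<open>\<alpha> = \<eta> = 0\<close> and \<open>\<beta> = 1\<close>.\<close>

lemma pairing_modulated_translate_derivative:
  fixes v :: "real \<Rightarrow> real ^ 'n \<Rightarrow> complex" and \<alpha> \<beta> \<eta> :: real and j :: 'n
  assumes v: "\<And>s. v s \<in> L2" "((\<lambda>s. L2_norm (\<lambda>x. v s x - v t x)) \<longlongrightarrow> 0) (at t)"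
    and \<theta>: "\<theta> \<in> test_functions"
  defines "\<Theta> \<equiv> \<lambda>s x. cis (\<alpha> * s + \<eta> * x $ j) * \<theta> (x + (\<beta> * s) *\<^sub>R axis j 1)"
  shows "((\<lambda>s. \<integral>x. v s x * (\<Theta> s x - \<Theta> t x) \<partial>lborel) has_vector_derivative
    (\<integral>x. v t x * (cis (\<alpha> * t + \<eta> * x $ j) * (\<i> * of_real \<alpha> * \<theta> (x + (\<beta> * t) *\<^sub>R axis j 1) +
      of_real \<beta> * partial j \<theta> (x + (\<beta> * t) *\<^sub>R axis j 1))) \<partial>lborel)) (at t)"
proof -
  define D where "D s x = cis (\<alpha> * s + \<eta> * x $ j) * (\<i> * of_real \<alpha> * \<theta> (x + (\<beta> * s) *\<^sub>R axis j 1) +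
      of_real \<beta> * partial j \<theta> (x + (\<beta> * s) *\<^sub>R axis j 1))" for s x
  have deriv: "((\<lambda>s. \<Theta> s x) has_vector_derivative D s x) (at s)" for s x
    unfolding \<Theta>_def D_def by (rule modulated_translate_has_vector_derivative[OF \<theta>])
  note \<theta>' = test_functions_partial[OF \<theta>, of j]
  obtain M0 where M0: "M0 > 0" "\<And>x. cmod (\<theta> x) \<le> M0" by (rule test_functions_bounded[OF \<theta>]) blast
  obtain M1 where M1: "M1 > 0" "\<And>x. cmod (partial j \<theta> x) \<le> M1" by (rule test_functions_bounded[OF \<theta>']) blast
  obtain R where R: "R > 0" "\<And>x. norm x > R \<Longrightarrow> \<theta> x = 0" by (rule test_functions_support[OF \<theta>]) blast
  note [measurable] = test_functions_measurable[OF \<theta>] test_functions_measurable[OF \<theta>']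
  have cis [measurable]: "(\<lambda>x::real^'n. cis (a + \<eta> * x $ j)) \<in> borel_measurable borel" for a
    by (intro borel_measurable_continuous_onI continuous_intros)
  have D_bound: "cmod (D s x) \<le> \<bar>\<alpha>\<bar> * M0 + \<bar>\<beta>\<bar> * M1" for s x
  proof -
    have "cmod (D s x) = cmod (\<i> * of_real \<alpha> * \<theta> (x + (\<beta> * s) *\<^sub>R axis j 1) +
        of_real \<beta> * partial j \<theta> (x + (\<beta> * s) *\<^sub>R axis j 1))"
      by (simp add: D_def norm_mult)
    also have "\<dots> \<le> \<bar>\<alpha>\<bar> * cmod (\<theta> (x + (\<beta> * s) *\<^sub>R axis j 1)) + \<bar>\<beta>\<bar> * cmod (partial j \<theta> (x + (\<beta> * s) *\<^sub>R axis j 1))"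
      by (rule order_trans[OF norm_triangle_ineq]) (simp add: norm_mult)
    also have "\<dots> \<le> \<bar>\<alpha>\<bar> * M0 + \<bar>\<beta>\<bar> * M1"
      by (intro add_mono mult_left_mono M0 M1) auto
    finally show ?thesis .
  qed
  have "((\<lambda>s. \<integral>x. v s x * (\<Theta> s x - \<Theta> t x) \<partial>lborel) has_vector_derivative
    (\<integral>x. v t x * D t x \<partial>lborel)) (at t)"
  proof (rule has_vector_derivative_moving_profile[OF v])
    show "\<Theta> s \<in> borel_measurable borel" "D t \<in> borel_measurable borel" for s
      unfolding \<Theta>_def D_def by measurable
    show "((\<lambda>s. \<Theta> s x) has_vector_derivative D t x) (at t)" for x by (rule deriv)
    show "cmod (\<Theta> s x - \<Theta> t x) \<le> (\<bar>\<alpha>\<bar> * M0 + \<bar>\<beta>\<bar> * M1) * \<bar>s - t\<bar>" for s x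
      by (rule vector_derivative_mean_value_bound[OF convex_UNIV deriv D_bound]) auto
    \<comment> \<open>During the unit time window the shift has length at most
      \<open>\<bar>\<beta>\<bar> * (\<bar>t\<bar> + 1)\<close>.\<close>
    show "\<Theta> s x = 0" if "\<bar>s - t\<bar> < 1" "norm x > R + \<bar>\<beta>\<bar> * (\<bar>t\<bar> + 1)" for s x
    proof -
      have "norm ((\<beta> * s) *\<^sub>R axis j 1 :: real ^ 'n) = \<bar>\<beta>\<bar> * \<bar>s\<bar>" by (simp add: abs_mult)
      also have "\<dots> \<le> \<bar>\<beta>\<bar> * (\<bar>t\<bar> + 1)" using that(1) by (intro mult_left_mono) auto
      finally have "norm (x + (\<beta> * s) *\<^sub>R axis j 1) > R"
        using norm_triangle_ineq4[of "x + (\<beta> * s) *\<^sub>R axis j 1" "(\<beta> * s) *\<^sub>R axis j 1"] that(2)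
        by simp
      then show ?thesis using R(2) by (simp add: \<Theta>_def)
    qed
  qed
  then show ?thesis by (simp add: D_def)
qed

lemma partial_cmult:
  assumes "f differentiable_on UNIV"
  shows "partial j (\<lambda>x. c * f x) = (\<lambda>x. c * partial j f x)"
  using partial_mult[OF differentiable_on_const[of c] assms] by (simp add: partial_const)

text \<open>Conjugation by the phase replaces each derivative by itself plus
  \<open>\<alpha> i\<close>, with \<open>\<alpha> j = \<i> * of_real \<eta>\<close> and all others
  0; the formula is the sum of the squares of these operators.\<close>

lemma laplacian_modulate:
  fixes g :: "real ^ 'n \<Rightarrow> complex"
  assumes "g \<in> test_functions"
  shows "laplacian (\<lambda>x. cis (\<eta> * x $ j) * g x) =
    (\<lambda>x. cis (\<eta> * x $ j) * (laplacian g x + 2 * \<i> * of_real \<eta> * partial j g x - of_real (\<eta>\<^sup>2) * g x))"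
proof -
  define \<alpha> :: "'n \<Rightarrow> complex" where "\<alpha> i = (if i = j then \<i> * of_real \<eta> else 0)" for i
  have cis: "(\<lambda>x::real^'n. cis (\<eta> * x $ j)) differentiable_on UNIV"
    using C_diff_cis[of "Suc 0" \<eta> j] by simp
  have mod: "partial i (\<lambda>x. cis (\<eta> * x $ j) * h x) = (\<lambda>x. cis (\<eta> * x $ j) * (partial i h x + \<alpha> i * h x))"
    if "h \<in> test_functions" for h i
    unfolding partial_mult[OF cis test_functions_differentiable[OF that]] partial_cis \<alpha>_def
    by (simp add: fun_eq_iff algebra_simps)
  have h: "(\<lambda>x. partial i g x + \<alpha> i * g x) \<in> test_functions" for i
    by (intro test_functions_add test_functions_cmult test_functions_partial assms)
  have "partial i (\<lambda>x. partial i g x + \<alpha> i * g x) = (\<lambda>x. partial i (partial i g) x + \<alpha> i * partial i g x)" for i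
    using assms by (simp add: partial_add partial_cmult test_functions_differentiable test_functions_partial test_functions_cmult)
  then have "partial i (partial i (\<lambda>x. cis (\<eta> * x $ j) * g x)) =
    (\<lambda>x. cis (\<eta> * x $ j) * (partial i (partial i g) x + 2 * (\<alpha> i * partial i g x) + \<alpha> i * \<alpha> i * g x))" for i
    unfolding mod[OF assms] mod[OF h] by (simp add: algebra_simps)
  then have "laplacian (\<lambda>x. cis (\<eta> * x $ j) * g x) x = cis (\<eta> * x $ j) *
      (laplacian g x + 2 * (\<Sum>i\<in>UNIV. \<alpha> i * partial i g x) + (\<Sum>i\<in>UNIV. \<alpha> i * \<alpha> i) * g x)" for x
    by (simp add: laplacian_def sum.distrib flip: sum_distrib_left sum_distrib_right)
  moreover have "(\<Sum>i\<in>UNIV. \<alpha> i * partial i g x) = \<i> * of_real \<eta> * partial j g x" for x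
    by (simp add: \<alpha>_def if_distrib[of "\<lambda>y. y * _"] cong: if_cong)
  moreover have "(\<Sum>i\<in>UNIV. \<alpha> i * \<alpha> i) = - of_real (\<eta>\<^sup>2)"
    by (simp add: \<alpha>_def if_distrib[of "\<lambda>y. y * _"] power2_eq_square algebra_simps cong: if_cong)
  ultimately show ?thesis by (simp add: fun_eq_iff mult.assoc)
qed

text \<open>The phase is the plane wave of wave number \<open>\<eta>\<close>, itself a solution of
  the free equation, and \<open>2 * \<eta>\<close> is its group velocity.\<close>

definition galilean :: "real \<Rightarrow> 'n \<Rightarrow> (real \<Rightarrow> real ^ 'n \<Rightarrow> complex) \<Rightarrow> real \<Rightarrow> real ^ 'n \<Rightarrow> complex" where
  "galilean \<eta> j v t x = cis (\<eta> * x $ j - \<eta>\<^sup>2 * t) * v t (x - (2 * \<eta> * t) *\<^sub>R axis j 1)"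

lemma galilean_L2:
  assumes "v t \<in> L2"
  shows "galilean \<eta> j v t \<in> L2"
proof -
  have "(\<lambda>x. v t (x - (2 * \<eta> * t) *\<^sub>R axis j 1)) \<in> L2"
    using L2_translate[OF assms, of "- ((2 * \<eta> * t) *\<^sub>R axis j 1)"] by simp
  moreover have "(\<lambda>x. cis (\<eta> * x $ j - \<eta>\<^sup>2 * t)) \<in> borel_measurable borel"
    by (intro borel_measurable_continuous_onI continuous_intros)
  ultimately show ?thesis
    unfolding galilean_def[abs_def] by (rule L2_mult_bounded[where C = 1]) simp
qed

text \<open>The substitution that undoes the translation moves the boost onto the test function; it
  adds \<open>2 * \<eta>\<^sup>2 * t\<close> to the phase, which reverses the sign of
  \<open>\<eta>\<^sup>2 * t\<close>.\<close>

lemma galilean_pairing: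
  assumes v: "v t \<in> L2" and \<theta>: "\<theta> \<in> test_functions"
  shows "(\<integral>x. galilean \<eta> j v t x * \<theta> x \<partial>lborel) =
    (\<integral>x. v t x * (cis (\<eta>\<^sup>2 * t + \<eta> * x $ j) * \<theta> (x + (2 * \<eta> * t) *\<^sub>R axis j 1)) \<partial>lborel)"
proof -
  have "(\<integral>x. galilean \<eta> j v t x * \<theta> x \<partial>lborel) =
      (\<integral>x. galilean \<eta> j v t (x + (2 * \<eta> * t) *\<^sub>R axis j 1) * \<theta> (x + (2 * \<eta> * t) *\<^sub>R axis j 1) \<partial>lborel)"
    using L2_measurable[OF galilean_L2[of v t, OF v]] test_functions_measurable[OF \<theta>]
    by (intro lborel_integral_translate[symmetric] borel_measurable_times)
  moreover have "galilean \<eta> j v t (x + (2 * \<eta> * t) *\<^sub>R axis j 1) = cis (\<eta>\<^sup>2 * t + \<eta> * x $ j) * v t x" for x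
    by (simp add: galilean_def power2_eq_square algebra_simps)
  ultimately show ?thesis by (simp add: ac_simps)
qed

lemma galilean_tendsto:
  assumes v: "weak_free v"
  shows "((\<lambda>s. L2_norm (\<lambda>x. galilean \<eta> j v s x - galilean \<eta> j v t x)) \<longlongrightarrow> 0) (at t)"
proof -
  note L = weak_free_L2[OF v]
  define a :: "real \<Rightarrow> real ^ 'a" where "a s = - ((2 * \<eta> * s) *\<^sub>R axis j 1)" for s
  have L': "(\<lambda>x. v s (x + a r)) \<in> L2" for s r by (rule L2_translate[OF L])
  have bound: "L2_norm (\<lambda>x. galilean \<eta> j v s x - galilean \<eta> j v t x) \<le>
      L2_norm (\<lambda>x. v s x - v t x) + (L2_norm (\<lambda>x. v t (x + (a s - a t)) - v t x)
        + cmod (cis (- (\<eta>\<^sup>2 * s)) - cis (- (\<eta>\<^sup>2 * t))) * L2_norm (v t))" for s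
  proof -
    define c where "c r = cis (- (\<eta>\<^sup>2 * r))" for r
    \<comment> \<open>The increment is split into the motion of \<open>v\<close>, of the translation
      and of the phase, controlled by continuity of \<open>v\<close>, of translations in
      \<open>L2\<close>, and of \<open>cis\<close>.\<close>
    let ?f1 = "\<lambda>x. c s * (v s (x + a s) - v t (x + a s))"
    let ?f2 = "\<lambda>x. c s * (v t (x + a s) - v t (x + a t))"
    let ?f3 = "\<lambda>x. (c s - c t) * v t (x + a t)"
    have "galilean \<eta> j v s x - galilean \<eta> j v t x = cis (\<eta> * x $ j) * (?f1 x + (?f2 x + ?f3 x))" for x
    proof -
      have "cis (\<eta> * x $ j - \<eta>\<^sup>2 * r) = cis (\<eta> * x $ j) * c r" for r
        by (simp add: c_def cis_mult)
      then show ?thesis by (simp add: galilean_def a_def algebra_simps)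
    qed
    then have "L2_norm (\<lambda>x. galilean \<eta> j v s x - galilean \<eta> j v t x) = L2_norm (\<lambda>x. ?f1 x + (?f2 x + ?f3 x))"
      by (intro L2_norm_cong_cmod) (simp add: norm_mult)
    also have "\<dots> \<le> L2_norm ?f1 + (L2_norm ?f2 + L2_norm ?f3)"
      using L2_norm_triangle[OF L2_cmult[OF L2_diff[OF L' L']] L2_add[OF L2_cmult[OF L2_diff[OF L' L']] L2_cmult[OF L']],
          of "c s" s s t s "c s" t s t t "c s - c t" t t]
        L2_norm_triangle[OF L2_cmult[OF L2_diff[OF L' L']] L2_cmult[OF L'], of "c s" t s t t "c s - c t" t t]
      by linarith
    also have "L2_norm ?f1 = L2_norm (\<lambda>x. v s x - v t x)"
      using L2_norm_translate[OF L2_diff[OF L[of s] L[of t]], of "a s"] unfolding L2_norm_cmult by (simp add: c_def)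
    also have "L2_norm ?f2 = L2_norm (\<lambda>x. v t (x + (a s - a t)) - v t x)"
      using L2_norm_translate[OF L2_diff[OF L2_translate[OF L[of t], of "a s - a t"] L[of t]], of "a t"]
      unfolding L2_norm_cmult by (simp add: c_def algebra_simps)
    also have "L2_norm ?f3 = cmod (c s - c t) * L2_norm (v t)"
      unfolding L2_norm_cmult by (simp add: L2_norm_translate[OF L])
    finally show ?thesis by (simp add: c_def)
  qed
  have "((\<lambda>s. L2_norm (\<lambda>x. v t (x + (a s - a t)) - v t x)) \<longlongrightarrow> 0) (at t)"
  proof (rule tendstoI)
    fix e :: real assume "e > 0"
    then obtain d where d: "d > 0" "\<And>b. norm b < d \<Longrightarrow> L2_norm (\<lambda>x. v t (x + b) - v t x) < e"
      by (rule L2_translation_continuous[OF L]) blast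
    have "((\<lambda>s. norm (a s - a t)) \<longlongrightarrow> norm (a t - a t)) (at t)"
      unfolding a_def by (intro tendsto_intros)
    then have "eventually (\<lambda>s. norm (a s - a t) < d) (at t)"
      using d(1) by (intro order_tendstoD(2)[of _ 0]) simp_all
    then show "\<forall>\<^sub>F s in at t. dist (L2_norm (\<lambda>x. v t (x + (a s - a t)) - v t x)) 0 < e"
      by eventually_elim (simp add: d(2))
  qed
  moreover have "((\<lambda>s. cmod (cis (- (\<eta>\<^sup>2 * s)) - cis (- (\<eta>\<^sup>2 * t))) * L2_norm (v t)) \<longlongrightarrow>
      cmod (cis (- (\<eta>\<^sup>2 * t)) - cis (- (\<eta>\<^sup>2 * t))) * L2_norm (v t)) (at t)"
    by (intro tendsto_intros)
  ultimately have "((\<lambda>s. L2_norm (\<lambda>x. v s x - v t x) + (L2_norm (\<lambda>x. v t (x + (a s - a t)) - v t x)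
        + cmod (cis (- (\<eta>\<^sup>2 * s)) - cis (- (\<eta>\<^sup>2 * t))) * L2_norm (v t))) \<longlongrightarrow> 0 + (0 + 0)) (at t)"
    by (intro tendsto_add weak_free_tendsto v) simp_all
  then have lim: "((\<lambda>s. L2_norm (\<lambda>x. v s x - v t x) + (L2_norm (\<lambda>x. v t (x + (a s - a t)) - v t x)
        + cmod (cis (- (\<eta>\<^sup>2 * s)) - cis (- (\<eta>\<^sup>2 * t))) * L2_norm (v t))) \<longlongrightarrow> 0) (at t)"
    by (simp only: add_0)
  show ?thesis
    by (rule Lim_null_comparison[OF always_eventually[OF allI] lim])
       (simp only: real_norm_def abs_of_nonneg[OF L2_norm_nonneg] bound)
qed

lemma weak_free_galilean:
  fixes v :: "real \<Rightarrow> real ^ 'n \<Rightarrow> complex"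
  assumes v: "weak_free v"
  shows "weak_free (galilean \<eta> j v)"
proof (rule weak_freeI[OF galilean_L2[OF weak_free_L2[OF v]] galilean_tendsto[OF v]])
  fix \<theta> :: "real ^ 'n \<Rightarrow> complex" and t assume \<theta>: "\<theta> \<in> test_functions"
  note L = weak_free_L2[OF v]
  define \<Theta> where "\<Theta> \<theta> s x = cis (\<eta>\<^sup>2 * s + \<eta> * x $ j) * \<theta> (x + (2 * \<eta> * s) *\<^sub>R axis j 1)" for \<theta> :: "real ^ 'n \<Rightarrow> complex" and s x
  have pairing: "(\<integral>x. galilean \<eta> j v s x * \<theta> x \<partial>lborel) = (\<integral>x. v s x * \<Theta> \<theta> s x \<partial>lborel)"
    if "\<theta> \<in> test_functions" for \<theta> s
    unfolding \<Theta>_def by (rule galilean_pairing[OF L that])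
  \<comment> \<open>The part of the phase that is constant in \<open>x\<close> is put into
    \<open>g\<close>, so that the formula for a modulated Laplacian applies.\<close>
  define g where "g x = cis (\<eta>\<^sup>2 * t) * \<theta> (x + (2 * \<eta> * t) *\<^sub>R axis j 1)" for x
  have g: "g \<in> test_functions"
    unfolding g_def by (intro test_functions_cmult test_functions_translate \<theta>)
  have \<theta>d: "\<theta> differentiable_on UNIV" "partial i \<theta> differentiable_on UNIV" for i
    by (auto intro: test_functions_differentiable test_functions_partial \<theta>)
  have pg: "partial i g = (\<lambda>x. cis (\<eta>\<^sup>2 * t) * partial i \<theta> (x + (2 * \<eta> * t) *\<^sub>R axis j 1))" for i
    unfolding g_def by (simp add: partial_cmult partial_translate differentiable_on_translate \<theta>d)
  have lg: "laplacian g = (\<lambda>x. cis (\<eta>\<^sup>2 * t) * laplacian \<theta> (x + (2 * \<eta> * t) *\<^sub>R axis j 1))"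
    unfolding laplacian_def[abs_def] pg
    by (simp add: partial_cmult partial_translate differentiable_on_translate \<theta>d sum_distrib_left)
  have \<Theta>g: "\<Theta> \<theta> t = (\<lambda>x. cis (\<eta> * x $ j) * g x)"
    by (simp add: \<Theta>_def g_def fun_eq_iff cis_mult[symmetric])
  have test: "\<Theta> \<theta> t \<in> test_functions"
    unfolding \<Theta>g by (intro test_functions_mult g C_diff_cis)
  have test_s: "\<Theta> \<theta> s \<in> test_functions" for s
  proof -
    have "\<Theta> \<theta> s = (\<lambda>x. cis (\<eta> * x $ j) * (cis (\<eta>\<^sup>2 * s) * \<theta> (x + (2 * \<eta> * s) *\<^sub>R axis j 1)))"
      by (simp add: \<Theta>_def fun_eq_iff cis_mult[symmetric])
    then show ?thesis
      by (simp only:) (intro test_functions_mult test_functions_cmult test_functions_translate \<theta> C_diff_cis)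
  qed
  define E where "E x = cis (\<eta>\<^sup>2 * t + \<eta> * x $ j) * (\<i> * of_real (\<eta>\<^sup>2) * \<theta> (x + (2 * \<eta> * t) *\<^sub>R axis j 1) +
      of_real (2 * \<eta>) * partial j \<theta> (x + (2 * \<eta> * t) *\<^sub>R axis j 1))" for x
  have E_alt: "E = (\<lambda>x. cis (\<eta> * x $ j) * (\<i> * of_real (\<eta>\<^sup>2) * g x + of_real (2 * \<eta>) * partial j g x))"
    by (simp add: E_def g_def pg fun_eq_iff cis_mult[symmetric] algebra_simps)
  have E: "E \<in> L2"
    unfolding E_alt
    by (intro test_functions_L2 test_functions_mult test_functions_add test_functions_cmult test_functions_partial g C_diff_cis)
  \<comment> \<open>\<open>E\<close> supplies \<open>2 * \<eta>\<close> times the partial derivative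
    and \<open>\<i> * \<eta>\<^sup>2\<close> times \<open>g\<close>; both occur with the opposite
    sign in \<open>\<i>\<close> times the Laplacian.\<close>
  have cancel: "\<i> * laplacian (\<Theta> \<theta> t) x + E x = \<i> * \<Theta> (laplacian \<theta>) t x" for x
  proof -
    have "\<Theta> (laplacian \<theta>) t x = cis (\<eta> * x $ j) * laplacian g x"
      by (simp add: \<Theta>_def lg cis_mult[symmetric])
    then show ?thesis
      unfolding \<Theta>g laplacian_modulate[OF g] E_alt by (simp add: algebra_simps)
  qed
  have "((\<lambda>s. (\<integral>x. v s x * \<Theta> \<theta> t x \<partial>lborel) + (\<integral>x. v s x * (\<Theta> \<theta> s x - \<Theta> \<theta> t x) \<partial>lborel))
      has_vector_derivative \<i> * (\<integral>x. v t x * laplacian (\<Theta> \<theta> t) x \<partial>lborel) + (\<integral>x. v t x * E x \<partial>lborel)) (at t)"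
    unfolding \<Theta>_def E_def
    by (intro has_vector_derivative_add weak_free_pairing_derivative[OF v test[unfolded \<Theta>_def]]
      pairing_modulated_translate_derivative L weak_free_tendsto v \<theta>)
  moreover have "(\<integral>x. v s x * \<Theta> \<theta> t x \<partial>lborel) + (\<integral>x. v s x * (\<Theta> \<theta> s x - \<Theta> \<theta> t x) \<partial>lborel) =
      (\<integral>x. galilean \<eta> j v s x * \<theta> x \<partial>lborel)" for s
    using L2_mult_integrable[OF L[of s] test_functions_L2[OF test]] L2_mult_integrable[OF L[of s] test_functions_L2[OF test_s[of s]]]
    by (simp add: pairing[OF \<theta>] right_diff_distrib)
  moreover have "\<i> * (\<integral>x. v t x * laplacian (\<Theta> \<theta> t) x \<partial>lborel) + (\<integral>x. v t x * E x \<partial>lborel) =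
      \<i> * (\<integral>x. galilean \<eta> j v t x * laplacian \<theta> x \<partial>lborel)"
  proof -
    have "\<i> * (\<integral>x. v t x * laplacian (\<Theta> \<theta> t) x \<partial>lborel) + (\<integral>x. v t x * E x \<partial>lborel) =
        (\<integral>x. \<i> * (v t x * laplacian (\<Theta> \<theta> t) x) + v t x * E x \<partial>lborel)"
      using L2_mult_integrable[OF L[of t] test_functions_L2[OF test_functions_laplacian[OF test]]]
        L2_mult_integrable[OF L[of t] E] by simp
    moreover have "\<i> * (v t x * laplacian (\<Theta> \<theta> t) x) + v t x * E x = \<i> * (v t x * \<Theta> (laplacian \<theta>) t x)" for x
    proof -
      have "\<i> * (v t x * laplacian (\<Theta> \<theta> t) x) + v t x * E x = v t x * (\<i> * laplacian (\<Theta> \<theta> t) x + E x)"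
        by (simp add: algebra_simps)
      then show ?thesis unfolding cancel by (simp only: ac_simps)
    qed
    ultimately show ?thesis by (simp add: pairing[OF test_functions_laplacian[OF \<theta>]])
  qed
  ultimately show "((\<lambda>s. \<integral>x. galilean \<eta> j v s x * \<theta> x \<partial>lborel) has_vector_derivative
      \<i> * (\<integral>x. galilean \<eta> j v t x * laplacian \<theta> x \<partial>lborel)) (at t)"
    by simp
qed

subsection \<open>The pseudo-conformal transformation\<close>

text \<open>The branch chosen by \<open>k\<close> contributes a factor of modulus one, so norms do
  not see it.\<close>

lemma cmod_half_power: "t \<noteq> 0 \<Longrightarrow> cmod (half_power k n t) = \<bar>t\<bar> powr (real n / 2)"
  by (simp add: half_power_def norm_mult)

lemma cmod_pseudo_conformal:
  fixes u :: "real \<Rightarrow> real ^ 'n \<Rightarrow> complex"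
  assumes "t \<noteq> 0"
  shows "cmod (pseudo_conformal k u t x) = \<bar>t\<bar> powr - (real CARD('n) / 2) * cmod (u (1 / t) (0 + (1 / t) *\<^sub>R x))"
  using assms by (simp add: pseudo_conformal_def norm_mult norm_divide cmod_half_power powr_minus_divide)

lemma pseudo_conformal_L2:
  fixes u :: "real \<Rightarrow> real ^ 'n \<Rightarrow> complex"
  assumes "t \<noteq> 0" "u (1 / t) \<in> L2"
  shows "pseudo_conformal k u t \<in> L2"
proof -
  let ?m = "\<lambda>x::real^'n. 1 / half_power k CARD('n) t * exp (\<i> * of_real ((norm x)\<^sup>2 / (4 * t)))"
  have "(\<lambda>x. u (1 / t) (0 + (1 / t) *\<^sub>R x)) \<in> L2"
    using assms by (intro L2_affine) auto
  then have "(\<lambda>x. cnj (u (1 / t) ((1 / t) *\<^sub>R x))) \<in> L2" using L2_cnj by force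
  moreover have "?m \<in> borel_measurable borel"
    using assms(1) by (intro borel_measurable_continuous_onI continuous_intros) auto
  moreover have "cmod (?m x) \<le> cmod (1 / half_power k CARD('n) t)" for x
    by (simp only: norm_mult norm_exp_i_times mult_1_right order_refl)
  ultimately have "(\<lambda>x. ?m x * cnj (u (1 / t) ((1 / t) *\<^sub>R x))) \<in> L2" by (rule L2_mult_bounded)
  then show ?thesis by (simp add: pseudo_conformal_def[abs_def] ac_simps)
qed

text \<open>The prefactor compensates the Jacobian of the dilation, and the Gaussian phase has
  modulus one.\<close>

lemma pseudo_conformal_norm:
  fixes u :: "real \<Rightarrow> real ^ 'n \<Rightarrow> complex"
  assumes t: "t \<noteq> 0" and u: "u (1 / t) \<in> L2"
  shows "L2_norm (pseudo_conformal k u t) = L2_norm (u (1 / t))"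
proof -
  have "L2_norm (pseudo_conformal k u t) =
      L2_norm (\<lambda>x. of_real (\<bar>t\<bar> powr - (real CARD('n) / 2)) * u (1 / t) (0 + (1 / t) *\<^sub>R x))"
    by (rule L2_norm_cong_cmod) (use t in \<open>simp add: cmod_pseudo_conformal norm_mult\<close>)
  also have "\<dots> = \<bar>t\<bar> powr - (real CARD('n) / 2) * (\<bar>1 / t\<bar> powr - (real CARD('n) / 2) * L2_norm (u (1 / t)))"
    unfolding L2_norm_cmult using L2_norm_affine[OF _ u, of "1 / t" 0] t by simp
  also have "\<dots> = (\<bar>t\<bar> * \<bar>1 / t\<bar>) powr - (real CARD('n) / 2) * L2_norm (u (1 / t))"
    by (subst powr_mult) auto
  also have "\<bar>t\<bar> * \<bar>1 / t\<bar> = 1" using t by simp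
  finally show ?thesis by simp
qed

text \<open>Complex coefficients would come out conjugated; difference quotients involve real ones
  only.\<close>

lemma pseudo_conformal_real_combination:
  "pseudo_conformal k (\<lambda>t x. of_real a * u t x + of_real b * v t x) t x =
    of_real a * pseudo_conformal k u t x + of_real b * pseudo_conformal k v t x"
  by (simp add: pseudo_conformal_def algebra_simps)

lemma pseudo_conformal_diff:
  "pseudo_conformal k u t x - pseudo_conformal k v t x = pseudo_conformal k (\<lambda>t x. u t x - v t x) t x"
  by (simp add: pseudo_conformal_def algebra_simps)

text \<open>At time \<open>1 / t\<close> the boost displaces by \<open>2 * \<eta> / t\<close>, which
  the dilation turns into the constant \<open>2 * \<eta>\<close>. Conjugation gives the phase of the
  boost the sign with which it completes the square in
  \<open>(norm x)\<^sup>2 / (4 * t)\<close>.\<close>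

lemma pseudo_conformal_galilean:
  fixes v :: "real \<Rightarrow> real ^ 'n \<Rightarrow> complex"
  assumes t: "t \<noteq> 0"
  shows "pseudo_conformal k (galilean \<eta> j v) t x = pseudo_conformal k v t (x - (2 * \<eta>) *\<^sub>R axis j 1)"
proof -
  define y where "y = x - (2 * \<eta>) *\<^sub>R axis j (1::real)"
  have arg: "(1 / t) *\<^sub>R x - (2 * \<eta> * (1 / t)) *\<^sub>R axis j 1 = (1 / t) *\<^sub>R y"
    by (simp add: y_def scaleR_diff_right)
  have "(norm y)\<^sup>2 = (norm x)\<^sup>2 - 4 * \<eta> * x $ j + 4 * \<eta>\<^sup>2"
    unfolding y_def power2_norm_eq_inner
    by (simp add: inner_diff_left inner_diff_right inner_axis inner_axis' power2_eq_square algebra_simps)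
  then have phase: "(norm x)\<^sup>2 / (4 * t) - (\<eta> * ((1 / t) *\<^sub>R x) $ j - \<eta>\<^sup>2 * (1 / t)) = (norm y)\<^sup>2 / (4 * t)"
    using t by (simp add: field_simps)
  have "cnj (cis (\<eta> * ((1 / t) *\<^sub>R x) $ j - \<eta>\<^sup>2 * (1 / t))) * exp (\<i> * of_real ((norm x)\<^sup>2 / (4 * t))) =
      cis ((norm x)\<^sup>2 / (4 * t) - (\<eta> * ((1 / t) *\<^sub>R x) $ j - \<eta>\<^sup>2 * (1 / t)))"
    unfolding cis_conv_exp[symmetric] cis_cnj cis_mult by (simp only: add.commute diff_conv_add_uminus)
  also have "\<dots> = exp (\<i> * of_real ((norm y)\<^sup>2 / (4 * t)))"
    unfolding phase by (simp only: cis_conv_exp)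
  finally have boost: "cnj (cis (\<eta> * ((1 / t) *\<^sub>R x) $ j - \<eta>\<^sup>2 * (1 / t))) * exp (\<i> * of_real ((norm x)\<^sup>2 / (4 * t))) =
      exp (\<i> * of_real ((norm y)\<^sup>2 / (4 * t)))" .
  show ?thesis
    unfolding pseudo_conformal_def galilean_def arg complex_cnj_mult y_def[symmetric] boost[symmetric]
    by (simp only: ac_simps)
qed

subsection \<open>Scattering state and limit of the transformed solution\<close>

text \<open>A relation with an existential solution takes the place of the composed map from datum
  to limit, because no free propagator has been constructed. The filter \<open>F\<close> treats both
  one-sided limits at 0 at once.\<close>

definition pc_limit :: "int \<Rightarrow> real filter \<Rightarrow> (real ^ 'n \<Rightarrow> complex) \<Rightarrow> (real ^ 'n \<Rightarrow> complex) \<Rightarrow> bool" where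
  "pc_limit k F \<phi> w \<longleftrightarrow> \<phi> \<in> L2 \<and> w \<in> L2 \<and> (\<exists>v. weak_free v \<and> (AE x in lborel. v 0 x = \<phi> x) \<and>
    ((\<lambda>t. L2_norm (\<lambda>x. pseudo_conformal k v t x - w x)) \<longlongrightarrow> 0) F)"

text \<open>For every \<open>t\<close> other than 0 the transformed function has the norm of
  \<open>v (1 / t)\<close>, which is that of the datum by mass conservation; the limit inherits
  it.\<close>

lemma pc_limit_isometry:
  assumes F: "F \<noteq> bot" "eventually (\<lambda>t. t \<noteq> 0) F" and lim: "pc_limit k F \<phi> w"
  shows "L2_norm \<phi> = L2_norm w"
proof -
  obtain v where v: "weak_free v" "AE x in lborel. v 0 x = \<phi> x" and L: "\<phi> \<in> L2" "w \<in> L2"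
    and tend: "((\<lambda>t. L2_norm (\<lambda>x. pseudo_conformal k v t x - w x)) \<longlongrightarrow> 0) F"
    using lim by (auto simp: pc_limit_def)
  note vL = weak_free_L2[OF v(1)]
  have "eventually (\<lambda>t. pseudo_conformal k v t \<in> L2) F"
    using F(2) by eventually_elim (simp add: pseudo_conformal_L2 vL)
  then have "((\<lambda>t. L2_norm (pseudo_conformal k v t)) \<longlongrightarrow> L2_norm w) F"
    by (rule tendsto_L2_norm[OF tend L(2)])
  moreover have "eventually (\<lambda>t. L2_norm (pseudo_conformal k v t) = L2_norm \<phi>) F"
    using F(2)
  proof eventually_elim
    case (elim t)
    then show ?case
      using pseudo_conformal_norm[where u = v, OF elim vL] weak_free_norm_conserved[OF v(1), of "1 / t"]
        L2_norm_AE_cong[OF vL[of 0] L(1) v(2)] by simp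
  qed
  ultimately have "((\<lambda>t. L2_norm \<phi>) \<longlongrightarrow> L2_norm w) F"
    by (rule Lim_transform_eventually)
  then show ?thesis using F(1) by (simp add: tendsto_const_iff)
qed

lemma pc_limit_real_combination:
  assumes F: "eventually (\<lambda>t. t \<noteq> 0) F" and lim: "pc_limit k F \<phi>1 w1" "pc_limit k F \<phi>2 w2"
  shows "pc_limit k F (\<lambda>x. of_real a * \<phi>1 x + of_real b * \<phi>2 x) (\<lambda>x. of_real a * w1 x + of_real b * w2 x)"
proof -
  obtain v1 where v1: "weak_free v1" "AE x in lborel. v1 0 x = \<phi>1 x" and L1: "\<phi>1 \<in> L2" "w1 \<in> L2"
    and tend1: "((\<lambda>t. L2_norm (\<lambda>x. pseudo_conformal k v1 t x - w1 x)) \<longlongrightarrow> 0) F"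
    using lim(1) by (auto simp: pc_limit_def)
  obtain v2 where v2: "weak_free v2" "AE x in lborel. v2 0 x = \<phi>2 x" and L2: "\<phi>2 \<in> L2" "w2 \<in> L2"
    and tend2: "((\<lambda>t. L2_norm (\<lambda>x. pseudo_conformal k v2 t x - w2 x)) \<longlongrightarrow> 0) F"
    using lim(2) by (auto simp: pc_limit_def)
  define v where "v t x = of_real a * v1 t x + of_real b * v2 t x" for t x
  have "((\<lambda>t. L2_norm (\<lambda>x. pseudo_conformal k v t x - (of_real a * w1 x + of_real b * w2 x))) \<longlongrightarrow> 0) F"
  proof (rule Lim_null_comparison)
    show "\<forall>\<^sub>F t in F. norm (L2_norm (\<lambda>x. pseudo_conformal k v t x - (of_real a * w1 x + of_real b * w2 x)))
      \<le> \<bar>a\<bar> * L2_norm (\<lambda>x. pseudo_conformal k v1 t x - w1 x) + \<bar>b\<bar> * L2_norm (\<lambda>x. pseudo_conformal k v2 t x - w2 x)"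
      using F
    proof eventually_elim
      case (elim t)
      note d1 = L2_diff[OF pseudo_conformal_L2[where k = k and u = v1, OF elim weak_free_L2[OF v1(1)]] L1(2)]
      note d2 = L2_diff[OF pseudo_conformal_L2[where k = k and u = v2, OF elim weak_free_L2[OF v2(1)]] L2(2)]
      have "L2_norm (\<lambda>x. pseudo_conformal k v t x - (of_real a * w1 x + of_real b * w2 x)) =
        L2_norm (\<lambda>x. of_real a * (pseudo_conformal k v1 t x - w1 x) + of_real b * (pseudo_conformal k v2 t x - w2 x))"
        unfolding v_def pseudo_conformal_real_combination by (simp add: algebra_simps)
      also have "\<dots> \<le> \<bar>a\<bar> * L2_norm (\<lambda>x. pseudo_conformal k v1 t x - w1 x) + \<bar>b\<bar> * L2_norm (\<lambda>x. pseudo_conformal k v2 t x - w2 x)"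
        using L2_norm_triangle[OF L2_cmult[OF d1, of "of_real a"] L2_cmult[OF d2, of "of_real b"]]
        by (simp add: L2_norm_cmult)
      finally show ?case by simp
    qed
    show "((\<lambda>t. \<bar>a\<bar> * L2_norm (\<lambda>x. pseudo_conformal k v1 t x - w1 x) + \<bar>b\<bar> * L2_norm (\<lambda>x. pseudo_conformal k v2 t x - w2 x)) \<longlongrightarrow> 0) F"
      using tendsto_add[OF tendsto_mult_left[OF tend1] tendsto_mult_left[OF tend2]] by simp
  qed
  moreover have "weak_free v"
    unfolding v_def by (rule weak_free_linear_combination[OF v1(1) v2(1)])
  moreover have "AE x in lborel. v 0 x = of_real a * \<phi>1 x + of_real b * \<phi>2 x"
    using v1(2) v2(2) by eventually_elim (simp add: v_def)
  ultimately show ?thesis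
    unfolding pc_limit_def using L1 L2 by (intro conjI exI[of _ v] L2_add L2_cmult)
qed

text \<open>The boost acts as a modulation at time 0 and as one and the same translation at every
  transformed time, so the distances to the limit are unchanged.\<close>

lemma pc_limit_galilean:
  assumes F: "eventually (\<lambda>t. t \<noteq> 0) F" and lim: "pc_limit k F \<phi> w"
  shows "pc_limit k F (\<lambda>x. cis (\<eta> * x $ j) * \<phi> x) (\<lambda>x. w (x - (2 * \<eta>) *\<^sub>R axis j 1))"
proof -
  obtain v where v: "weak_free v" "AE x in lborel. v 0 x = \<phi> x" and L: "\<phi> \<in> L2" "w \<in> L2"
    and tend: "((\<lambda>t. L2_norm (\<lambda>x. pseudo_conformal k v t x - w x)) \<longlongrightarrow> 0) F"
    using lim by (auto simp: pc_limit_def)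
  have "((\<lambda>t. L2_norm (\<lambda>x. pseudo_conformal k (galilean \<eta> j v) t x - w (x - (2 * \<eta>) *\<^sub>R axis j 1))) \<longlongrightarrow> 0) F"
  proof (rule Lim_transform_eventually[OF tend], use F in eventually_elim)
    case (elim t)
    show ?case
      using L2_norm_translate[OF L2_diff[OF pseudo_conformal_L2[where k = k and u = v, OF elim weak_free_L2[OF v(1)]] L(2)],
          where a = "- ((2 * \<eta>) *\<^sub>R axis j 1)"]
      by (simp add: pseudo_conformal_galilean[OF elim])
  qed
  moreover have "AE x in lborel. galilean \<eta> j v 0 x = cis (\<eta> * x $ j) * \<phi> x"
    using v(2) by eventually_elim (simp add: galilean_def)
  moreover have "(\<lambda>x. cis (\<eta> * x $ j) * \<phi> x) \<in> L2"
    by (rule L2_mult_bounded[OF L(1), where C = 1])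
       (auto intro!: borel_measurable_continuous_onI continuous_intros)
  moreover have "(\<lambda>x. w (x - (2 * \<eta>) *\<^sub>R axis j 1)) \<in> L2"
    using L2_translate[OF L(2), of "- ((2 * \<eta>) *\<^sub>R axis j 1)"] by simp
  ultimately show ?thesis
    unfolding pc_limit_def using weak_free_galilean[OF v(1)] by blast
qed

section \<open>Difference quotients: second moment of the datum against gradient of the
  limit\<close>

lemma cis_minus_1_bound: "cmod (cis a - 1) \<le> \<bar>a\<bar>"
  using vector_derivative_mean_value_bound[OF convex_UNIV cis_line_has_vector_derivative[of 1], of 1 a 0]
  by (simp add: norm_mult)

lemma coordinate_mult_measurable:
  fixes f :: "real ^ 'n \<Rightarrow> complex"
  assumes "f \<in> L2"
  shows "(\<lambda>x. \<i> * of_real (x $ j) * f x) \<in> borel_measurable borel"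
proof -
  have "(\<lambda>x::real^'n. \<i> * complex_of_real (x $ j)) \<in> borel_measurable borel"
    by (intro borel_measurable_continuous_onI continuous_intros)
  then show ?thesis using L2_measurable[OF assms] by (rule borel_measurable_times)
qed

text \<open>The squared norm splits into coordinates. The factor \<open>\<i>\<close> is kept because
  the function is then exactly the derivative of \<open>cis (\<eta> * x $ j) * \<phi> x\<close> at
  \<open>\<eta> = 0\<close>.\<close>

lemma finite_second_moment_iff:
  assumes "\<phi> \<in> L2"
  shows "finite_second_moment \<phi> \<longleftrightarrow> (\<forall>j. (\<lambda>x. \<i> * of_real (x $ j) * \<phi> x) \<in> L2)"
proof -
  have square: "(cmod (\<i> * of_real (x $ j) * \<phi> x))\<^sup>2 = (x $ j)\<^sup>2 * (cmod (\<phi> x))\<^sup>2" for x j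
    by (simp add: norm_mult power_mult_distrib)
  have sum: "(norm x)\<^sup>2 * (cmod (\<phi> x))\<^sup>2 = (\<Sum>j\<in>UNIV. (cmod (\<i> * of_real (x $ j) * \<phi> x))\<^sup>2)" for x
    unfolding square by (simp add: norm_vec_def L2_set_def sum_nonneg sum_distrib_right)
  show ?thesis
  proof
    assume *: "finite_second_moment \<phi>"
    show "\<forall>j. (\<lambda>x. \<i> * of_real (x $ j) * \<phi> x) \<in> L2"
    proof (intro allI L2_dominated[OF coordinate_mult_measurable[OF assms]])
      show "integrable lborel (\<lambda>x. (norm x)\<^sup>2 * (cmod (\<phi> x))\<^sup>2)"
        using * by (simp add: finite_second_moment_def)
      show "(cmod (\<i> * of_real (x $ j) * \<phi> x))\<^sup>2 \<le> (norm x)\<^sup>2 * (cmod (\<phi> x))\<^sup>2" for x j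
        unfolding sum by (rule member_le_sum) auto
    qed
  next
    assume "\<forall>j. (\<lambda>x. \<i> * of_real (x $ j) * \<phi> x) \<in> L2"
    then show "finite_second_moment \<phi>"
      unfolding finite_second_moment_def sum by (intro Bochner_Integration.integrable_sum L2_square_integrable) simp
  qed
qed

lemma translated_pairing_has_derivative:
  fixes w :: "real ^ 'n \<Rightarrow> complex"
  assumes w: "w \<in> L2" and \<theta>: "\<theta> \<in> test_functions"
  shows "((\<lambda>s. \<integral>x. w x * \<theta> (x + s *\<^sub>R axis j 1) \<partial>lborel) has_vector_derivative
    (\<integral>x. w x * partial j \<theta> (x + t *\<^sub>R axis j 1) \<partial>lborel)) (at t)"
proof -
  have "((\<lambda>s. L2_norm (\<lambda>x. w x - w x)) \<longlongrightarrow> 0) (at t)" by (simp add: L2_norm_def)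
  from pairing_modulated_translate_derivative[where v = "\<lambda>s. w" and \<alpha> = 0 and \<eta> = 0 and \<beta> = 1 and j = j, OF w this \<theta>]
  have "((\<lambda>s. \<integral>x. w x * (\<theta> (x + s *\<^sub>R axis j 1) - \<theta> (x + t *\<^sub>R axis j 1)) \<partial>lborel) has_vector_derivative
      (\<integral>x. w x * partial j \<theta> (x + t *\<^sub>R axis j 1) \<partial>lborel)) (at t)" by simp
  moreover have "(\<integral>x. w x * (\<theta> (x + s *\<^sub>R axis j 1) - \<theta> (x + t *\<^sub>R axis j 1)) \<partial>lborel) =
      (\<integral>x. w x * \<theta> (x + s *\<^sub>R axis j 1) \<partial>lborel) - (\<integral>x. w x * \<theta> (x + t *\<^sub>R axis j 1) \<partial>lborel)" for s
    using L2_mult_integrable[OF w test_functions_L2[OF test_functions_translate[OF \<theta>]], of "s *\<^sub>R axis j 1"]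
      L2_mult_integrable[OF w test_functions_L2[OF test_functions_translate[OF \<theta>]], of "t *\<^sub>R axis j 1"]
    by (simp add: right_diff_distrib)
  ultimately show ?thesis by (simp add: has_vector_derivative_diff_const)
qed

text \<open>Discrete integration by parts: the translation passes from \<open>w\<close> to the test
  function with the opposite sign.\<close>

lemma difference_quotient_pairing:
  fixes w :: "real ^ 'n \<Rightarrow> complex"
  assumes w: "w \<in> L2" and \<theta>: "\<theta> \<in> test_functions"
  shows "(\<integral>x. (of_real a * w (x - b) + of_real (- a) * w x) * \<theta> x \<partial>lborel) =
    of_real a * ((\<integral>x. w x * \<theta> (x + b) \<partial>lborel) - (\<integral>x. w x * \<theta> x \<partial>lborel))"
proof -
  note L\<theta> = test_functions_L2[OF \<theta>]
  have wb: "(\<lambda>x. w (x - b)) \<in> L2" using L2_translate[OF w, of "- b"] by simp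
  have "(\<integral>x. w (x - b) * \<theta> x \<partial>lborel) = (\<integral>x. w x * \<theta> (x + b) \<partial>lborel)"
    using lborel_integral_translate[of "\<lambda>x. w (x - b) * \<theta> x" b] L2_measurable[OF wb] test_functions_measurable[OF \<theta>]
    by simp
  then show ?thesis
    using L2_mult_integrable[OF wb L\<theta>] L2_mult_integrable[OF w L\<theta>]
    by (simp add: distrib_right mult.assoc right_diff_distrib left_diff_distrib)
qed

text \<open>The difference quotients \<open>q j m\<close> and \<open>r j m\<close> below tend to \<open>\<i> x\<^sub>j \<phi>\<close> and \<open>- 2 \<partial>\<^sub>j w\<close>.\<close>

lemma pc_limit_moment_iff_gradient:
  fixes \<phi> w :: "real ^ 'n \<Rightarrow> complex"
  assumes F: "F \<noteq> bot" "eventually (\<lambda>t. t \<noteq> 0) F" and lim: "pc_limit k F \<phi> w"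
  shows "finite_second_moment \<phi> \<longleftrightarrow> in_H1_dot w"
proof -
  define \<eta> where "\<eta> m = inverse (real (Suc m))" for m
  have \<eta>: "\<eta> m > 0" for m by (simp add: \<eta>_def)
  have \<eta>_lim: "\<eta> \<longlonglongrightarrow> 0" unfolding \<eta>_def by (rule LIMSEQ_inverse_real_of_nat)
  define q where "q j m x = of_real (1 / \<eta> m) * (cis (\<eta> m * x $ j) * \<phi> x) + of_real (- (1 / \<eta> m)) * \<phi> x" for j m x
  define r where "r j m x = of_real (1 / \<eta> m) * w (x - (2 * \<eta> m) *\<^sub>R axis j 1) + of_real (- (1 / \<eta> m)) * w x" for j m x
  have L: "\<phi> \<in> L2" "w \<in> L2" using lim by (auto simp: pc_limit_def)
  have pc: "pc_limit k F (q j m) (r j m)" for j m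
    unfolding q_def r_def by (intro pc_limit_real_combination pc_limit_galilean F lim)
  have qL: "q j m \<in> L2" and rL: "r j m \<in> L2" for j m
    using pc by (auto simp: pc_limit_def)
  have norm_eq: "L2_norm (q j m) = L2_norm (r j m)" for j m
    by (rule pc_limit_isometry[OF F pc])
  \<comment> \<open>Differences of quotients are again related by the correspondence; this is what
    transports the Cauchy property.\<close>
  have norm_diff_eq: "L2_norm (\<lambda>x. q j m x - q j l x) = L2_norm (\<lambda>x. r j m x - r j l x)" for j m l
    using pc_limit_isometry[OF F pc_limit_real_combination[OF F(2) pc[of j m] pc[of j l], of 1 "- 1"]] by simp
  have q_alt: "q j m x = (cis (\<eta> m * x $ j) - 1) / of_real (\<eta> m) * \<phi> x" for j m x
    using \<eta>[of m] by (simp add: q_def field_simps)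
  have q_lim: "(\<lambda>m. q j m x) \<longlonglongrightarrow> \<i> * of_real (x $ j) * \<phi> x" for j x
  proof -
    have at0: "filterlim \<eta> (at 0) sequentially"
      using \<eta>_lim \<eta> by (auto simp: filterlim_at intro!: always_eventually less_imp_neq[symmetric])
    have "((\<lambda>s. (cis (x $ j * s) - cis (x $ j * 0)) / of_real (s - 0)) \<longlongrightarrow> \<i> * of_real (x $ j) * cis (x $ j * 0)) (at 0)"
      using cis_line_has_vector_derivative[of "x $ j" 0] unfolding has_vector_derivative_iff_quotient .
    from tendsto_mult_right[OF filterlim_compose[OF this at0], of "\<phi> x"] show ?thesis
      by (simp add: q_alt mult.commute)
  qed
  have r_pairing: "(\<integral>x. r j m x * \<theta> x \<partial>lborel) =
      of_real (1 / \<eta> m) * ((\<integral>x. w x * \<theta> (x + (2 * \<eta> m) *\<^sub>R axis j 1) \<partial>lborel) - (\<integral>x. w x * \<theta> x \<partial>lborel))"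
    if "\<theta> \<in> test_functions" for j m \<theta>
    unfolding r_def by (rule difference_quotient_pairing[OF L(2) that])
  show ?thesis
  proof
    assume "finite_second_moment \<phi>"
    then have X: "(\<lambda>x. \<i> * of_real (x $ j) * \<phi> x) \<in> L2" for j
      using finite_second_moment_iff[OF L(1)] by blast
    have "\<exists>g. g \<in> L2 \<and> (\<forall>\<theta>\<in>test_functions. (\<integral>x. w x * partial j \<theta> x \<partial>lborel) = - (\<integral>x. g x * \<theta> x \<partial>lborel))" for j
    proof -
      \<comment> \<open>The bound \<open>\<bar>cis a - 1\<bar> \<le> \<bar>a\<bar>\<close> makes the
        quotients no larger than their limit, so the squared error is dominated with the factor
        4.\<close>
      have "(\<lambda>m. L2_norm (\<lambda>x. q j m x - \<i> * of_real (x $ j) * \<phi> x)) \<longlonglongrightarrow> 0"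
      proof (rule L2_dominated_convergence)
        show "integrable lborel (\<lambda>x. 4 * (cmod (\<i> * of_real (x $ j) * \<phi> x))\<^sup>2)"
          using X[of j] by (simp add: L2_iff)
        show "AE x in lborel. (cmod (q j m x - \<i> * of_real (x $ j) * \<phi> x))\<^sup>2 \<le> 4 * (cmod (\<i> * of_real (x $ j) * \<phi> x))\<^sup>2" for m
        proof (intro AE_I2)
          fix x
          have "cmod (q j m x) = cmod (cis (\<eta> m * x $ j) - 1) / \<eta> m * cmod (\<phi> x)"
            using \<eta>[of m] by (simp add: q_alt norm_mult norm_divide)
          also have "\<dots> \<le> \<bar>\<eta> m * x $ j\<bar> / \<eta> m * cmod (\<phi> x)"
            using \<eta>[of m] by (intro mult_right_mono divide_right_mono cis_minus_1_bound) auto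
          also have "\<dots> = cmod (\<i> * of_real (x $ j) * \<phi> x)"
            using \<eta>[of m] by (simp add: norm_mult abs_mult)
          finally have "cmod (q j m x - \<i> * of_real (x $ j) * \<phi> x) \<le> 2 * cmod (\<i> * of_real (x $ j) * \<phi> x)"
            using norm_triangle_ineq4[of "q j m x" "\<i> * of_real (x $ j) * \<phi> x"] by linarith
          from power_mono[OF this, of 2]
          show "(cmod (q j m x - \<i> * of_real (x $ j) * \<phi> x))\<^sup>2 \<le> 4 * (cmod (\<i> * of_real (x $ j) * \<phi> x))\<^sup>2"
            unfolding power_mult_distrib by simp
        qed
      qed (use q_lim in \<open>auto intro: L2_measurable qL X\<close>)
      note q_L2_lim = this
      \<comment> \<open>The quotients of the datum converge, hence are Cauchy; by the isometry so
        are those of \<open>w\<close>, and completeness supplies the limit \<open>R\<close>.\<close>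
      obtain R where R: "R \<in> L2" "(\<lambda>m. L2_norm (\<lambda>x. r j m x - R x)) \<longlonglongrightarrow> 0"
      proof (rule L2_complete[of "r j", OF rL, THEN bexE])
        fix e :: real assume "e > 0"
        then have "e / 2 > 0" by simp
        then obtain N where N: "\<And>m. m \<ge> N \<Longrightarrow> L2_norm (\<lambda>x. q j m x - \<i> * of_real (x $ j) * \<phi> x) < e / 2"
          using order_tendstoD(2)[OF q_L2_lim] unfolding eventually_sequentially by blast
        have "L2_norm (\<lambda>x. r j m x - r j l x) \<le> e" if "m \<ge> N" "l \<ge> N" for m l
          using L2_norm_triangle_diff[OF qL[of j m] X[of j] qL[of j l]] N[OF that(1)] N[OF that(2)]
            L2_norm_minus_commute[of "q j l" "\<lambda>x. \<i> * of_real (x $ j) * \<phi> x"]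
          by (simp flip: norm_diff_eq)
        then show "\<exists>N. \<forall>m\<ge>N. \<forall>l\<ge>N. L2_norm (\<lambda>x. r j m x - r j l x) \<le> e" by blast
      qed (blast intro: that)
      \<comment> \<open>\<open>R\<close> is \<open>- 2\<close> times the derivative of
        \<open>w\<close>: the translation subtracts \<open>2 * \<eta> m\<close> from the argument
        while the quotient divides by \<open>\<eta> m\<close>.\<close>
      have "(\<integral>x. w x * partial j \<theta> x \<partial>lborel) = - (\<integral>x. - (1 / 2) * R x * \<theta> x \<partial>lborel)" if \<theta>: "\<theta> \<in> test_functions" for \<theta>
      proof -
        define P where "P s = (\<integral>x. w x * \<theta> (x + s *\<^sub>R axis j 1) \<partial>lborel)" for s
        have "(P has_vector_derivative (\<integral>x. w x * partial j \<theta> x \<partial>lborel)) (at 0)"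
          using translated_pairing_has_derivative[OF L(2) \<theta>, of j 0] by (simp add: P_def[abs_def])
        then have quot: "((\<lambda>s. (P s - P 0) / of_real (s - 0)) \<longlongrightarrow> (\<integral>x. w x * partial j \<theta> x \<partial>lborel)) (at 0)"
          unfolding has_vector_derivative_iff_quotient .
        have "(\<lambda>m. 2 * \<eta> m) \<longlonglongrightarrow> 2 * 0" by (intro tendsto_intros \<eta>_lim)
        then have at0: "filterlim (\<lambda>m. 2 * \<eta> m) (at 0) sequentially"
          using \<eta> by (auto simp: filterlim_at intro!: always_eventually less_imp_neq[symmetric])
        have "(\<lambda>m. 2 * ((P (2 * \<eta> m) - P 0) / of_real (2 * \<eta> m - 0))) \<longlonglongrightarrow> 2 * (\<integral>x. w x * partial j \<theta> x \<partial>lborel)"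
          by (intro tendsto_mult_left filterlim_compose[OF quot at0])
        moreover have "2 * ((P (2 * \<eta> m) - P 0) / of_real (2 * \<eta> m - 0)) = (\<integral>x. r j m x * \<theta> x \<partial>lborel)" for m
          unfolding r_pairing[OF \<theta>] using \<eta>[of m] by (simp add: P_def field_simps)
        moreover have "(\<lambda>m. \<integral>x. r j m x * \<theta> x \<partial>lborel) \<longlonglongrightarrow> (\<integral>x. R x * \<theta> x \<partial>lborel)"
          by (rule tendsto_integral_L2_mult[OF R(2,1) always_eventually[OF allI[OF rL]] test_functions_L2[OF \<theta>]])
        ultimately have "2 * (\<integral>x. w x * partial j \<theta> x \<partial>lborel) = (\<integral>x. R x * \<theta> x \<partial>lborel)"
          using LIMSEQ_unique by simp
        then show ?thesis by (simp add: mult.assoc mult.commute[of _ "2::complex"])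
      qed
      moreover have "(\<lambda>x. - (1 / 2) * R x) \<in> L2" by (rule L2_cmult[OF R(1)])
      ultimately show ?thesis by blast
    qed
    then show "in_H1_dot w" unfolding in_H1_dot_def L2_gradient_def by metis
  next
    assume "in_H1_dot w"
    then obtain G where G: "\<And>j. G j \<in> L2"
        "\<And>j \<theta>. \<theta> \<in> test_functions \<Longrightarrow> (\<integral>x. w x * partial j \<theta> x \<partial>lborel) = - (\<integral>x. G j x * \<theta> x \<partial>lborel)"
      unfolding in_H1_dot_def L2_gradient_def by blast
    \<comment> \<open>For the converse the quotients of \<open>w\<close> are bounded by duality and
      the mean value inequality, the bound passes to the quotients of the datum, and Fatou applies
      to their pointwise limit.\<close>
    have "(\<lambda>x. \<i> * of_real (x $ j) * \<phi> x) \<in> L2" for j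
    proof (rule L2_liminf(1)[of "q j", OF qL])
      show "(\<lambda>x. \<i> * of_real (x $ j) * \<phi> x) \<in> borel_measurable borel"
        by (rule coordinate_mult_measurable[OF L(1)])
      show "AE x in lborel. (\<lambda>m. q j m x) \<longlonglongrightarrow> \<i> * of_real (x $ j) * \<phi> x"
        by (intro AE_I2 q_lim)
      show "L2_norm (q j m) \<le> 2 * L2_norm (G j)" for m
        unfolding norm_eq
      proof (rule L2_norm_le_by_duality[OF rL])
        fix \<theta> :: "real ^ 'n \<Rightarrow> complex" assume \<theta>: "\<theta> \<in> test_functions"
        define P where "P s = (\<integral>x. w x * \<theta> (x + s *\<^sub>R axis j 1) \<partial>lborel)" for s
        have "cmod (P (2 * \<eta> m) - P 0) \<le> (L2_norm (G j) * L2_norm \<theta>) * \<bar>2 * \<eta> m - 0\<bar>"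
        proof (rule vector_derivative_mean_value_bound[OF convex_UNIV])
          fix s
          show "(P has_vector_derivative (\<integral>x. w x * partial j \<theta> (x + s *\<^sub>R axis j 1) \<partial>lborel)) (at s)"
            unfolding P_def by (rule translated_pairing_has_derivative[OF L(2) \<theta>])
          note \<theta>s = test_functions_translate[OF \<theta>, of "s *\<^sub>R axis j 1"]
          have "(\<integral>x. w x * partial j \<theta> (x + s *\<^sub>R axis j 1) \<partial>lborel) = - (\<integral>x. G j x * \<theta> (x + s *\<^sub>R axis j 1) \<partial>lborel)"
            using G(2)[OF \<theta>s, of j] by (simp add: partial_translate test_functions_differentiable \<theta>)
          then show "cmod (\<integral>x. w x * partial j \<theta> (x + s *\<^sub>R axis j 1) \<partial>lborel) \<le> L2_norm (G j) * L2_norm \<theta>"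
            using L2_Cauchy_Schwarz[OF G(1) test_functions_L2[OF \<theta>s], of j]
            by (simp add: L2_norm_translate[OF test_functions_L2[OF \<theta>]])
        qed auto
        then have "1 / \<eta> m * cmod (P (2 * \<eta> m) - P 0) \<le> 1 / \<eta> m * ((L2_norm (G j) * L2_norm \<theta>) * (2 * \<eta> m))"
          using \<eta>[of m] by (intro mult_left_mono) auto
        then show "cmod (\<integral>x. r j m x * \<theta> x \<partial>lborel) \<le> 2 * L2_norm (G j) * L2_norm \<theta>"
          unfolding r_pairing[OF \<theta>] using \<eta>[of m] by (simp add: P_def norm_mult norm_divide mult.assoc)
      qed simp
    qed
    then show "finite_second_moment \<phi>" using finite_second_moment_iff[OF L(1)] by blast
  qed
qed

text \<open>Since the transformation is isometric, replacing \<open>u\<close> by \<open>v\<close>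
  changes the transformed function at \<open>t\<close> by the scattering error at time
  \<open>inverse t\<close>. The map \<open>inverse\<close> carries the approach \<open>F\<close> to
  0 into the approach \<open>H\<close> to infinite time.\<close>

lemma pc_limit_of_scattering:
  fixes u v :: "real \<Rightarrow> real ^ 'n \<Rightarrow> complex"
  assumes u: "\<And>t. u t \<in> L2" and \<phi>: "\<phi> \<in> L2" "free_evolution \<phi> v" and w: "w \<in> L2"
    and scatter: "((\<lambda>t. L2_norm (\<lambda>x. u t x - v t x)) \<longlongrightarrow> 0) H" and FH: "filterlim inverse H F"
    and F: "eventually (\<lambda>t. t \<noteq> 0) F"
    and lim: "((\<lambda>t. L2_norm (\<lambda>x. pseudo_conformal k u t x - w x)) \<longlongrightarrow> 0) F"
  shows "pc_limit k F \<phi> w"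
proof -
  have v: "weak_free v" "AE x in lborel. v 0 x = \<phi> x"
    using \<phi>(2) by (auto simp: free_evolution_def weak_free_def)
  note vL = weak_free_L2[OF v(1)]
  have "((\<lambda>t. L2_norm (\<lambda>x. pseudo_conformal k v t x - w x)) \<longlongrightarrow> 0) F"
  proof (rule Lim_null_comparison)
    show "\<forall>\<^sub>F t in F. norm (L2_norm (\<lambda>x. pseudo_conformal k v t x - w x)) \<le>
        L2_norm (\<lambda>x. u (inverse t) x - v (inverse t) x) + L2_norm (\<lambda>x. pseudo_conformal k u t x - w x)"
      using F
    proof eventually_elim
      case (elim t)
      have "L2_norm (\<lambda>x. pseudo_conformal k u t x - pseudo_conformal k v t x) = L2_norm (\<lambda>x. u (1 / t) x - v (1 / t) x)"
        unfolding pseudo_conformal_diff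
        using pseudo_conformal_norm[where u = "\<lambda>t x. u t x - v t x" and k = k, OF elim] L2_diff[OF u vL] by simp
      then show ?case
        using L2_norm_triangle_diff[OF pseudo_conformal_L2[where u = v and k = k, OF elim vL]
            pseudo_conformal_L2[where u = u and k = k, OF elim u] w]
          L2_norm_minus_commute[of "pseudo_conformal k u t" "pseudo_conformal k v t"]
        by (simp add: inverse_eq_divide)
    qed
    show "((\<lambda>t. L2_norm (\<lambda>x. u (inverse t) x - v (inverse t) x) + L2_norm (\<lambda>x. pseudo_conformal k u t x - w x)) \<longlongrightarrow> 0) F"
      using tendsto_add[OF filterlim_compose[OF scatter FH] lim] by simp
  qed
  then show ?thesis unfolding pc_limit_def using \<phi>(1) w v by blast
qed

theorem theorem1p4:
  fixes \<phi> :: "real ^ 'n \<Rightarrow> complex"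
    and u :: "real \<Rightarrow> real ^ 'n \<Rightarrow> complex"
    and p :: real
    and k :: int
  assumes "\<phi> \<in> Sigma_space"
    and "0 < p" and "p < 4 / real CARD('n)"
    and "nls_solution p \<phi> u"
  shows
    "(\<forall>\<phi>p vp wp.
        \<phi>p \<in> L2 \<and> free_evolution \<phi>p vp \<and>
        ((\<lambda>t. L2_norm (\<lambda>x. u t x - vp t x)) \<longlongrightarrow> 0) at_top \<and>
        wp \<in> L2 \<and>
        ((\<lambda>t. L2_norm (\<lambda>x. pseudo_conformal k u t x - wp x)) \<longlongrightarrow> 0) (at_right 0) \<longrightarrow>
        (finite_second_moment \<phi>p \<longleftrightarrow> in_H1_dot wp)) \<and>
     (\<forall>\<phi>m vm wm.
        \<phi>m \<in> L2 \<and> free_evolution \<phi>m vm \<and>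
        ((\<lambda>t. L2_norm (\<lambda>x. u t x - vm t x)) \<longlongrightarrow> 0) at_bot \<and>
        wm \<in> L2 \<and>
        ((\<lambda>t. L2_norm (\<lambda>x. pseudo_conformal k u t x - wm x)) \<longlongrightarrow> 0) (at_left 0) \<longrightarrow>
        (finite_second_moment \<phi>m \<longleftrightarrow> in_H1_dot wm))"
proof -
  have u: "u t \<in> L2" for t
    using assms(4) by (auto simp: nls_solution_def continuous_in_H1_def H1_def)
  have ev: "eventually (\<lambda>t::real. t \<noteq> 0) (at_right 0)" "eventually (\<lambda>t::real. t \<noteq> 0) (at_left 0)"
    by (auto simp: eventually_at_filter)
  \<comment> \<open>The two signs are two instances: inversion sends \<open>at_right 0\<close> to
    \<open>at_top\<close> and \<open>at_left 0\<close> to \<open>at_bot\<close>.\<close>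
  note top = pc_limit_of_scattering[where u = u and k = k, OF u _ _ _ _ filterlim_inverse_at_top_right ev(1)]
  note bot = pc_limit_of_scattering[where u = u and k = k, OF u _ _ _ _ filterlim_inverse_at_bot_neg ev(2)]
  show ?thesis
    using pc_limit_moment_iff_gradient[OF trivial_limit_at_right_real ev(1) top]
      pc_limit_moment_iff_gradient[OF trivial_limit_at_left_real ev(2) bot]
    by blast
qed

end
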